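(* Let $(W,\Phi)$ be an $L$-twisted $\mathrm{SL}(n,\mathbb C)$-Higgs pair over a compact Riemann surface $X$. (1) $(W,\Phi)$ is semistable if and only if for any subbundle $W'\subset W$ such that $\Phi(W')\subset L\otimes W'$ we have $\deg W'\le0$. (2) $(W,\Phi)$ is stable if for any nonzero and strict subbundle $W'\subset W$ such that $\Phi(W')\subset L\otimes W'$ we have $\deg W'<0$. (3) $(W,\Phi)$ is polystable if it is semistable and for each subbundle $W'\subset W$ such that $\Phi(W')\subset L\otimes W'$ and $\deg W'=0$ there is another subbundle $W''\subset W$ satisfying $\Phi(W'')\subset L\otimes W''$ and $W=W'\oplus W''$.
   Context: $L$ is a holomorphic line bundle on $X$. An $L$-twisted $\mathrm{SL}(n,\mathbb C)$-Higgs pair consists of a rank $n$ holomorphic vector bundle $W$ with a trivialization $\det W\simeq\mathcal O$ and $\Phi\in H^0(L\otimes\mathrm{End}_0W)$, $\mathrm{End}_0W$ being the bundle of traceless endomorphisms. Subbundles are holomorphic. For a filtration by holomorphic subbundles $\mathcal W=(0=W_0\subsetneq W_1\subsetneq\dots\subsetneq W_k=W)$ let $\Lambda(\mathcal W)$ be the set of $(\lambda_1,\dots,\lambda_k)\in\mathbb R^k$ with $\lambda_i\le\lambda_{i+1}$ for all $i$ and $\sum_{i=1}^k\mathrm{rk}\,W_i\,(\lambda_i-\lambda_{i+1})=0$, where $\lambda_{k+1}:=0$ (equivalently $\sum_i\lambda_i\,\mathrm{rk}(W_i/W_{i-1})=0$). For $\lambda\in\Lambda(\mathcal W)$ let $N(\mathcal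 W,\lambda)\subset L\otimes\mathrm{End}_0W$ be the subbundle of those $\Phi$ with $\Phi(W_i)\subset L\otimes W_i$ for every $i<k$ with $\lambda_i<\lambda_{i+1}$, and let $d(\mathcal W,\lambda)=\sum_{j=1}^{k-1}(\lambda_j-\lambda_{j+1})\deg W_j$. $(W,\Phi)$ is: - semistable if $d(\mathcal W,\lambda)\ge0$ for every $\mathcal W$ and $\lambda\in\Lambda(\mathcal W)$ with $\Phi\in H^0(N(\mathcal W,\lambda))$; - stable if it is semistable and $d(\mathcal W,\lambda)>0$ for every $\mathcal W$ and $\lambda\in\Lambda(\mathcal W)$ not identically zero with $\Phi\in H^0(N(\mathcal W,\lambda))$; - polystable if it is semistable and for every $\mathcal W$ and $\lambda\in\Lambda(\mathcal W)$ with $\lambda_i<\lambda_{i+1}$ for each $i$, $\Phi\in H^0(N(\mathcal W,\lambda))$ and $d(\mathcal W,\lambda)=0$, there is an isomorphism $W\simeq W_1\oplus W_2/W_1\oplus\dots\oplus W_k/W_{k-1}$ (under which $W_j$ corresponds to the sum of the first $j$ summands) with respect to which $\Phi\in H^0(\bigoplus_iL\otimes\mathrm{Hom}(W_i/W_{i-1},W_i/W_{i-1}))$. *)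

theory Defs
  imports
    "HOL-Complex_Analysis.Complex_Analysis"
    "Jordan_Normal_Form.Determinant"
begin

hide_type (open) Finite_Cartesian_Product.vec
hide_const (open) Finite_Cartesian_Product.vec Determinants.det
no_notation Finite_Cartesian_Product.vec_nth (infixl "$" 90)

section \<open>Riemann surfaces\<close>

type_synonym 'x coord = "'x set \<times> ('x \<Rightarrow> complex)"

text \<open>A Riemann surface is the whole of a Hausdorff type with an atlas of complex coordinates
  \<open>(U, z)\<close>; as usual, Riemann surfaces are connected.\<close>

locale compact_riemann_surface =
  fixes A :: "'x::t2_space coord set"
  assumes coord_homeo: "(U, z) \<in> A \<Longrightarrow> open U \<and> open (z ` U) \<and> homeomorphism U (z ` U) z (the_inv_into U z)"
    and coord_cover: "(\<Union>c\<in>A. fst c) = UNIV"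
    and coord_compat: "(U, z) \<in> A \<Longrightarrow> (V, w) \<in> A \<Longrightarrow> (w \<circ> the_inv_into U z) holomorphic_on z ` (U \<inter> V)"
    and connected_surface: "connected (UNIV :: 'x set)"
    and compact_surface: "compact (UNIV :: 'x set)"

definition hol_fun_on :: "'x::t2_space coord set \<Rightarrow> ('x \<Rightarrow> complex) \<Rightarrow> 'x set \<Rightarrow> bool" where
  "hol_fun_on A f U \<longleftrightarrow> (\<forall>(V, z)\<in>A. (f \<circ> the_inv_into V z) holomorphic_on z ` (U \<inter> V))"

definition hol_mat_on :: "'x::t2_space coord set \<Rightarrow> nat \<Rightarrow> nat \<Rightarrow> ('x \<Rightarrow> complex mat) \<Rightarrow> 'x set \<Rightarrow> bool" where
  "hol_mat_on A m n M U \<longleftrightarrow> (\<forall>x\<in>U. M x \<in> carrier_mat m n) \<and>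
     (\<forall>i<m. \<forall>j<n. hol_fun_on A (\<lambda>x. M x $$ (i, j)) U)"

section \<open>Holomorphic vector bundles\<close>

text \<open>A bundle consists of its fibres and of local trivializations \<open>(U, \<phi>)\<close>, where \<open>\<phi> x\<close>, for
  \<open>x \<in> U\<close>, identifies the fibre over \<open>x\<close> with the space of complex column vectors of length the rank.
  The transition functions of a holomorphic bundle are invertible holomorphic matrices; the
  vector space structure of the fibres is the one transported from the trivializations. Different
  fibres need not be disjoint: a point of the total space is a pair \<open>(x, v)\<close> with \<open>v \<in> fibre E x\<close>.\<close>

type_synonym ('x, 'v) triv = "'x set \<times> ('x \<Rightarrow> 'v \<Rightarrow> complex vec)"

record ('x, 'v) vbundle =
  vb_rank :: nat
  fibre :: "'x \<Rightarrow> 'v set"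
  trivs :: "('x, 'v) triv set"

definition trivs_at :: "('x, 'v) vbundle \<Rightarrow> 'x \<Rightarrow> ('x, 'v) triv set" where
  "trivs_at E x = {c \<in> trivs E. x \<in> fst c}"

text \<open>The local holomorphic trivializations of \<open>E\<close>, i.e. the members of the maximal bundle atlas.
  The matrix \<open>g x\<close> is automatically invertible, since both trivializations are bijective.\<close>

definition hol_triv :: "'x::t2_space coord set \<Rightarrow> ('x, 'v) vbundle \<Rightarrow> ('x, 'v) triv \<Rightarrow> bool" where
  "hol_triv A E c \<longleftrightarrow> open (fst c) \<and>
     (\<forall>x\<in>fst c. bij_betw (snd c x) (fibre E x) (carrier_vec (vb_rank E))) \<and>
     (\<forall>b\<in>trivs E. \<exists>g. hol_mat_on A (vb_rank E) (vb_rank E) g (fst b \<inter> fst c) \<and>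
        (\<forall>x\<in>fst b \<inter> fst c. \<forall>v\<in>fibre E x. snd c x v = g x *\<^sub>v snd b x v))"

definition hol_vbundle :: "'x::t2_space coord set \<Rightarrow> ('x, 'v) vbundle \<Rightarrow> bool" where
  "hol_vbundle A E \<longleftrightarrow> (\<forall>c\<in>trivs E. hol_triv A E c) \<and> (\<Union>c\<in>trivs E. fst c) = UNIV"

definition hol_line_bundle :: "'x::t2_space coord set \<Rightarrow> ('x, 'v) vbundle \<Rightarrow> bool" where
  "hol_line_bundle A E \<longleftrightarrow> hol_vbundle A E \<and> vb_rank E = 1"

definition fibre_add :: "('x, 'v) vbundle \<Rightarrow> 'x \<Rightarrow> 'v \<Rightarrow> 'v \<Rightarrow> 'v" where
  "fibre_add E x v w = (THE u. u \<in> fibre E x \<and> (\<exists>c\<in>trivs_at E x. snd c x u = snd c x v + snd c x w))"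

definition zero_sub :: "('x, 'v) vbundle \<Rightarrow> 'x \<Rightarrow> 'v set" where
  "zero_sub E x = {v \<in> fibre E x. \<exists>c\<in>trivs_at E x. snd c x v = 0\<^sub>v (vb_rank E)}"

definition vb_hom ::
  "'x::t2_space coord set \<Rightarrow> ('x, 'v) vbundle \<Rightarrow> ('x, 'w) vbundle \<Rightarrow> ('x \<Rightarrow> 'v \<Rightarrow> 'w) \<Rightarrow> bool" where
  "vb_hom A E F h \<longleftrightarrow> (\<forall>x. h x ` fibre E x \<subseteq> fibre F x) \<and>
     (\<forall>b\<in>trivs E. \<forall>c\<in>trivs F. \<exists>M. hol_mat_on A (vb_rank F) (vb_rank E) M (fst b \<inter> fst c) \<and>
        (\<forall>x\<in>fst b \<inter> fst c. \<forall>v\<in>fibre E x. snd c x (h x v) = M x *\<^sub>v snd b x v))"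

definition vb_iso ::
  "'x::t2_space coord set \<Rightarrow> ('x, 'v) vbundle \<Rightarrow> ('x, 'w) vbundle \<Rightarrow> ('x \<Rightarrow> 'v \<Rightarrow> 'w) \<Rightarrow> bool" where
  "vb_iso A E F h \<longleftrightarrow> vb_hom A E F h \<and> (\<forall>x. bij_betw (h x) (fibre E x) (fibre F x))"

definition trivial_line_bundle :: "('x, complex) vbundle" where
  "trivial_line_bundle =
     \<lparr>vb_rank = 1, fibre = (\<lambda>_. UNIV), trivs = {(UNIV, \<lambda>_ a. vec 1 (\<lambda>_. a))}\<rparr>"

section \<open>Subbundles, quotients, direct sums, tensor products and determinants\<close>

text \<open>A subbundle is a family of subsets \<open>S x\<close> of the fibres that, near every point, is given in a
  suitable local holomorphic trivialization by the vanishing of all but the first \<open>m\<close> coordinates.\<close>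

definition adapted_triv ::
  "'x::t2_space coord set \<Rightarrow> ('x, 'v) vbundle \<Rightarrow> nat \<Rightarrow> ('x \<Rightarrow> 'v set) \<Rightarrow> ('x, 'v) triv \<Rightarrow> bool" where
  "adapted_triv A E m S c \<longleftrightarrow> hol_triv A E c \<and>
     (\<forall>x\<in>fst c. snd c x ` S x = {v \<in> carrier_vec (vb_rank E). \<forall>i. m \<le> i \<and> i < vb_rank E \<longrightarrow> v $ i = 0})"

definition subbundle_of_rank ::
  "'x::t2_space coord set \<Rightarrow> ('x, 'v) vbundle \<Rightarrow> nat \<Rightarrow> ('x \<Rightarrow> 'v set) \<Rightarrow> bool" where
  "subbundle_of_rank A E m S \<longleftrightarrow> m \<le> vb_rank E \<and> (\<forall>x. S x \<subseteq> fibre E x) \<and>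
     (\<forall>x. \<exists>c. x \<in> fst c \<and> adapted_triv A E m S c)"

definition subbundle :: "'x::t2_space coord set \<Rightarrow> ('x, 'v) vbundle \<Rightarrow> ('x \<Rightarrow> 'v set) \<Rightarrow> bool" where
  "subbundle A E S \<longleftrightarrow> (\<exists>m. subbundle_of_rank A E m S)"

definition sub_rank :: "'x::t2_space coord set \<Rightarrow> ('x, 'v) vbundle \<Rightarrow> ('x \<Rightarrow> 'v set) \<Rightarrow> nat" where
  "sub_rank A E S = (THE m. subbundle_of_rank A E m S)"

definition sub_bundle ::
  "'x::t2_space coord set \<Rightarrow> ('x, 'v) vbundle \<Rightarrow> ('x \<Rightarrow> 'v set) \<Rightarrow> ('x, 'v) vbundle" where
  "sub_bundle A E S = (let m = sub_rank A E S in
     \<lparr>vb_rank = m, fibre = S,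
      trivs = {(fst c, \<lambda>x v. vec_first (snd c x v) m) | c. adapted_triv A E m S c}\<rparr>)"

text \<open>The points of the quotient \<open>E/S\<close> over \<open>x\<close> are the cosets \<open>v + S x\<close>; an adapted trivialization
  of \<open>E\<close> trivializes \<open>E/S\<close> by its last coordinates, which are constant on cosets.\<close>

definition quot_bundle ::
  "'x::t2_space coord set \<Rightarrow> ('x, 'v) vbundle \<Rightarrow> ('x \<Rightarrow> 'v set) \<Rightarrow> ('x, 'v set) vbundle" where
  "quot_bundle A E S = (let m = sub_rank A E S; q = vb_rank E - m in
     \<lparr>vb_rank = q, fibre = (\<lambda>x. (\<lambda>v. fibre_add E x v ` S x) ` fibre E x),
      trivs = {(fst c, \<lambda>x C. vec_last (snd c x (SOME v. v \<in> C)) q) | c. adapted_triv A E m S c}\<rparr>)"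

text \<open>The direct sum of \<open>G 1, \<dots>, G k\<close>, trivialized by concatenating coordinate vectors.\<close>

definition direct_sum :: "nat \<Rightarrow> (nat \<Rightarrow> ('x, 'v) vbundle) \<Rightarrow> ('x, nat \<Rightarrow> 'v) vbundle" where
  "direct_sum k G =
     \<lparr>vb_rank = (\<Sum>i=1..k. vb_rank (G i)), fibre = (\<lambda>x. PiE {1..k} (\<lambda>i. fibre (G i) x)),
      trivs = {(\<Inter>i\<in>{1..k}. fst (c i),
                \<lambda>x u. vec_of_list (concat (map (\<lambda>i. list_of_vec (snd (c i) x (u i))) [1..<Suc k])))
               | c. \<forall>i\<in>{1..k}. c i \<in> trivs (G i)}\<rparr>"

text \<open>The sum of the summands with index in \<open>I\<close>, as a family of subsets of the fibres of the
  direct sum.\<close>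

definition partial_sum :: "nat \<Rightarrow> (nat \<Rightarrow> ('x, 'v) vbundle) \<Rightarrow> nat set \<Rightarrow> 'x \<Rightarrow> (nat \<Rightarrow> 'v) set" where
  "partial_sum k G I x = {u \<in> fibre (direct_sum k G) x. \<forall>i\<in>{1..k} - I. u i \<in> zero_sub (G i) x}"

definition internal_sum :: "('x, 'v) vbundle \<Rightarrow> ('x \<Rightarrow> 'v set) \<Rightarrow> ('x \<Rightarrow> 'v set) \<Rightarrow> bool" where
  "internal_sum E S T \<longleftrightarrow>
     (\<forall>x. \<forall>v\<in>fibre E x. \<exists>!p. p \<in> S x \<times> T x \<and> v = fibre_add E x (fst p) (snd p))"

text \<open>Tensoring with a line bundle \<open>L\<close>. Every element of the tensor product of a line with a vector
  space is a pure tensor \<open>l \<otimes> v\<close>; it is represented by the set of all pairs \<open>(l', v')\<close> having the same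
  coordinates \<open>l' v'\<^sub>i\<close>, i.e. with \<open>l' \<otimes> v' = l \<otimes> v\<close>.\<close>

definition tensor_coords ::
  "('x, 'l) triv \<Rightarrow> ('x, 'v) triv \<Rightarrow> 'x \<Rightarrow> 'l \<Rightarrow> 'v \<Rightarrow> complex vec" where
  "tensor_coords b c x l v = (snd b x l $ 0) \<cdot>\<^sub>v snd c x v"

definition pure_tensor ::
  "('x, 'l) vbundle \<Rightarrow> ('x, 'v) vbundle \<Rightarrow> 'x \<Rightarrow> 'l \<Rightarrow> 'v \<Rightarrow> ('l \<times> 'v) set" where
  "pure_tensor L E x l v = {(l', v'). l' \<in> fibre L x \<and> v' \<in> fibre E x \<and>
     (\<exists>b\<in>trivs_at L x. \<exists>c\<in>trivs_at E x. tensor_coords b c x l' v' = tensor_coords b c x l v)}"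

definition tensor_sub ::
  "('x, 'l) vbundle \<Rightarrow> ('x, 'v) vbundle \<Rightarrow> ('x \<Rightarrow> 'v set) \<Rightarrow> 'x \<Rightarrow> ('l \<times> 'v) set set" where
  "tensor_sub L E S x = {pure_tensor L E x l v | l v. l \<in> fibre L x \<and> v \<in> S x}"

definition tensor_triv :: "('x, 'l) triv \<Rightarrow> ('x, 'v) triv \<Rightarrow> ('x, ('l \<times> 'v) set) triv" where
  "tensor_triv b c = (fst b \<inter> fst c, \<lambda>x t. THE y. \<exists>(l, v)\<in>t. y = tensor_coords b c x l v)"

definition line_tensor :: "('x, 'l) vbundle \<Rightarrow> ('x, 'v) vbundle \<Rightarrow> ('x, ('l \<times> 'v) set) vbundle" where
  "line_tensor L E =
     \<lparr>vb_rank = vb_rank E, fibre = tensor_sub L E (fibre E),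
      trivs = {tensor_triv b c | b c. b \<in> trivs L \<and> c \<in> trivs E}\<rparr>"

text \<open>The determinant line bundle, given by the determinants of the transition matrices: a point over
  \<open>x\<close> assigns to each trivialization \<open>c\<close> around \<open>x\<close> its coordinate \<open>\<delta> c\<close> with respect to
  \<open>e\<^sub>1 \<and> \<dots> \<and> e\<^sub>r\<close>, where \<open>e\<^sub>1, \<dots>, e\<^sub>r\<close> is the frame belonging to \<open>c\<close>.\<close>

definition transition :: "('x, 'v) vbundle \<Rightarrow> ('x, 'v) triv \<Rightarrow> ('x, 'v) triv \<Rightarrow> 'x \<Rightarrow> complex mat" where
  "transition E b c x = (THE g. g \<in> carrier_mat (vb_rank E) (vb_rank E) \<and>
     (\<forall>v\<in>fibre E x. snd c x v = g *\<^sub>v snd b x v))"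

definition det_bundle :: "('x, 'v) vbundle \<Rightarrow> ('x, ('x, 'v) triv \<Rightarrow> complex) vbundle" where
  "det_bundle E =
     \<lparr>vb_rank = 1,
      fibre = (\<lambda>x. {\<delta> \<in> extensional (trivs_at E x).
        \<forall>b\<in>trivs_at E x. \<forall>c\<in>trivs_at E x. \<delta> c = det (transition E b c x) * \<delta> b}),
      trivs = {(fst c, \<lambda>x \<delta>. vec 1 (\<lambda>_. \<delta> c)) | c. c \<in> trivs E}\<rparr>"

section \<open>Degree\<close>

text \<open>A meromorphic section of a line bundle in the coordinate \<open>z\<close> of a chart \<open>(V, z)\<close> of the surface
  and a trivialization \<open>c\<close>. As always with \<^const>\<open>meromorphic_on\<close>, the values at the poles are
  irrelevant.\<close>

definition local_section ::
  "'x coord \<Rightarrow> ('x, 'v) triv \<Rightarrow> ('x \<Rightarrow> 'v) \<Rightarrow> complex \<Rightarrow> complex" where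
  "local_section a c s \<zeta> = (let x = the_inv_into (fst a) (snd a) \<zeta> in snd c x (s x) $ 0)"

text \<open>Nonzero meromorphic sections; on a connected surface, a meromorphic section that is not
  identically zero does not vanish identically on a punctured neighbourhood of any point.\<close>

definition nonzero_mero_section ::
  "'x::t2_space coord set \<Rightarrow> ('x, 'v) vbundle \<Rightarrow> ('x \<Rightarrow> 'v) \<Rightarrow> bool" where
  "nonzero_mero_section A E s \<longleftrightarrow> (\<forall>x. s x \<in> fibre E x) \<and>
     (\<forall>a\<in>A. \<forall>c\<in>trivs E. local_section a c s meromorphic_on snd a ` (fst a \<inter> fst c) \<and>
        (\<forall>x\<in>fst a \<inter> fst c. \<exists>\<^sub>F \<zeta> in at (snd a x). local_section a c s \<zeta> \<noteq> 0))"

definition section_order ::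
  "'x::t2_space coord set \<Rightarrow> ('x, 'v) vbundle \<Rightarrow> ('x \<Rightarrow> 'v) \<Rightarrow> 'x \<Rightarrow> int" where
  "section_order A E s x = (THE n. \<forall>a\<in>A. \<forall>c\<in>trivs E. x \<in> fst a \<inter> fst c \<longrightarrow>
     zorder (local_section a c s) (snd a x) = n)"

text \<open>The degree of a line bundle is the degree of the divisor of any nonzero meromorphic section;
  the degree of a vector bundle is that of its determinant.\<close>

definition line_degree :: "'x::t2_space coord set \<Rightarrow> ('x, 'v) vbundle \<Rightarrow> int" where
  "line_degree A E = (THE d. \<exists>s. nonzero_mero_section A E s \<and>
     d = (\<Sum>x | section_order A E s x \<noteq> 0. section_order A E s x))"

definition vb_degree :: "'x::t2_space coord set \<Rightarrow> ('x, 'v) vbundle \<Rightarrow> int" where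
  "vb_degree A E = line_degree A (det_bundle E)"

definition sub_degree :: "'x::t2_space coord set \<Rightarrow> ('x, 'v) vbundle \<Rightarrow> ('x \<Rightarrow> 'v set) \<Rightarrow> int" where
  "sub_degree A E S = vb_degree A (sub_bundle A E S)"

section \<open>Twisted Higgs pairs\<close>

text \<open>Sections of \<open>L \<otimes> End W\<close> are identified with homomorphisms \<open>W \<rightarrow> L \<otimes> W\<close>. The trace, a section
  of \<open>L\<close>, is in trivializations the trace of the matrix.\<close>

definition traceless ::
  "('x, 'l) vbundle \<Rightarrow> ('x, 'w) vbundle \<Rightarrow> ('x \<Rightarrow> 'w \<Rightarrow> ('l \<times> 'w) set) \<Rightarrow> bool" where
  "traceless L W \<Phi> \<longleftrightarrow>
     (\<forall>x. \<forall>b\<in>trivs_at L x. \<forall>c\<in>trivs_at W x. \<forall>M\<in>carrier_mat (vb_rank W) (vb_rank W).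
        (\<forall>v\<in>fibre W x. snd (tensor_triv b c) x (\<Phi> x v) = M *\<^sub>v snd c x v) \<longrightarrow>
        (\<Sum>i<vb_rank W. M $$ (i, i)) = 0)"

definition SL_higgs_pair ::
  "'x::t2_space coord set \<Rightarrow> ('x, 'l) vbundle \<Rightarrow> nat \<Rightarrow> ('x, 'w) vbundle \<Rightarrow>
   ('x \<Rightarrow> (('x, 'w) triv \<Rightarrow> complex) \<Rightarrow> complex) \<Rightarrow> ('x \<Rightarrow> 'w \<Rightarrow> ('l \<times> 'w) set) \<Rightarrow> bool" where
  "SL_higgs_pair A L n W \<tau> \<Phi> \<longleftrightarrow>
     hol_vbundle A W \<and> vb_rank W = n \<and> vb_iso A (det_bundle W) trivial_line_bundle \<tau> \<and>
     vb_hom A W (line_tensor L W) \<Phi> \<and> traceless L W \<Phi>"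

definition higgs_invariant ::
  "('x, 'l) vbundle \<Rightarrow> ('x, 'w) vbundle \<Rightarrow> ('x \<Rightarrow> 'w \<Rightarrow> ('l \<times> 'w) set) \<Rightarrow> ('x \<Rightarrow> 'w set) \<Rightarrow> bool" where
  "higgs_invariant L W \<Phi> S \<longleftrightarrow> (\<forall>x. \<Phi> x ` S x \<subseteq> tensor_sub L W S x)"

definition filtration :: "'x::t2_space coord set \<Rightarrow> ('x, 'w) vbundle \<Rightarrow> nat \<Rightarrow> (nat \<Rightarrow> 'x \<Rightarrow> 'w set) \<Rightarrow> bool" where
  "filtration A W k F \<longleftrightarrow> F 0 = zero_sub W \<and> F k = fibre W \<and> (\<forall>i\<le>k. subbundle A W (F i)) \<and>
     (\<forall>i<k. (\<forall>x. F i x \<subseteq> F (Suc i) x) \<and> F i \<noteq> F (Suc i))"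

text \<open>Weight vectors are functions of which only the values at \<open>1, \<dots>, k\<close> matter. The monotonicity
  condition concerns \<open>1 \<le> i < k\<close> only; \<open>\<lambda>\<^sub>k\<^sub>+\<^sub>1 = 0\<close> enters only in the linear condition.\<close>

definition weights ::
  "'x::t2_space coord set \<Rightarrow> ('x, 'w) vbundle \<Rightarrow> nat \<Rightarrow> (nat \<Rightarrow> 'x \<Rightarrow> 'w set) \<Rightarrow> (nat \<Rightarrow> real) set" where
  "weights A W k F = {l. (\<forall>i\<in>{1..<k}. l i \<le> l (Suc i)) \<and>
     (\<Sum>i=1..k. real (sub_rank A W (F i)) * (l i - (if i = k then 0 else l (Suc i)))) = 0}"

text \<open>\<open>\<Phi>\<close> is a section of the bundle \<open>N(F, l)\<close>.\<close>

definition in_N ::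
  "('x, 'l) vbundle \<Rightarrow> ('x, 'w) vbundle \<Rightarrow> nat \<Rightarrow> (nat \<Rightarrow> 'x \<Rightarrow> 'w set) \<Rightarrow> (nat \<Rightarrow> real) \<Rightarrow>
   ('x \<Rightarrow> 'w \<Rightarrow> ('l \<times> 'w) set) \<Rightarrow> bool" where
  "in_N L W k F l \<Phi> \<longleftrightarrow> (\<forall>i\<in>{1..<k}. l i < l (Suc i) \<longrightarrow> higgs_invariant L W \<Phi> (F i))"

definition filt_degree ::
  "'x::t2_space coord set \<Rightarrow> ('x, 'w) vbundle \<Rightarrow> nat \<Rightarrow> (nat \<Rightarrow> 'x \<Rightarrow> 'w set) \<Rightarrow> (nat \<Rightarrow> real) \<Rightarrow> real" where
  "filt_degree A W k F l = (\<Sum>j\<in>{1..<k}. (l j - l (Suc j)) * real_of_int (sub_degree A W (F j)))"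

definition higgs_semistable ::
  "'x::t2_space coord set \<Rightarrow> ('x, 'l) vbundle \<Rightarrow> ('x, 'w) vbundle \<Rightarrow> ('x \<Rightarrow> 'w \<Rightarrow> ('l \<times> 'w) set) \<Rightarrow> bool" where
  "higgs_semistable A L W \<Phi> \<longleftrightarrow>
     (\<forall>k F l. filtration A W k F \<and> l \<in> weights A W k F \<and> in_N L W k F l \<Phi> \<longrightarrow>
        filt_degree A W k F l \<ge> 0)"

definition higgs_stable ::
  "'x::t2_space coord set \<Rightarrow> ('x, 'l) vbundle \<Rightarrow> ('x, 'w) vbundle \<Rightarrow> ('x \<Rightarrow> 'w \<Rightarrow> ('l \<times> 'w) set) \<Rightarrow> bool" where
  "higgs_stable A L W \<Phi> \<longleftrightarrow> higgs_semistable A L W \<Phi> \<and>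
     (\<forall>k F l. filtration A W k F \<and> l \<in> weights A W k F \<and> (\<exists>i\<in>{1..k}. l i \<noteq> 0) \<and>
        in_N L W k F l \<Phi> \<longrightarrow> filt_degree A W k F l > 0)"

definition graded :: "'x::t2_space coord set \<Rightarrow> ('x, 'w) vbundle \<Rightarrow> (nat \<Rightarrow> 'x \<Rightarrow> 'w set) \<Rightarrow> nat \<Rightarrow>
   ('x, 'w set) vbundle" where
  "graded A W F i = quot_bundle A (sub_bundle A W (F i)) (F (i - 1))"

text \<open>In the last conjunct, \<open>\<Phi>\<close>, transported along the isomorphism \<open>h\<close>, maps the \<open>i\<close>-th summand into
  \<open>L\<close> tensor the \<open>i\<close>-th summand, i.e. it is block diagonal.\<close>

definition higgs_polystable ::
  "'x::t2_space coord set \<Rightarrow> ('x, 'l) vbundle \<Rightarrow> ('x, 'w) vbundle \<Rightarrow> ('x \<Rightarrow> 'w \<Rightarrow> ('l \<times> 'w) set) \<Rightarrow> bool" where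
  "higgs_polystable A L W \<Phi> \<longleftrightarrow> higgs_semistable A L W \<Phi> \<and>
     (\<forall>k F l. filtration A W k F \<and> l \<in> weights A W k F \<and> (\<forall>i\<in>{1..<k}. l i < l (Suc i)) \<and>
        in_N L W k F l \<Phi> \<and> filt_degree A W k F l = 0 \<longrightarrow>
        (\<exists>h. vb_iso A W (direct_sum k (graded A W F)) h \<and>
           (\<forall>j\<le>k. \<forall>x. h x ` F j x = partial_sum k (graded A W F) {1..j} x) \<and>
           (\<forall>i\<in>{1..k}. higgs_invariant L W \<Phi>
              (\<lambda>x. {v \<in> fibre W x. h x v \<in> partial_sum k (graded A W F) {i} x}))))"

end

theory Submission
  imports Defs
begin

text \<open>A sum \<open>\<Sum>\<^sub>j (\<lambda>\<^sub>j - \<lambda>\<^sub>j\<^sub>+\<^sub>1) deg W\<^sub>j\<close> has nonpositive coefficients, and only \<open>\<Phi>\<close>-invariant \<open>W\<^sub>j\<close> have a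
  nonzero one; this gives (2) and one half of (1). For the other half, an invariant subbundle other than
  \<open>0\<close> and \<open>W\<close> is tested with the filtration \<open>0 \<subset> W' \<subset> W\<close>, while \<open>0\<close> and \<open>W\<close> have degree 0 because their
  determinants are trivial. That the degree of a trivial line bundle is well defined and 0 means that
  principal divisors have degree 0: by Rouche's theorem the number of solutions of \<open>f = c\<close> does not
  depend on \<open>c\<close>, and the same for \<open>1 / f\<close>, so that
  \<open>N\<^sub>f(0) - N\<^sub>1\<^sub>/\<^sub>f(0) = N\<^sub>f(1) - N\<^sub>1\<^sub>/\<^sub>f(1) = 0\<close>.
  For (3), all \<open>W\<^sub>j\<close> of a filtration with \<open>d = 0\<close> have degree 0, hence invariant complements. The projections
  \<open>\<pi>\<^sub>i\<close> onto \<open>W\<^sub>i\<close> along them commute with \<open>\<Phi>\<close>, and \<open>v \<mapsto> (\<pi>\<^sub>i v mod W\<^sub>i\<^sub>-\<^sub>1)\<^sub>i\<close> is the required isomorphism.\<close>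

text \<open>Only the degrees of 0 and of \<open>W\<close> are ever evaluated; those of other
  subbundles are constrained by hypotheses alone. Since \<open>line_degree\<close> is a definite
  description, even the value 0 requires that all nonzero meromorphic sections have divisors of the
  same degree; dividing by a nowhere vanishing section reduces this to functions. The values
  \<open>c = 0\<close> and \<open>c = 1\<close> are compared because \<open>f = 1\<close> and
  \<open>1 / f = 1\<close> have the same solutions, while the zeros of \<open>f\<close> and of
  \<open>1 / f\<close> are the zeros and the poles of \<open>f\<close>. The obstacle in (3) is that
  fibres are bare sets: sums, cosets and tensors are read off from coordinates. Holomorphic
  dependence is therefore a relation between families of coordinates, and pointwise claims concern
  subspaces of a coordinate space. As the quotient by \<open>F (i - 1)\<close> is taken inside the
  bundle \<open>F i\<close>, trivializations of \<open>F i\<close> adapted to the smaller subbundle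
  must be built. The projections are holomorphic by Cramer's rule, hence so is the splitting; its
  bijectivity and its compatibility with \<Phi> are fibrewise linear algebra.\<close>

no_notation fps_nth (infixl "$" 75)

section \<open>Zeros of meromorphic functions and their perturbations\<close>

lemma holomorphic_zero_count_stable:
  assumes hol: "G holomorphic_on ball z0 \<rho>" and "\<rho> > 0"
    and ne: "\<And>c. \<exists>\<^sub>F w in at z0. G w \<noteq> c"
  obtains \<delta> where "\<delta> > 0"
    "\<And>r. 0 < r \<Longrightarrow> r \<le> \<delta> \<Longrightarrow> \<exists>\<epsilon>>0. \<forall>c\<in>ball c0 \<epsilon>.
       finite {w \<in> ball z0 r. zorder (\<lambda>u. G u - c) w > 0} \<and>
       (\<Sum>w | w \<in> ball z0 r \<and> zorder (\<lambda>u. G u - c) w > 0. zorder (\<lambda>u. G u - c) w)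
         = max 0 (zorder (\<lambda>u. G u - c0) z0)"
proof -
  have nc: "\<not> (\<lambda>u. G u - c) constant_on ball z0 \<rho>" for c
  proof
    assume "(\<lambda>u. G u - c) constant_on ball z0 \<rho>"
    then obtain d where "\<And>u. u \<in> ball z0 \<rho> \<Longrightarrow> G u - c = d" by (auto simp: constant_on_def)
    moreover have "\<forall>\<^sub>F w in at z0. w \<in> ball z0 \<rho>"
      using \<open>\<rho> > 0\<close> by (intro eventually_at_in_open') auto
    ultimately have "\<forall>\<^sub>F w in at z0. G w = c + d"
      by (auto elim!: eventually_mono simp: algebra_simps)
    with ne[of "c + d"] show False by (auto simp: frequently_def)
  qed
  have holc: "(\<lambda>u. G u - c) holomorphic_on ball z0 \<rho>" for c
    by (intro holomorphic_intros hol)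
  \<comment> \<open>On the smaller disc the zeros stay in a compact subset of the domain, so there
    are finitely many of them for each \<open>c\<close>.\<close>
  define s where "s = ball z0 (\<rho>/2)"
  have s_sub: "s \<subseteq> ball z0 \<rho>" using \<open>\<rho> > 0\<close> by (auto simp: s_def)
  have fin: "finite {u \<in> s. G u - c = 0}" for c
    by (rule finite_subset[OF _ holomorphic_compact_finite_zeros[OF holc[of c] open_ball connected_ball _ _ nc, of "cball z0 (\<rho>/2)"]])
       (use \<open>\<rho> > 0\<close> in \<open>auto simp: s_def\<close>)
  have "open (- ({u \<in> s. G u - c0 = 0} - {z0}))"
    using fin[of c0] by (intro open_Compl finite_imp_closed) auto
  then obtain \<delta>1 where \<delta>1: "\<delta>1 > 0" "cball z0 \<delta>1 \<subseteq> - ({u \<in> s. G u - c0 = 0} - {z0})"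
    by (metis (no_types, lifting) ComplI Diff_iff insertI1 open_contains_cball)
  define \<delta> where "\<delta> = min \<delta>1 (\<rho>/4)"
  \<comment> \<open>By the identity theorem \<open>G - c\<close> vanishes identically near no point
    of the disc, so that a positive order there means a zero.\<close>
  have freq: "\<exists>\<^sub>F w in at u. G w - c \<noteq> 0" if "u \<in> ball z0 \<rho>" for u c
  proof (rule ccontr)
    assume "\<not> (\<exists>\<^sub>F w in at u. G w - c \<noteq> 0)"
    then have "\<forall>\<^sub>F w in at u. G w - c = 0" by (simp add: frequently_def)
    then have "\<exists>\<^sub>F w in at u. G w - c = 0"
      by (simp add: eventually_frequently)
    then have "u islimpt {w \<in> ball z0 \<rho>. G w - c = 0}"
      using eventually_at_in_open'[of "ball z0 \<rho>" u] that
      unfolding islimpt_conv_frequently_at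
      by (auto elim: frequently_rev_mp elim!: eventually_mono)
    then have "G w - c = 0" if "w \<in> ball z0 \<rho>" for w
      using analytic_continuation[OF holc[of c] open_ball connected_ball _ \<open>u \<in> ball z0 \<rho>\<close>, of "{w \<in> ball z0 \<rho>. G w - c = 0}" w] that by blast
    with nc[of c] show False by (auto simp: constant_on_def)
  qed
  have pos: "zorder (\<lambda>u. G u - c) w > 0 \<longleftrightarrow> G w - c = 0" if "w \<in> ball z0 \<rho>" for w c
    by (rule zorder_pos_iff[OF holc open_ball that freq[OF that]])
  show thesis
  proof
    show "\<delta> > 0" using \<delta>1 \<open>\<rho> > 0\<close> by (simp add: \<delta>_def)
    fix r assume r: "0 < r" "r \<le> \<delta>"
    have rs: "cball z0 r \<subseteq> s" using r \<open>\<rho> > 0\<close> by (auto simp: s_def \<delta>_def)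
    have nz: "G u \<noteq> c0" if "u \<in> cball z0 r - {z0}" for u
    proof -
      have "u \<in> s" "u \<in> cball z0 \<delta>1" using that r rs by (auto simp: \<delta>_def)
      with \<delta>1(2) that show ?thesis by auto
    qed
    have "continuous_on (sphere z0 r) (\<lambda>u. norm (G u - c0))"
      using rs s_sub by (intro continuous_intros holomorphic_on_imp_continuous_on[OF holomorphic_on_subset[OF hol]]) auto
    then obtain u0 where u0: "u0 \<in> sphere z0 r" "\<And>u. u \<in> sphere z0 r \<Longrightarrow> norm (G u0 - c0) \<le> norm (G u - c0)"
      using continuous_attains_inf[of "sphere z0 r" "\<lambda>u. norm (G u - c0)"] r by auto
    \<comment> \<open>Rouche's theorem tolerates every perturbation smaller than the minimum of
      \<open>norm (G - c0)\<close> on the circle.\<close>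
    define \<epsilon> where "\<epsilon> = norm (G u0 - c0)"
    have "\<epsilon> > 0" using nz[of u0] u0 r by (auto simp: \<epsilon>_def)
    moreover have "finite {w \<in> ball z0 r. zorder (\<lambda>u. G u - c) w > 0} \<and>
       (\<Sum>w | w \<in> ball z0 r \<and> zorder (\<lambda>u. G u - c) w > 0. zorder (\<lambda>u. G u - c) w)
         = max 0 (zorder (\<lambda>u. G u - c0) z0)" if c: "c \<in> ball c0 \<epsilon>" for c
    proof -
      have eq: "{w \<in> ball z0 r. zorder (\<lambda>u. G u - c) w > 0} = {w \<in> ball z0 r. G w - c = 0}" for c
        using pos rs s_sub by (auto simp: subset_iff)
      have lt: "norm (c0 - c) < norm (G u - c0)" if "u \<in> sphere z0 r" for u
        using u0(2)[OF that] c by (auto simp: \<epsilon>_def dist_norm)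
      have wn: "winding_number (circlepath z0 r) w = (if w \<in> ball z0 r then 1 else 0)" if "w \<notin> sphere z0 r" for w
      proof (cases "w \<in> ball z0 r")
        case True
        then show ?thesis by (simp add: winding_number_circlepath dist_norm norm_minus_commute)
      next
        case False
        then have "winding_number (circlepath z0 r) w = 0"
          using r that by (intro winding_number_zero_outside[where s="cball z0 r"]) auto
        then show ?thesis using False by simp
      qed
      have R: "(\<Sum>p | p \<in> s \<and> (G p - c0) + (c0 - c) = 0. winding_number (circlepath z0 r) p * zorder (\<lambda>p. (G p - c0) + (c0 - c)) p)
          = (\<Sum>p | p \<in> s \<and> G p - c0 = 0. winding_number (circlepath z0 r) p * zorder (\<lambda>p. G p - c0) p)"
      proof (rule Rouche_theorem)
        show "\<forall>z. z \<notin> s \<longrightarrow> winding_number (circlepath z0 r) z = 0"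
          using wn rs by (metis (no_types, opaque_lifting) mem_ball mem_cball mem_sphere order_less_imp_le order_refl subset_iff)
      qed (use fin[of c] fin[of c0] rs r lt in \<open>auto simp: s_def intro!: holomorphic_intros holomorphic_on_subset[OF hol s_sub[unfolded s_def]]\<close>)
      \<comment> \<open>Rouche's theorem weights the zeros in \<open>s\<close> by winding numbers.
        The weight is 1 inside the circle and 0 outside, and no zero lies on the circle, so a plain
        count remains.\<close>
      have S: "(\<Sum>p | p \<in> s \<and> G p - c' = 0. winding_number (circlepath z0 r) p * zorder (\<lambda>p. G p - c') p)
         = of_int (\<Sum>p | p \<in> ball z0 r \<and> G p - c' = 0. zorder (\<lambda>p. G p - c') p)"
        if "c' \<in> ball c0 \<epsilon>" for c'
      proof -
        have lt': "norm (c0 - c') < norm (G u - c0)" if "u \<in> sphere z0 r" for u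
          using u0(2)[OF that] \<open>c' \<in> ball c0 \<epsilon>\<close> by (auto simp: \<epsilon>_def dist_norm)
        have "(\<Sum>p | p \<in> s \<and> G p - c' = 0. winding_number (circlepath z0 r) p * zorder (\<lambda>p. G p - c') p)
          = (\<Sum>p | p \<in> s \<and> G p - c' = 0. if p \<in> ball z0 r then of_int (zorder (\<lambda>p. G p - c') p) else 0)"
        proof (rule sum.cong, simp)
          fix p assume p: "p \<in> {p \<in> s. G p - c' = 0}"
          then have "p \<notin> sphere z0 r" using lt'[of p] by (auto simp: norm_minus_commute)
          from wn[OF this] show "winding_number (circlepath z0 r) p * complex_of_int (zorder (\<lambda>p. G p - c') p) =
            (if p \<in> ball z0 r then complex_of_int (zorder (\<lambda>p. G p - c') p) else 0)" by auto
        qed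
        also have "\<dots> = (\<Sum>p | p \<in> ball z0 r \<and> G p - c' = 0. of_int (zorder (\<lambda>p. G p - c') p))"
          using fin[of c'] rs by (intro sum.mono_neutral_cong_right) auto
        finally show ?thesis by simp
      qed
      have R': "(\<Sum>p | p \<in> ball z0 r \<and> G p - c = 0. zorder (\<lambda>p. G p - c) p)
         = (\<Sum>p | p \<in> ball z0 r \<and> G p - c0 = 0. zorder (\<lambda>p. G p - c0) p)"
        using R S[OF c] S[of c0] \<open>\<epsilon> > 0\<close> by (simp del: of_int_sum)
      have z0: "z0 \<in> ball z0 \<rho>" using \<open>\<rho> > 0\<close> by simp
      have "(\<Sum>p | p \<in> ball z0 r \<and> G p - c0 = 0. zorder (\<lambda>p. G p - c0) p) = max 0 (zorder (\<lambda>u. G u - c0) z0)"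
      proof (cases "G z0 = c0")
        case True
        then have "{p \<in> ball z0 r. G p - c0 = 0} = {z0}" using nz r by force
        then show ?thesis using pos[OF z0, of c0] True by simp
      next
        case False
        then have "{p \<in> ball z0 r. G p - c0 = 0} = {}" using nz by force
        then show ?thesis using pos[OF z0, of c0] False by (simp del: Collect_empty_eq)
      qed
      moreover have "finite {w \<in> ball z0 r. G w - c = 0}"
        by (rule finite_subset[OF _ fin[of c]]) (use rs in auto)
      ultimately show ?thesis using R' unfolding eq by (intro conjI) (assumption, rule trans)
    qed
    ultimately show "\<exists>\<epsilon>>0. \<forall>c\<in>ball c0 \<epsilon>.
       finite {w \<in> ball z0 r. zorder (\<lambda>u. G u - c) w > 0} \<and>
       (\<Sum>w | w \<in> ball z0 r \<and> zorder (\<lambda>u. G u - c) w > 0. zorder (\<lambda>u. G u - c) w)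
         = max 0 (zorder (\<lambda>u. G u - c0) z0)" by blast
  qed
qed

text \<open>At a pole both sides vanish: \<open>g\<close> is large around it, so no value near
  \<open>c0\<close> is taken, and the order at \<open>z0\<close> is negative. Otherwise the
  singularity is removable, and removing it changes no order because orders only depend on punctured
  neighbourhoods.\<close>

lemma meromorphic_zero_count_stable:
  assumes g: "g meromorphic_on {z0}" and ne: "\<And>c. \<exists>\<^sub>F w in at z0. g w \<noteq> c"
  shows "\<exists>\<delta>>0. \<forall>r. 0 < r \<longrightarrow> r \<le> \<delta> \<longrightarrow> (\<exists>\<epsilon>>0. \<forall>c\<in>ball c0 \<epsilon>.
       finite {w \<in> ball z0 r. zorder (\<lambda>u. g u - c) w > 0} \<and>
       (\<Sum>w | w \<in> ball z0 r \<and> zorder (\<lambda>u. g u - c) w > 0. zorder (\<lambda>u. g u - c) w)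
         = max 0 (zorder (\<lambda>u. g u - c0) z0))"
proof (cases "is_pole g z0")
  case True
  have mc: "(\<lambda>u. g u - c) meromorphic_on {z0}" for c by (intro meromorphic_intros g)
  have pc: "is_pole (\<lambda>u. g u - c) z0" for c
  proof -
    have "filterlim (\<lambda>u. (- c) + g u) at_infinity (at z0)"
      by (rule tendsto_add_filterlim_at_infinity[OF tendsto_const]) (use True in \<open>simp add: is_pole_def\<close>)
    then show ?thesis by (simp add: is_pole_def)
  qed
  have neg: "zorder (\<lambda>u. g u - c) z0 < 0" for c
    using mc[of c] pc[of c] by (intro isolated_pole_imp_neg_zorder) (auto simp: meromorphic_at_iff)
  have "\<forall>\<^sub>F w in at z0. norm (g w) > norm c0 + 1"
    using True unfolding is_pole_def filterlim_at_infinity_conv_norm_at_top filterlim_at_top_dense by blast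
  moreover have "\<forall>\<^sub>F w in at z0. g analytic_on {w}"
    using g by (auto simp: meromorphic_at_iff isolated_singularity_at_altdef)
  ultimately have "\<forall>\<^sub>F w in at z0. g analytic_on {w} \<and> norm (g w) > norm c0 + 1"
    by eventually_elim auto
  then obtain \<delta> where \<delta>: "\<delta> > 0" "\<And>w. w \<noteq> z0 \<Longrightarrow> dist w z0 < \<delta> \<Longrightarrow> g analytic_on {w} \<and> norm (g w) > norm c0 + 1"
    by (auto simp: eventually_at)
  have "{w \<in> ball z0 r. zorder (\<lambda>u. g u - c) w > 0} = {}" if "r \<le> \<delta>" "c \<in> ball c0 1" for r c
  proof -
    have "zorder (\<lambda>u. g u - c) w = 0" if "w \<in> ball z0 r" "w \<noteq> z0" for w
    proof (rule zorder_eq_0I)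
      have *: "g analytic_on {w}" "norm (g w) > norm c0 + 1" using \<delta>(2)[of w] that \<open>r \<le> \<delta>\<close> by (auto simp: dist_commute)
      show "(\<lambda>u. g u - c) analytic_on {w}" by (intro analytic_intros *)
      have "norm c \<le> norm c0 + 1" using \<open>c \<in> ball c0 1\<close> norm_triangle_ineq2[of c c0] by (simp add: dist_norm norm_minus_commute)
      with * show "g w - c \<noteq> 0" by auto
    qed
    with neg[of c] show ?thesis by (metis (no_types, lifting) Collect_empty_eq less_irrefl not_less_iff_gr_or_eq)
  qed
  then show ?thesis using \<delta>(1) neg[of c0]
    by (intro exI[of _ \<delta>] conjI allI impI exI[of _ "1::real"]) (auto simp del: Collect_empty_eq)
next
  case False
  then obtain l where l: "g \<midarrow>z0\<rightarrow> l" using g by (auto simp: meromorphic_at_iff not_essential_def)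
  have isg: "isolated_singularity_at g z0" using g by (simp add: meromorphic_at_iff)
  define G where "G = remove_sings g"
  have "G analytic_on {z0}" unfolding G_def by (rule remove_sings_analytic_at[OF isg l])
  then obtain \<rho>1 where \<rho>1: "\<rho>1 > 0" "G holomorphic_on ball z0 \<rho>1"
    by (auto simp: analytic_on_def)
  have "\<forall>\<^sub>F w in at z0. G w = g w" unfolding G_def by (rule eventually_remove_sings_eq_at[OF isg])
  then obtain \<rho>2 where \<rho>2: "\<rho>2 > 0" "\<And>w. w \<noteq> z0 \<Longrightarrow> dist w z0 < \<rho>2 \<Longrightarrow> G w = g w"
    by (auto simp: eventually_at)
  define \<rho> where "\<rho> = min \<rho>1 \<rho>2"
  have \<rho>: "\<rho> > 0" "G holomorphic_on ball z0 \<rho>"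
    using \<rho>1 \<rho>2 by (auto simp: \<rho>_def intro: holomorphic_on_subset)
  have ev: "\<forall>\<^sub>F u in at w. G u = g u" if "w \<in> ball z0 \<rho>" for w
  proof -
    have "\<forall>\<^sub>F u in at w. u \<in> ball z0 \<rho> - {z0}"
      using eventually_at_in_open[of "ball z0 \<rho>" w] eventually_at_in_open'[of "ball z0 \<rho> - {z0}" w] that
      by (cases "w = z0") auto
    then show ?thesis by eventually_elim (use \<rho>2 in \<open>auto simp: \<rho>_def dist_commute\<close>)
  qed
  have zo: "zorder (\<lambda>u. g u - c) w = zorder (\<lambda>u. G u - c) w" if "w \<in> ball z0 \<rho>" for c w
    by (rule zorder_cong[OF _ refl]) (use ev[OF that] in eventually_elim, auto)
  have neG: "\<exists>\<^sub>F w in at z0. G w \<noteq> c" for c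
  proof -
    have "\<exists>\<^sub>F w in at z0. g w \<noteq> c \<and> G w = g w"
      using ne[of c] ev[of z0] \<rho>(1) by (intro frequently_eventually_frequently) auto
    then show ?thesis by (rule frequently_elim1) auto
  qed
  obtain \<delta> where \<delta>: "\<delta> > 0"
    "\<And>r. 0 < r \<Longrightarrow> r \<le> \<delta> \<Longrightarrow> \<exists>\<epsilon>>0. \<forall>c\<in>ball c0 \<epsilon>.
       finite {w \<in> ball z0 r. zorder (\<lambda>u. G u - c) w > 0} \<and>
       (\<Sum>w | w \<in> ball z0 r \<and> zorder (\<lambda>u. G u - c) w > 0. zorder (\<lambda>u. G u - c) w)
         = max 0 (zorder (\<lambda>u. G u - c0) z0)"
    by (rule holomorphic_zero_count_stable[OF \<rho>(2,1) neG, where ?c0.0=c0]) blast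
  have eq: "{w \<in> ball z0 r. zorder (\<lambda>u. g u - c) w > 0} = {w \<in> ball z0 r. zorder (\<lambda>u. G u - c) w > 0}"
    "(\<Sum>w | w \<in> ball z0 r \<and> zorder (\<lambda>u. g u - c) w > 0. zorder (\<lambda>u. g u - c) w) =
     (\<Sum>w | w \<in> ball z0 r \<and> zorder (\<lambda>u. G u - c) w > 0. zorder (\<lambda>u. G u - c) w)" if "r \<le> \<rho>" for r c
    using zo that by (auto intro!: sum.cong)
  show ?thesis
  proof (rule exI[of _ "min \<delta> \<rho>"], intro conjI allI impI)
    fix r assume "0 < r" "r \<le> min \<delta> \<rho>"
    then show "\<exists>\<epsilon>>0. \<forall>c\<in>ball c0 \<epsilon>.
       finite {w \<in> ball z0 r. zorder (\<lambda>u. g u - c) w > 0} \<and>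
       (\<Sum>w | w \<in> ball z0 r \<and> zorder (\<lambda>u. g u - c) w > 0. zorder (\<lambda>u. g u - c) w)
         = max 0 (zorder (\<lambda>u. g u - c0) z0)"
      using \<delta>(2)[of r] zo[of z0 c0] \<rho>(1) unfolding eq(2)[OF \<open>r \<le> min \<delta> \<rho>\<close>[THEN order.trans[OF _ min.cobounded2]]] unfolding eq(1)[OF \<open>r \<le> min \<delta> \<rho>\<close>[THEN order.trans[OF _ min.cobounded2]]] by simp
  qed (use \<delta> \<rho> in auto)
qed

text \<open>The count is locally constant in \<open>c\<close>, and the complex plane is connected.
  Near a fixed \<open>c0\<close>, a finite cover by good neighbourhoods confines all solutions to
  neighbourhoods of the solutions for \<open>c0\<close>. In \<open>loc\<close> the neighbourhood is
  required inside an arbitrary \<open>V\<close> so that these can be made disjoint and no solution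
  is counted twice.\<close>

lemma local_count_constant:
  fixes m :: "'x::t2_space \<Rightarrow> complex \<Rightarrow> int"
  assumes cpt: "compact (UNIV :: 'x set)" and nonneg: "\<And>y c. m y c \<ge> 0"
    and loc: "\<And>x c0 V. open V \<Longrightarrow> x \<in> V \<Longrightarrow> \<exists>U. open U \<and> x \<in> U \<and> U \<subseteq> V \<and> (\<exists>\<epsilon>>0. \<forall>c\<in>ball c0 \<epsilon>.
        finite {y \<in> U. m y c > 0} \<and> (\<Sum>y | y \<in> U \<and> m y c > 0. m y c) = m x c0)"
  shows "finite {y. m y c > 0}" and "(\<Sum>y | m y c > 0. m y c) = (\<Sum>y | m y c' > 0. m y c')"
proof -
  have fin: "finite {y. m y c > 0}" for c
  proof -
    have "\<exists>U. open U \<and> x \<in> U \<and> finite {y \<in> U. m y c > 0}" for x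
      using loc[of UNIV x c] by (metis UNIV_I centre_in_ball open_UNIV)
    then obtain U where U: "\<And>x. open (U x)" "\<And>x. x \<in> U x" "\<And>x. finite {y \<in> U x. m y c > 0}" by metis
    have op: "\<And>x. x \<in> UNIV \<Longrightarrow> open (U x)" and cov: "UNIV \<subseteq> (\<Union>x\<in>UNIV. U x)"
      using U(1,2) by auto
    obtain D where "finite D" "UNIV \<subseteq> (\<Union>x\<in>D. U x)"
      by (rule compactE_image[OF cpt op cov, simplified]) (rule that)
    then have "{y. m y c > 0} \<subseteq> (\<Union>x\<in>D. {y \<in> U x. m y c > 0})" by auto
    then show ?thesis using \<open>finite D\<close> U(3) by (meson finite_UN_I finite_subset)
  qed
  then show "finite {y. m y c > 0}" .
  define N where "N c = (\<Sum>y | m y c > 0. m y c)" for c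
  have lc: "\<exists>\<epsilon>>0. \<forall>c\<in>ball c0 \<epsilon>. N c = N c0" for c0
  proof -
    define Z where "Z = {y. m y c0 > 0}"
    have "finite Z" unfolding Z_def by (rule fin)
    have "\<exists>B. x \<noteq> y \<longrightarrow> open (fst B) \<and> open (snd B) \<and> x \<in> fst B \<and> y \<in> snd B \<and> fst B \<inter> snd B = {}"
      for x y :: 'x
      using hausdorff[of x y] by (metis fst_conv snd_conv)
    then obtain B where B: "\<And>x y :: 'x. x \<noteq> y \<Longrightarrow> open (fst (B x y)) \<and> open (snd (B x y)) \<and> x \<in> fst (B x y)
        \<and> y \<in> snd (B x y) \<and> fst (B x y) \<inter> snd (B x y) = {}"
      by metis
    \<comment> \<open>Pairwise separations are intersected so that the neighbourhoods of distinct
      points of \<open>Z\<close> are disjoint; finiteness of \<open>Z\<close> keeps them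
      open.\<close>
    define V where "V x = (\<Inter>y\<in>Z - {x}. fst (B x y) \<inter> snd (B y x))" for x
    have V: "open (V x)" "x \<in> V x" for x
    proof -
      have *: "open (fst (B x y) \<inter> snd (B y x))" "x \<in> fst (B x y) \<inter> snd (B y x)" if "y \<in> Z - {x}" for y
      proof -
        from that have "x \<noteq> y" "y \<noteq> x" by auto
        from B[OF this(1)] B[OF this(2)] show "open (fst (B x y) \<inter> snd (B y x))" "x \<in> fst (B x y) \<inter> snd (B y x)"
          by auto
      qed
      show "open (V x)" unfolding V_def using \<open>finite Z\<close> * by (intro open_INT ballI) auto
      show "x \<in> V x" unfolding V_def using * by (intro INT_I)
    qed
    have Vd: "V x \<inter> V y = {}" if "x \<in> Z" "y \<in> Z" "x \<noteq> y" for x y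
    proof -
      have "V x \<subseteq> fst (B x y)" "V y \<subseteq> snd (B x y)" using that by (auto simp: V_def)
      then show ?thesis using B[OF \<open>x \<noteq> y\<close>] by blast
    qed
    define good where "good x p \<longleftrightarrow> open (fst p) \<and> x \<in> fst p \<and> fst p \<subseteq> V x \<and> snd p > 0 \<and> (\<forall>c\<in>ball c0 (snd p).
        finite {y \<in> fst p. m y c > 0} \<and> (\<Sum>y | y \<in> fst p \<and> m y c > 0. m y c) = m x c0)" for x and p :: "'x set \<times> real"
    have "\<exists>p. good x p" for x
    proof -
      obtain S \<epsilon> where "open S" "x \<in> S" "S \<subseteq> V x" "\<epsilon> > 0" "\<forall>c\<in>ball c0 \<epsilon>.
        finite {y \<in> S. m y c > 0} \<and> (\<Sum>y | y \<in> S \<and> m y c > 0. m y c) = m x c0"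
        using loc[OF V[of x], of c0] by blast
      then have "good x (S, \<epsilon>)" by (simp add: good_def)
      then show ?thesis by blast
    qed
    then obtain p where p: "\<And>x. good x (p x)" by metis
    define U where "U x = fst (p x)" for x
    define \<epsilon> where "\<epsilon> x = snd (p x)" for x
    have U: "\<And>x. open (U x)" "\<And>x. x \<in> U x" "\<And>x. U x \<subseteq> V x" "\<And>x. \<epsilon> x > (0::real)"
      "\<And>x c. c \<in> ball c0 (\<epsilon> x) \<Longrightarrow> finite {y \<in> U x. m y c > 0} \<and> (\<Sum>y | y \<in> U x \<and> m y c > 0. m y c) = m x c0"
      using p unfolding good_def U_def \<epsilon>_def by blast+
    have op: "\<And>x. x \<in> UNIV \<Longrightarrow> open (U x)" and cov: "UNIV \<subseteq> (\<Union>x\<in>UNIV. U x)"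
      using U(1,2) by auto
    obtain D where D: "finite D" "UNIV \<subseteq> (\<Union>x\<in>D. U x)"
      by (rule compactE_image[OF cpt op cov, simplified]) (rule that)
    \<comment> \<open>One radius serves the whole cover and all of \<open>Z\<close>; the extra 1
      makes the argument of \<open>Min\<close> visibly nonempty.\<close>
    define e where "e = Min (insert 1 (\<epsilon> ` (D \<union> Z)))"
    have e: "e > 0" "\<And>x. x \<in> D \<union> Z \<Longrightarrow> e \<le> \<epsilon> x"
      using D(1) \<open>finite Z\<close> U(4) by (auto simp: e_def)
    have "N c = N c0" if c: "c \<in> ball c0 e" for c
    proof -
      have cb: "c \<in> ball c0 (\<epsilon> x)" if "x \<in> D \<union> Z" for x using e(2)[OF that] c by auto
      \<comment> \<open>Around a point that is no solution for \<open>c0\<close> the local count is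
        0, and a vanishing sum of nonnegative terms leaves no solution there.\<close>
      have none: "m y c = 0" if "x \<in> D" "x \<notin> Z" "y \<in> U x" for x y
      proof (rule ccontr)
        assume "m y c \<noteq> 0"
        then have "m y c > 0" using nonneg[of y c] by simp
        have "m x c0 = 0" using \<open>x \<notin> Z\<close> nonneg[of x c0] by (simp add: Z_def)
        with U(5)[OF cb[of x]] \<open>x \<in> D\<close> have "finite {y \<in> U x. m y c > 0}" "(\<Sum>y | y \<in> U x \<and> m y c > 0. m y c) = 0" by auto
        then have "\<forall>y\<in>{y \<in> U x. m y c > 0}. m y c = 0"
          by (subst sum_nonneg_eq_0_iff[symmetric]) (simp_all add: nonneg)
        moreover have "y \<in> {y \<in> U x. m y c > 0}" using \<open>m y c > 0\<close> \<open>y \<in> U x\<close> by simp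
        ultimately have "m y c = 0" by (rule bspec)
        with \<open>m y c > 0\<close> show False by simp
      qed
      have "{y. m y c > 0} = (\<Union>x\<in>Z. {y \<in> U x. m y c > 0})"
      proof (intro equalityI subsetI)
        fix y assume "y \<in> {y. m y c > 0}"
        then have "m y c > 0" by simp
        obtain x where x: "x \<in> D" "y \<in> U x" using D(2) by blast
        then have "x \<in> Z" using none[of x y] \<open>m y c > 0\<close> by auto
        with x \<open>m y c > 0\<close> show "y \<in> (\<Union>x\<in>Z. {y \<in> U x. m y c > 0})" by auto
      qed auto
      then have "N c = (\<Sum>x\<in>Z. \<Sum>y | y \<in> U x \<and> m y c > 0. m y c)"
        unfolding N_def using U(5)[OF cb] U(3) Vd \<open>finite Z\<close>
        by (subst sum.UNION_disjoint[symmetric]) (simp_all, blast)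
      also have "\<dots> = (\<Sum>x\<in>Z. m x c0)" using U(5)[OF cb] by (intro sum.cong) auto
      finally show ?thesis by (simp add: N_def Z_def)
    qed
    with e(1) show ?thesis by blast
  qed
  have "open {c. N c = N c'}" unfolding open_contains_ball using lc by fastforce
  moreover have "open (- {c. N c = N c'})" unfolding open_contains_ball
  proof
    fix d assume d: "d \<in> - {c. N c = N c'}"
    obtain \<epsilon> where "\<epsilon> > 0" "\<forall>c\<in>ball d \<epsilon>. N c = N d" using lc by blast
    moreover from this(2) d have "ball d \<epsilon> \<subseteq> - {c. N c = N c'}" by (metis (mono_tags) ComplI ComplD mem_Collect_eq subsetI)
    ultimately show "\<exists>e>0. ball d e \<subseteq> - {c. N c = N c'}" by blast
  qed
  ultimately have "{c. N c = N c'} = UNIV"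
    using clopen[of "{c. N c = N c'}"] by (auto simp: closed_def)
  then show "(\<Sum>y | m y c > 0. m y c) = (\<Sum>y | m y c' > 0. m y c')" by (auto simp: N_def)
qed

section \<open>Principal divisors on compact Riemann surfaces\<close>

lemma meromorphic_zero_dichotomy:
  assumes "f meromorphic_on {z}"
  shows "(\<forall>\<^sub>F w in at z. f w = 0) \<or> (\<forall>\<^sub>F w in at z. f w \<noteq> 0)"
proof (cases "\<exists>\<^sub>F w in at z. f w = 0")
  case True
  with assms show ?thesis
    using not_essential_frequently_0_imp_eventually_0[of f z] by (auto simp: meromorphic_at_iff)
qed (simp add: frequently_def)

section \<open>Charts, meromorphic functions and their orders on the surface\<close>

context compact_riemann_surface begin

lemma chartD:
  assumes "(U, z) \<in> A"
  shows "open U" "open (z ` U)" "continuous_on U z" "continuous_on (z ` U) (the_inv_into U z)"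
    "inj_on z U" "\<And>x. x \<in> U \<Longrightarrow> the_inv_into U z (z x) = x" "\<And>w. w \<in> z ` U \<Longrightarrow> the_inv_into U z w \<in> U"
    "\<And>w. w \<in> z ` U \<Longrightarrow> z (the_inv_into U z w) = w"
proof -
  have h: "open U" "open (z ` U)" "homeomorphism U (z ` U) z (the_inv_into U z)"
    using coord_homeo[OF assms] by auto
  then show "open U" "open (z ` U)" "continuous_on U z" "continuous_on (z ` U) (the_inv_into U z)"
    "\<And>x. x \<in> U \<Longrightarrow> the_inv_into U z (z x) = x" "\<And>w. w \<in> z ` U \<Longrightarrow> the_inv_into U z w \<in> U"
    "\<And>w. w \<in> z ` U \<Longrightarrow> z (the_inv_into U z w) = w"
    by (auto simp: homeomorphism_def)
  show "inj_on z U" by (rule inj_on_inverseI[of U "the_inv_into U z"]) (rule homeomorphism_apply1[OF h(3)])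
qed

lemma open_chart_image: "(U, z) \<in> A \<Longrightarrow> open S \<Longrightarrow> open (z ` (U \<inter> S))"
proof -
  assume c: "(U, z) \<in> A" and S: "open S"
  have "z ` (U \<inter> S) = z ` U \<inter> the_inv_into U z -` S"
    using chartD(6,7,8)[OF c] by (force simp: image_iff)
  then show ?thesis
    using continuous_on_open_vimage[OF chartD(2)[OF c], of "the_inv_into U z"] chartD(4)[OF c] S
    by (metis inf_commute)
qed

lemma open_chart_preimage: "(U, z) \<in> A \<Longrightarrow> open S \<Longrightarrow> open (U \<inter> z -` S)"
  using continuous_on_open_vimage[OF chartD(1), of U z z] chartD(3) by (metis inf_commute)

text \<open>Charts are homeomorphisms onto open sets, so punctured neighbourhoods correspond.
  Properties near a point of the surface and properties near its coordinate are exchanged in this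
  way below.\<close>

lemma eventually_chart:
  assumes c: "(U, z) \<in> A" and x: "x \<in> U"
  shows "(\<forall>\<^sub>F w in at (z x). Q (the_inv_into U z w)) \<longleftrightarrow> (\<forall>\<^sub>F y in at x. Q y)"
proof
  assume "\<forall>\<^sub>F w in at (z x). Q (the_inv_into U z w)"
  then obtain S where S: "open S" "z x \<in> S" "\<And>w. w \<in> S \<Longrightarrow> w \<noteq> z x \<Longrightarrow> Q (the_inv_into U z w)"
    by (auto simp: eventually_at_topological)
  show "\<forall>\<^sub>F y in at x. Q y" unfolding eventually_at_topological
  proof (intro exI[of _ "U \<inter> z -` S"] conjI ballI impI)
    fix y assume "y \<in> U \<inter> z -` S" "y \<noteq> x"
    then show "Q y" using S(3)[of "z y"] chartD(5,6)[OF c] x by (auto simp: inj_on_def)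
  qed (use S x open_chart_preimage[OF c] in auto)
next
  assume "\<forall>\<^sub>F y in at x. Q y"
  then obtain S where S: "open S" "x \<in> S" "\<And>y. y \<in> S \<Longrightarrow> y \<noteq> x \<Longrightarrow> Q y"
    by (auto simp: eventually_at_topological)
  show "\<forall>\<^sub>F w in at (z x). Q (the_inv_into U z w)" unfolding eventually_at_topological
  proof (intro exI[of _ "z ` (U \<inter> S)"] conjI ballI impI)
    fix w assume "w \<in> z ` (U \<inter> S)" "w \<noteq> z x"
    then show "Q (the_inv_into U z w)" using S(3) chartD(6)[OF c] by (metis IntE image_iff)
  qed (use S x open_chart_image[OF c] in auto)
qed

lemma frequently_chart:
  assumes c: "(U, z) \<in> A" and x: "x \<in> U"
  shows "(\<exists>\<^sub>F w in at (z x). Q (the_inv_into U z w)) \<longleftrightarrow> (\<exists>\<^sub>F y in at x. Q y)"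
  using eventually_chart[OF assms, of "\<lambda>x. \<not> Q x"] by (simp add: frequently_def)

lemma ex_chart: "\<exists>c. c \<in> A \<and> x \<in> fst c"
  using coord_cover by blast

definition chart_at :: "'x \<Rightarrow> 'x coord" where "chart_at x = (SOME c. c \<in> A \<and> x \<in> fst c)"

lemma chart_at: "chart_at x \<in> A" "x \<in> fst (chart_at x)"
  using someI_ex[OF ex_chart[of x]] by (auto simp: chart_at_def)

definition in_chart :: "'x coord \<Rightarrow> ('x \<Rightarrow> complex) \<Rightarrow> complex \<Rightarrow> complex" where
  "in_chart c f \<zeta> = f (the_inv_into (fst c) (snd c) \<zeta>)"

definition mero_fun :: "('x \<Rightarrow> complex) \<Rightarrow> bool" where
  "mero_fun f \<longleftrightarrow> (\<forall>c\<in>A. in_chart c f meromorphic_on snd c ` fst c)"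

definition ord_at :: "('x \<Rightarrow> complex) \<Rightarrow> 'x \<Rightarrow> int" where
  "ord_at f x = zorder (in_chart (chart_at x) f) (snd (chart_at x) x)"

lemma mero_funD: "mero_fun f \<Longrightarrow> c \<in> A \<Longrightarrow> x \<in> fst c \<Longrightarrow> in_chart c f meromorphic_on {snd c x}"
  unfolding mero_fun_def by (meson image_eqI meromorphic_on_meromorphic_at)

text \<open>A change of charts is holomorphic and injective, hence has nonzero derivative, and
  composition with it multiplies orders by 1. The hypothesis \<open>nz\<close> excludes functions
  vanishing near \<open>x\<close>, to which the composition rule for orders does not apply.\<close>

lemma ord_at_chart:
  assumes m: "mero_fun f" and nz: "\<exists>\<^sub>F y in at x. f y \<noteq> 0" and c: "c \<in> A" "x \<in> fst c"
  shows "zorder (in_chart c f) (snd c x) = ord_at f x"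
proof -
  have *: "zorder (in_chart (U, z) f) (z x) = zorder (in_chart (V, w) f) (w x)"
    if c: "(U, z) \<in> A" "x \<in> U" and d: "(V, w) \<in> A" "x \<in> V" for U z V w
  proof -
    define \<phi> where "\<phi> = w \<circ> the_inv_into U z"
    have op: "open (z ` (U \<inter> V))" using open_chart_image[OF c(1) chartD(1)[OF d(1)]] .
    have hol: "\<phi> holomorphic_on z ` (U \<inter> V)" unfolding \<phi>_def by (rule coord_compat[OF c(1) d(1)])
    have zx: "z x \<in> z ` (U \<inter> V)" using c d by auto
    have \<phi>x: "\<phi> (z x) = w x" using chartD(6)[OF c(1)] c by (simp add: \<phi>_def)
    have inj: "inj_on \<phi> (z ` (U \<inter> V))"
    proof (rule inj_onI)
      fix a b assume "a \<in> z ` (U \<inter> V)" "b \<in> z ` (U \<inter> V)" "\<phi> a = \<phi> b"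
      then obtain p q where "a = z p" "b = z q" "p \<in> U \<inter> V" "q \<in> U \<inter> V" by blast
      with \<open>\<phi> a = \<phi> b\<close> show "a = b"
        using chartD(6)[OF c(1)] chartD(5)[OF d(1)] by (auto simp: \<phi>_def inj_on_def)
    qed
    have dnz: "deriv \<phi> (z x) \<noteq> 0" by (rule holomorphic_injective_imp_regular[OF hol op inj zx])
    have an: "\<phi> analytic_on {z x}" using hol op zx analytic_at by blast
    have ev: "\<forall>\<^sub>F y in at (z x). y \<in> z ` (U \<inter> V)" using op zx by (rule eventually_at_in_open')
    have evne: "\<forall>\<^sub>F y in at (z x). \<phi> y \<noteq> \<phi> (z x)"
      using ev eventually_neq_at_within[of "z x"] by eventually_elim (use inj zx in \<open>auto simp: inj_on_def\<close>)
    have one: "zorder (\<lambda>y. \<phi> y - \<phi> (z x)) (z x) = 1"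
    proof (rule zorder_zero_eqI[where S="z ` (U \<inter> V)"])
      show "(\<lambda>y. \<phi> y - \<phi> (z x)) holomorphic_on z ` (U \<inter> V)" by (intro holomorphic_intros hol)
      have "(\<phi> has_field_derivative deriv \<phi> (z x)) (at (z x))"
        using hol op zx holomorphic_derivI by blast
      then have "((\<lambda>y. \<phi> y - \<phi> (z x)) has_field_derivative deriv \<phi> (z x)) (at (z x))"
        by (auto intro!: derivative_eq_intros)
      then have "deriv (\<lambda>y. \<phi> y - \<phi> (z x)) (z x) = deriv \<phi> (z x)" by (rule DERIV_imp_deriv)
      then show "(deriv ^^ nat 1) (\<lambda>y. \<phi> y - \<phi> (z x)) (z x) \<noteq> 0" using dnz by simp
    qed (use op zx in auto)
    have mw: "in_chart (V, w) f meromorphic_on {w x}" using mero_funD[OF m d(1)] d(2) by auto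
    have frq: "\<exists>\<^sub>F y in at (w x). in_chart (V, w) f y \<noteq> 0"
      using frequently_chart[OF d, of "\<lambda>y. f y \<noteq> 0"] nz by (simp add: in_chart_def)
    have evnz: "\<forall>\<^sub>F y in at (w x). in_chart (V, w) f y \<noteq> 0"
      using frq meromorphic_zero_dichotomy[OF mw] by (simp add: frequently_def)
    have "zorder (in_chart (V, w) f \<circ> \<phi>) (z x) = zorder (in_chart (V, w) f) (\<phi> (z x)) * zorder (\<lambda>y. \<phi> y - \<phi> (z x)) (z x)"
      by (rule zorder_compose'[OF _ _ an _ evne]) (use mw evnz in \<open>auto simp: \<phi>x meromorphic_at_iff\<close>)
    moreover have "zorder (in_chart (V, w) f \<circ> \<phi>) (z x) = zorder (in_chart (U, z) f) (z x)"
      by (rule zorder_cong[OF _ refl]) (use ev in eventually_elim, use chartD(6)[OF c(1)] chartD(6)[OF d(1)] in \<open>auto simp: in_chart_def \<phi>_def\<close>)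
    ultimately show ?thesis using one \<phi>x by simp
  qed
  show ?thesis unfolding ord_at_def
    using *[of "fst c" "snd c" "fst (chart_at x)" "snd (chart_at x)"] c chart_at[of x] by simp
qed

lemma mero_fun_intros:
  "mero_fun (\<lambda>_. k)"
  "mero_fun f \<Longrightarrow> mero_fun g \<Longrightarrow> mero_fun (\<lambda>x. f x - g x)"
  "mero_fun f \<Longrightarrow> mero_fun g \<Longrightarrow> mero_fun (\<lambda>x. f x / g x)"
  "mero_fun f \<Longrightarrow> mero_fun (\<lambda>x. inverse (f x))"
proof -
  show "mero_fun (\<lambda>_. k)" by (auto simp: mero_fun_def in_chart_def[abs_def] intro: meromorphic_intros)
  show "mero_fun (\<lambda>x. f x - g x)" if "mero_fun f" "mero_fun g" for f g
    using that unfolding mero_fun_def in_chart_def[abs_def] by (auto intro: meromorphic_on_diff)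
  show "mero_fun (\<lambda>x. f x / g x)" if "mero_fun f" "mero_fun g" for f g
    using that unfolding mero_fun_def in_chart_def[abs_def] by (auto intro: meromorphic_on_divide)
  show "mero_fun (\<lambda>x. inverse (f x))" if "mero_fun f" for f
    using that unfolding mero_fun_def in_chart_def[abs_def] by (auto intro: meromorphic_on_inverse)
qed

lemma mero_fun_dichotomy:
  assumes "mero_fun f" shows "(\<forall>\<^sub>F y in at x. f y = k) \<or> (\<forall>\<^sub>F y in at x. f y \<noteq> k)"
proof -
  let ?c = "chart_at x"
  have m: "(\<lambda>w. in_chart ?c f w - k) meromorphic_on {snd ?c x}"
    using mero_funD[OF assms chart_at] by (intro meromorphic_intros)
  then have "(\<forall>\<^sub>F w in at (snd ?c x). in_chart ?c f w - k = 0) \<or> (\<forall>\<^sub>F w in at (snd ?c x). in_chart ?c f w - k \<noteq> 0)"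
    by (rule meromorphic_zero_dichotomy)
  then show ?thesis
    using eventually_chart[of "fst ?c" "snd ?c" x "\<lambda>y. f y = k"] eventually_chart[of "fst ?c" "snd ?c" x "\<lambda>y. f y \<noteq> k"] chart_at[of x]
    by (simp add: in_chart_def)
qed

text \<open>The surface has no isolated point because the plane has none. This makes being
  eventually equal to a constant and eventually different from it incompatible.\<close>

lemma at_ne_bot: "at (x :: 'x) \<noteq> bot"
proof
  assume "at x = bot"
  then have "\<forall>\<^sub>F y in at x. False" by simp
  then have "\<forall>\<^sub>F w in at (snd (chart_at x) x). False"
    using eventually_chart[of "fst (chart_at x)" "snd (chart_at x)" x "\<lambda>_. False"] chart_at[of x] by simp
  then show False by simp
qed

text \<open>The identity theorem by connectedness: the points near which \<open>f\<close> equals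
  \<open>k\<close> form an open set, and by the dichotomy so do the remaining points, near which
  \<open>f\<close> avoids \<open>k\<close>.\<close>

lemma mero_fun_locally_constant:
  assumes m: "mero_fun f" and x: "\<forall>\<^sub>F y in at x. f y = k"
  shows "\<forall>\<^sub>F y in at x'. f y = k"
proof -
  define C where "C = {x. \<forall>\<^sub>F y in at x. f y = k}"
  have op: "open {x. \<forall>\<^sub>F y in at x. P (f y)}" for P :: "complex \<Rightarrow> bool"
  proof (rule Topological_Spaces.openI)
    fix x assume "x \<in> {x. \<forall>\<^sub>F y in at x. P (f y)}"
    then obtain S where S: "open S" "x \<in> S" "\<And>y. y \<in> S \<Longrightarrow> y \<noteq> x \<Longrightarrow> P (f y)"
      by (auto simp: eventually_at_topological)
    have "\<forall>\<^sub>F y in at u. P (f y)" if "u \<in> S" for u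
    proof (cases "u = x")
      case False
      then show ?thesis unfolding eventually_at_topological
        using S that by (intro exI[of _ "S - {x}"]) auto
    qed (use S in \<open>auto simp: eventually_at_topological\<close>)
    with S show "\<exists>T. open T \<and> x \<in> T \<and> T \<subseteq> {x. \<forall>\<^sub>F y in at x. P (f y)}" by blast
  qed
  have cC: "- C = {x. \<forall>\<^sub>F y in at x. f y \<noteq> k}"
  proof (intro equalityI subsetI)
    fix u assume "u \<in> - C"
    then show "u \<in> {x. \<forall>\<^sub>F y in at x. f y \<noteq> k}" using mero_fun_dichotomy[OF m, of k u] by (auto simp: C_def)
  next
    fix u assume "u \<in> {x. \<forall>\<^sub>F y in at x. f y \<noteq> k}"
    then have "\<forall>\<^sub>F y in at u. f y \<noteq> k" by simp
    then show "u \<in> - C" using at_ne_bot[of u] by (auto simp: C_def dest: eventually_conj)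
  qed
  have "open (- C)" unfolding cC by (rule op)
  moreover have "open C" unfolding C_def by (rule op)
  moreover have "C \<noteq> {}" using x by (auto simp: C_def)
  ultimately have "C = UNIV"
    using connectedD[OF connected_surface, of C "- C"] by auto
  then show ?thesis by (auto simp: C_def)
qed

lemma in_chart_diff: "in_chart c (\<lambda>y. f y - k) = (\<lambda>w. in_chart c f w - k)"
  by (simp add: in_chart_def fun_eq_iff)

lemma zero_count_constant:
  assumes m: "mero_fun f" and ne: "\<And>k x. \<exists>\<^sub>F y in at x. f y \<noteq> k"
  shows "finite {x. ord_at (\<lambda>y. f y - k) x > 0}"
    and "(\<Sum>x | ord_at (\<lambda>y. f y - k) x > 0. ord_at (\<lambda>y. f y - k) x)
       = (\<Sum>x | ord_at (\<lambda>y. f y - k') x > 0. ord_at (\<lambda>y. f y - k') x)"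
proof -
  \<comment> \<open>Truncation at 0 discards the poles and makes the multiplicity nonnegative, as
    the compactness argument requires.\<close>
  define M where "M x k = max 0 (ord_at (\<lambda>y. f y - k) x)" for x k
  have loc: "\<exists>U. open U \<and> x \<in> U \<and> U \<subseteq> V \<and> (\<exists>\<epsilon>>0. \<forall>c\<in>ball c0 \<epsilon>.
        finite {y \<in> U. M y c > 0} \<and> (\<Sum>y | y \<in> U \<and> M y c > 0. M y c) = M x c0)"
    if V: "open V" "x \<in> V" for x c0 V
  proof -
    obtain Uc z where c: "chart_at x = (Uc, z)" by fastforce
    have cA: "(Uc, z) \<in> A" "x \<in> Uc" using chart_at[of x] c by auto
    define g where "g = in_chart (Uc, z) f"
    have gm: "g meromorphic_on {z x}" unfolding g_def using mero_funD[OF m cA(1)] cA(2) by auto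
    have gne: "\<exists>\<^sub>F w in at (z x). g w \<noteq> k" for k
      using frequently_chart[OF cA, of "\<lambda>y. f y \<noteq> k"] ne[of k x] by (simp add: g_def in_chart_def)
    have zx: "z x \<in> z ` (Uc \<inter> V)" using cA V by auto
    then obtain \<rho> where \<rho>: "\<rho> > 0" "ball (z x) \<rho> \<subseteq> z ` (Uc \<inter> V)"
      using open_chart_image[OF cA(1) V(1)] by (meson open_contains_ball)
    obtain \<delta> where \<delta>: "\<delta> > 0" "\<And>r. 0 < r \<Longrightarrow> r \<le> \<delta> \<Longrightarrow> \<exists>\<epsilon>>0. \<forall>c\<in>ball c0 \<epsilon>.
       finite {w \<in> ball (z x) r. zorder (\<lambda>u. g u - c) w > 0} \<and>
       (\<Sum>w | w \<in> ball (z x) r \<and> zorder (\<lambda>u. g u - c) w > 0. zorder (\<lambda>u. g u - c) w)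
         = max 0 (zorder (\<lambda>u. g u - c0) (z x))"
      using meromorphic_zero_count_stable[OF gm gne, of c0] by auto
    \<comment> \<open>\<open>\<delta>\<close> is the bound for counting in the disc,
      \<open>\<rho>\<close> keeps the disc inside the image of \<open>V\<close>.\<close>
    define r where "r = min \<delta> \<rho>"
    have r: "0 < r" "r \<le> \<delta>" "ball (z x) r \<subseteq> z ` (Uc \<inter> V)" using \<delta> \<rho> by (auto simp: r_def)
    obtain \<epsilon> where \<epsilon>: "\<epsilon> > 0" "\<And>c. c \<in> ball c0 \<epsilon> \<Longrightarrow>
       finite {w \<in> ball (z x) r. zorder (\<lambda>u. g u - c) w > 0} \<and>
       (\<Sum>w | w \<in> ball (z x) r \<and> zorder (\<lambda>u. g u - c) w > 0. zorder (\<lambda>u. g u - c) w)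
         = max 0 (zorder (\<lambda>u. g u - c0) (z x))"
      using \<delta>(2)[OF r(1,2)] by auto
    define U where "U = Uc \<inter> z -` ball (z x) r"
    have ordU: "ord_at (\<lambda>y. f y - c) y = zorder (\<lambda>u. g u - c) (z y)" if "y \<in> Uc" for c y
      unfolding g_def in_chart_diff[symmetric]
      using ord_at_chart[OF mero_fun_intros(2)[OF m mero_fun_intros(1)] _ cA(1), of c y] ne[of c y] that by simp
    show ?thesis
    proof (intro exI[of _ U] conjI)
      show "open U" unfolding U_def by (rule open_chart_preimage[OF cA(1)]) simp
      show "x \<in> U" using cA r by (simp add: U_def)
      show "U \<subseteq> V"
      proof
        fix y assume "y \<in> U"
        then have "y \<in> Uc" "z y \<in> z ` (Uc \<inter> V)" using r(3) by (auto simp: U_def)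
        then obtain y' where "y' \<in> Uc" "y' \<in> V" "z y = z y'" by blast
        with \<open>y \<in> Uc\<close> chartD(5)[OF cA(1)] show "y \<in> V" by (metis inj_onD)
      qed
      have "finite {y \<in> U. M y c > 0} \<and> (\<Sum>y | y \<in> U \<and> M y c > 0. M y c) = M x c0"
        if "c \<in> ball c0 \<epsilon>" for c
      proof -
        \<comment> \<open>The chart carries the solutions on the surface bijectively to those in the
          disc and preserves orders, so the two counts agree.\<close>
        let ?Y = "{y \<in> U. M y c > 0}" and ?W = "{w \<in> ball (z x) r. zorder (\<lambda>u. g u - c) w > 0}"
        have inj: "inj_on z ?Y" using chartD(5)[OF cA(1)] by (rule inj_on_subset) (auto simp: U_def)
        have im: "z ` ?Y = ?W"
        proof (intro equalityI subsetI)
          fix w assume "w \<in> z ` ?Y"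
          then show "w \<in> ?W" using ordU by (auto simp: U_def M_def)
        next
          fix w assume w: "w \<in> ?W"
          then obtain y where "y \<in> Uc" "w = z y" using r(3) by blast
          with w show "w \<in> z ` ?Y" using ordU[of y c] by (intro image_eqI[of _ _ y]) (auto simp: U_def M_def)
        qed
        have "(\<Sum>y\<in>?Y. M y c) = (\<Sum>y\<in>?Y. zorder (\<lambda>u. g u - c) (z y))"
          using ordU by (intro sum.cong) (auto simp: M_def U_def)
        also have "\<dots> = (\<Sum>w\<in>?W. zorder (\<lambda>u. g u - c) w)"
          unfolding im[symmetric] by (simp add: sum.reindex[OF inj])
        also have "\<dots> = M x c0" using \<epsilon>(2)[OF that] ordU[OF cA(2), of c0] by (simp add: M_def)
        finally have "(\<Sum>y\<in>?Y. M y c) = M x c0" .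
        moreover have "finite ?Y" using \<epsilon>(2)[OF that] im inj by (metis (no_types, lifting) finite_image_iff)
        ultimately show ?thesis by blast
      qed
      with \<epsilon>(1) show "\<exists>\<epsilon>>0. \<forall>c\<in>ball c0 \<epsilon>. finite {y \<in> U. M y c > 0} \<and> (\<Sum>y | y \<in> U \<and> M y c > 0. M y c) = M x c0"
        by blast
    qed
  qed
  have M0: "M y c \<ge> 0" for y c by (simp add: M_def)
  have eq: "{x. M x k > 0} = {x. ord_at (\<lambda>y. f y - k) x > 0}" for k by (auto simp: M_def less_max_iff_disj)
  have eq2: "(\<Sum>x | M x k > 0. M x k) = (\<Sum>x | ord_at (\<lambda>y. f y - k) x > 0. ord_at (\<lambda>y. f y - k) x)" for k
    by (rule sum.cong) (auto simp: M_def)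
  show "finite {x. ord_at (\<lambda>y. f y - k) x > 0}"
    using local_count_constant(1)[of M k, OF compact_surface M0 loc] by (simp only: eq)
  show "(\<Sum>x | ord_at (\<lambda>y. f y - k) x > 0. ord_at (\<lambda>y. f y - k) x)
       = (\<Sum>x | ord_at (\<lambda>y. f y - k') x > 0. ord_at (\<lambda>y. f y - k') x)"
    using local_count_constant(2)[of M k k', OF compact_surface M0 loc] by (simp only: eq2)
qed

lemma ord_at_const:
  assumes "\<forall>\<^sub>F y in at x. f y = k" "k \<noteq> 0" shows "ord_at f x = 0"
proof -
  have "\<forall>\<^sub>F w in at (snd (chart_at x) x). in_chart (chart_at x) f w = k"
    using eventually_chart[of "fst (chart_at x)" "snd (chart_at x)" x "\<lambda>y. f y = k"] chart_at[of x] assms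
    by (simp add: in_chart_def)
  then have "ord_at f x = zorder (\<lambda>_. k) (snd (chart_at x) x)" unfolding ord_at_def by (rule zorder_cong[OF _ refl])
  with \<open>k \<noteq> 0\<close> show ?thesis by simp
qed

lemma frequently_in_chart_at:
  "(\<exists>\<^sub>F w in at (snd (chart_at x) x). in_chart (chart_at x) f w \<noteq> 0) \<longleftrightarrow> (\<exists>\<^sub>F y in at x. f y \<noteq> 0)"
  using frequently_chart[of "fst (chart_at x)" "snd (chart_at x)" x "\<lambda>y. f y \<noteq> 0"] chart_at[of x]
  by (simp add: in_chart_def)

lemma ord_at_divide:
  assumes "mero_fun f" "mero_fun g" "\<exists>\<^sub>F y in at x. f y \<noteq> 0" "\<exists>\<^sub>F y in at x. g y \<noteq> 0"
  shows "ord_at (\<lambda>y. f y / g y) x = ord_at f x - ord_at g x"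
proof -
  have "in_chart (chart_at x) (\<lambda>y. f y / g y) = (\<lambda>w. in_chart (chart_at x) f w / in_chart (chart_at x) g w)"
    by (simp add: in_chart_def fun_eq_iff)
  then show ?thesis unfolding ord_at_def using assms
    by (simp add: zorder_divide mero_funD chart_at frequently_in_chart_at)
qed

lemma ord_at_cong:
  assumes "\<forall>\<^sub>F y in at x. f y = g y" shows "ord_at f x = ord_at g x"
  unfolding ord_at_def
  by (rule zorder_cong[OF _ refl])
     (use assms eventually_chart[of "fst (chart_at x)" "snd (chart_at x)" x "\<lambda>y. f y = g y"] chart_at[of x]
      in \<open>auto simp: in_chart_def\<close>)

text \<open>At a zero of \<open>f\<close> the constant -1 dominates, at a pole \<open>f\<close>
  itself does. Consequently \<open>f - 1\<close> can have a zero only where \<open>f\<close> has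
  order 0.\<close>

lemma ord_at_minus_one:
  assumes "mero_fun f" "\<And>k. \<exists>\<^sub>F y in at x. f y \<noteq> k"
  shows "ord_at f x > 0 \<Longrightarrow> ord_at (\<lambda>y. f y - 1) x = 0"
    and "ord_at f x < 0 \<Longrightarrow> ord_at (\<lambda>y. f y - 1) x = ord_at f x"
proof -
  let ?g = "in_chart (chart_at x) f" and ?z = "snd (chart_at x) x"
  have g: "?g meromorphic_on {?z}" using mero_funD[OF assms(1) chart_at] .
  have ne: "\<exists>\<^sub>F w in at ?z. ?g w \<noteq> 0" using assms(2)[of 0] by (simp add: frequently_in_chart_at)
  have one: "(\<lambda>_. 1) meromorphic_on {?z}" "\<exists>\<^sub>F w in at ?z. (1::complex) \<noteq> 0" by auto
  show "ord_at (\<lambda>y. f y - 1) x = 0" if "ord_at f x > 0"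
    using zorder_diff2[OF g ne one] that by (simp add: ord_at_def in_chart_diff)
  show "ord_at (\<lambda>y. f y - 1) x = ord_at f x" if "ord_at f x < 0"
    using zorder_diff1[OF g ne one] that by (simp add: ord_at_def in_chart_diff)
qed

theorem principal_divisor_degree:
  assumes m: "mero_fun f" and nz: "\<And>x. \<exists>\<^sub>F y in at x. f y \<noteq> 0"
  shows "(\<Sum>x | ord_at f x \<noteq> 0. ord_at f x) = 0"
\<comment> \<open>If \<open>f\<close> is constant near one point, it is so near all points and has
  no zeros or poles; solutions of \<open>f = c\<close> can be counted only in the other
  case.\<close>
proof (cases "\<exists>k x. \<forall>\<^sub>F y in at x. f y = k")
  case True
  then obtain k x0 where k: "\<forall>\<^sub>F y in at x0. f y = k" by blast
  have ev: "\<forall>\<^sub>F y in at x. f y = k" for x by (rule mero_fun_locally_constant[OF m k])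
  have "k \<noteq> 0" using nz[of x0] k by (auto simp: frequently_def)
  then have "ord_at f x = 0" for x using ord_at_const[OF ev] by blast
  then show ?thesis by simp
next
  case False
  then have ne: "\<And>k x. \<exists>\<^sub>F y in at x. f y \<noteq> k" by (simp add: frequently_def)
  define g where "g y = inverse (f y)" for y
  have gm: "mero_fun g" unfolding g_def by (rule mero_fun_intros(4)[OF m])
  have gne: "\<exists>\<^sub>F y in at x. g y \<noteq> k" for k x
    using ne[where k="inverse k" and x=x] by (rule frequently_elim1) (auto simp: g_def)
  have g0: "ord_at g x = - ord_at f x" for x
  proof -
    have "ord_at (\<lambda>y. 1 / f y) x = ord_at (\<lambda>_. 1) x - ord_at f x"
      by (rule ord_at_divide[OF mero_fun_intros(1) m _ nz]) (simp add: at_ne_bot)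
    then show ?thesis using ord_at_const[of "\<lambda>_. 1" 1 x] by (simp add: g_def[abs_def] divide_inverse)
  qed
  \<comment> \<open>This comes from \<open>1 / f - 1 = (1 - f) / f\<close>, which holds where
    \<open>f\<close> is nonzero, hence on a punctured neighbourhood of every point.\<close>
  have g1: "ord_at (\<lambda>y. g y - 1) x = ord_at (\<lambda>y. f y - 1) x - ord_at f x" for x
  proof -
    have fm1: "mero_fun (\<lambda>y. 1 - f y)" by (intro mero_fun_intros m)
    have "\<forall>\<^sub>F y in at x. f y \<noteq> 0"
      using mero_fun_dichotomy[OF m, of 0 x] nz[of x] by (auto simp: frequently_def)
    then have "\<forall>\<^sub>F y in at x. g y - 1 = (1 - f y) / f y"
      by eventually_elim (simp add: g_def field_simps)
    then have "ord_at (\<lambda>y. g y - 1) x = ord_at (\<lambda>y. (1 - f y) / f y) x" by (rule ord_at_cong)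
    also have "\<dots> = ord_at (\<lambda>y. 1 - f y) x - ord_at f x"
      by (rule ord_at_divide[OF fm1 m _ nz]) (use ne[where k=1 and x=x] in \<open>auto elim: frequently_elim1\<close>)
    also have "ord_at (\<lambda>y. 1 - f y) x = ord_at (\<lambda>y. f y - 1) x"
    proof -
      have "in_chart c (\<lambda>y. 1 - f y) = (\<lambda>w. - in_chart c (\<lambda>y. f y - 1) w)" for c
        by (simp add: in_chart_def fun_eq_iff)
      then show ?thesis by (simp add: ord_at_def)
    qed
    finally show ?thesis .
  qed
  \<comment> \<open>If \<open>f - 1\<close> or \<open>g - 1\<close> has positive order at
    \<open>x\<close>, then \<open>f\<close> has order 0 there, and by \<open>g1\<close> the two
    orders coincide.\<close>
  have pos: "ord_at (\<lambda>y. g y - 1) x > 0 \<longleftrightarrow> ord_at (\<lambda>y. f y - 1) x > 0"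
    and poseq: "ord_at (\<lambda>y. f y - 1) x > 0 \<Longrightarrow> ord_at (\<lambda>y. g y - 1) x = ord_at (\<lambda>y. f y - 1) x" for x
    using ord_at_minus_one[OF m ne, of x] g1[of x] by (linarith)+
  let ?N = "\<lambda>f k. \<Sum>x | ord_at (\<lambda>y. f y - k) x > 0. ord_at (\<lambda>y. f y - k) x"
  have "?N f 0 = ?N f 1" by (rule zero_count_constant(2)[OF m ne])
  moreover have "?N g 0 = ?N g 1" by (rule zero_count_constant(2)[OF gm gne])
  moreover have "?N g 1 = ?N f 1" by (rule sum.cong) (auto simp: pos poseq)
  \<comment> \<open>The zeros of \<open>g\<close> are the poles of \<open>f\<close>, with the
    opposite order.\<close>
  moreover have "?N g 0 = - (\<Sum>x | ord_at f x < 0. ord_at f x)"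
    by (simp add: g0 sum_negf)
  ultimately have eq: "(\<Sum>x | ord_at f x > 0. ord_at f x) = - (\<Sum>x | ord_at f x < 0. ord_at f x)" by simp
  have f1: "finite {x. ord_at f x > 0}" using zero_count_constant(1)[OF m ne, of 0] by simp
  have f2: "finite {x. ord_at f x < 0}" using zero_count_constant(1)[OF gm gne, of 0] by (simp add: g0)
  have "{x. ord_at f x \<noteq> 0} = {x. ord_at f x > 0} \<union> {x. ord_at f x < 0}" by auto
  then show ?thesis using f1 f2 eq by (simp add: sum.union_disjoint disjoint_iff)
qed

end

section \<open>Holomorphic matrices\<close>

lemma mult_unit_vec_col:
  assumes "M \<in> carrier_mat m n" "j < n" "i < m"
  shows "(M *\<^sub>v unit_vec n j) $ i = (M $$ (i,j) :: complex)"
  using assms by (simp add: scalar_prod_right_unit row_def)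

lemma mat_eq_if_mult_eq:
  assumes "M \<in> carrier_mat m n" "N \<in> carrier_mat m n"
    and "\<And>v. v \<in> carrier_vec n \<Longrightarrow> M *\<^sub>v v = N *\<^sub>v (v :: complex vec)"
  shows "M = N"
proof (rule eq_matI)
  fix i j assume "i < dim_row N" "j < dim_col N"
  then show "M $$ (i,j) = N $$ (i,j)"
    using mult_unit_vec_col[of M m n j i] mult_unit_vec_col[of N m n j i] assms(3)[of "unit_vec n j"] assms(1,2)
    by (metis carrier_matD unit_vec_carrier)
qed (use assms(1,2) in auto)

text \<open>Filling up with zero rows gives a square matrix of determinant 0; it kills a nonzero
  vector, and so does \<open>M\<close>, whose rows are among its rows.\<close>

lemma wide_matrix_kernel:
  assumes M: "(M :: complex mat) \<in> carrier_mat m n" and "m < n"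
  shows "\<exists>v\<in>carrier_vec n. v \<noteq> 0\<^sub>v n \<and> M *\<^sub>v v = 0\<^sub>v m"
proof -
  define N where "N = mat n n (\<lambda>(i,j). if i < m then M $$ (i,j) else 0)"
  have N: "N \<in> carrier_mat n n" by (simp add: N_def)
  \<comment> \<open>Every product in Leibniz' formula has a factor from the last row, which is one
    of the added zero rows.\<close>
  have "(\<Prod>i = 0..<n. N $$ (i, p i)) = 0" if "p permutes {0..<n}" for p
  proof (rule prod_zero)
    have "p (n - 1) < n" using permutes_in_image[OF that, of "n - 1"] \<open>m < n\<close> by simp
    then show "\<exists>i\<in>{0..<n}. N $$ (i, p i) = 0"
      using \<open>m < n\<close> by (intro bexI[of _ "n - 1"]) (auto simp: N_def)
  qed simp
  then have "det N = 0" unfolding det_def'[OF N] by (intro sum.neutral) simp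
  then obtain v where v: "v \<in> carrier_vec n" "v \<noteq> 0\<^sub>v n" "N *\<^sub>v v = 0\<^sub>v n"
    using det_0_iff_vec_prod_zero[OF N] by auto
  have "M *\<^sub>v v = 0\<^sub>v m"
  proof (rule eq_vecI)
    fix i assume i: "i < dim_vec (0\<^sub>v m :: complex vec)"
    then have "row N i = row M i" using \<open>m < n\<close> M by (intro eq_vecI) (auto simp: N_def)
    then show "(M *\<^sub>v v) $ i = 0\<^sub>v m $ i"
      using i M N \<open>m < n\<close> arg_cong[OF v(3), of "\<lambda>w. vec_index w i"] by simp
  qed (use M in simp)
  with v show ?thesis by blast
qed

lemma injective_mat_tall:
  assumes M: "(M :: complex mat) \<in> carrier_mat m n"
    and inj: "\<And>v. v \<in> carrier_vec n \<Longrightarrow> M *\<^sub>v v = 0\<^sub>v m \<Longrightarrow> v = 0\<^sub>v n"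
  shows "n \<le> m"
  using wide_matrix_kernel[OF M] inj by (meson not_le)

lemma det_nonzero_if_injective:
  assumes M: "(M :: complex mat) \<in> carrier_mat n n"
    and inj: "\<And>v. v \<in> carrier_vec n \<Longrightarrow> M *\<^sub>v v = 0\<^sub>v n \<Longrightarrow> v = 0\<^sub>v n"
  shows "det M \<noteq> 0"
  using det_0_iff_vec_prod_zero[OF M] inj by blast

text \<open>Cramer's rule is used as the definition so that the entries are visibly quotients of
  determinants and inherit holomorphy.\<close>

definition mat_inv :: "complex mat \<Rightarrow> complex mat" where
  "mat_inv M = inverse (det M) \<cdot>\<^sub>m adj_mat M"

lemma mat_inv:
  assumes M: "M \<in> carrier_mat n n" and d: "det M \<noteq> 0"
  shows "mat_inv M \<in> carrier_mat n n" "M * mat_inv M = 1\<^sub>m n" "mat_inv M * M = 1\<^sub>m n"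
    "v \<in> carrier_vec n \<Longrightarrow> mat_inv M *\<^sub>v (M *\<^sub>v v) = v" "v \<in> carrier_vec n \<Longrightarrow> M *\<^sub>v (mat_inv M *\<^sub>v v) = v"
proof -
  note a = adj_mat[OF M]
  show c: "mat_inv M \<in> carrier_mat n n" using a(1) unfolding mat_inv_def by (rule smult_carrier_mat)
  have one: "inverse (det M) \<cdot>\<^sub>m (det M \<cdot>\<^sub>m 1\<^sub>m n) = (1\<^sub>m n :: complex mat)"
    by (rule eq_matI) (use d in auto)
  show r: "M * mat_inv M = 1\<^sub>m n" unfolding mat_inv_def
    using mult_smult_distrib[OF M a(1), of "inverse (det M)"] a(2) one by simp
  show l: "mat_inv M * M = 1\<^sub>m n" unfolding mat_inv_def
    using mult_smult_assoc_mat[OF a(1) M, of "inverse (det M)"] a(3) one by simp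
  show "mat_inv M *\<^sub>v (M *\<^sub>v v) = v" if "v \<in> carrier_vec n"
    using assoc_mult_mat_vec[OF c M that] l that by simp
  show "M *\<^sub>v (mat_inv M *\<^sub>v v) = v" if "v \<in> carrier_vec n"
    using assoc_mult_mat_vec[OF M c that] r that by simp
qed

section \<open>Holomorphic functions, matrices and families of linear maps\<close>

context compact_riemann_surface begin

abbreviation "hfun \<equiv> hol_fun_on A"
abbreviation "hmat \<equiv> hol_mat_on A"

lemma hfunD: "hfun f U \<Longrightarrow> (V, z) \<in> A \<Longrightarrow> (f \<circ> the_inv_into V z) holomorphic_on z ` (U \<inter> V)"
  by (auto simp: hol_fun_on_def)

lemma hfunI: "(\<And>V z. (V, z) \<in> A \<Longrightarrow> (f \<circ> the_inv_into V z) holomorphic_on z ` (U \<inter> V)) \<Longrightarrow> hfun f U"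
  by (auto simp: hol_fun_on_def)

lemma hfun_subset: "hfun f U \<Longrightarrow> S \<subseteq> U \<Longrightarrow> hfun f S"
  by (rule hfunI, rule holomorphic_on_subset[OF hfunD]) auto

lemma hfun_cong:
  assumes "hfun f U" "\<And>x. x \<in> U \<Longrightarrow> f x = g x" shows "hfun g U"
proof (rule hfunI)
  fix V z assume c: "(V, z) \<in> A"
  show "(g \<circ> the_inv_into V z) holomorphic_on z ` (U \<inter> V)"
    by (rule holomorphic_transform[OF hfunD[OF assms(1) c]]) (use assms(2) chartD(6)[OF c] in auto)
qed

lemma hfun_const: "hfun (\<lambda>_. k) U"
  by (rule hfunI) (simp add: o_def)

lemma hfun_add: "hfun f U \<Longrightarrow> hfun g U \<Longrightarrow> hfun (\<lambda>x. f x + g x) U"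
  by (rule hfunI) (use hfunD in \<open>force intro!: holomorphic_intros simp: o_def\<close>)

lemma hfun_mult: "hfun f U \<Longrightarrow> hfun g U \<Longrightarrow> hfun (\<lambda>x. f x * g x) U"
  by (rule hfunI) (use hfunD in \<open>force intro!: holomorphic_intros simp: o_def\<close>)

lemma hfun_sum: "(\<And>i. i \<in> I \<Longrightarrow> hfun (f i) U) \<Longrightarrow> hfun (\<lambda>x. \<Sum>i\<in>I. f i x) U"
  by (induction I rule: infinite_finite_induct) (auto intro: hfun_const hfun_add)

lemma hfun_prod: "(\<And>i. i \<in> I \<Longrightarrow> hfun (f i) U) \<Longrightarrow> hfun (\<lambda>x. \<Prod>i\<in>I. f i x) U"
  by (induction I rule: infinite_finite_induct) (auto intro: hfun_const hfun_mult)

lemma hfun_inverse: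
  assumes "hfun f U" "\<And>x. x \<in> U \<Longrightarrow> f x \<noteq> 0" shows "hfun (\<lambda>x. inverse (f x)) U"
proof (rule hfunI)
  fix V z assume c: "(V, z) \<in> A"
  have "(\<lambda>w. inverse ((f \<circ> the_inv_into V z) w)) holomorphic_on z ` (U \<inter> V)"
    by (rule holomorphic_on_inverse[OF hfunD[OF assms(1) c]]) (use assms(2) chartD(6)[OF c] in auto)
  then show "((\<lambda>x. inverse (f x)) \<circ> the_inv_into V z) holomorphic_on z ` (U \<inter> V)" by (simp add: o_def)
qed

lemma hfun_local:
  assumes "open U" "\<And>x. x \<in> U \<Longrightarrow> \<exists>S. open S \<and> x \<in> S \<and> hfun f (U \<inter> S)"
  shows "hfun f U"
proof (rule hfunI)
  fix V z assume c: "(V, z) \<in> A"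
  from assms(2) obtain S where S: "\<And>x. x \<in> U \<Longrightarrow> open (S x) \<and> x \<in> S x \<and> hfun f (U \<inter> S x)" by metis
  have "(f \<circ> the_inv_into V z) holomorphic_on (\<Union>x\<in>U. z ` ((U \<inter> S x) \<inter> V))"
  proof (rule holomorphic_on_UN_open)
    fix x assume x: "x \<in> U"
    then show "(f \<circ> the_inv_into V z) holomorphic_on z ` ((U \<inter> S x) \<inter> V)" using S hfunD[OF _ c] by blast
    show "open (z ` (U \<inter> S x \<inter> V))" using open_chart_image[OF c, of "U \<inter> S x"] S[OF x] \<open>open U\<close>
      by (simp add: Int_ac open_Int)
  qed
  moreover have "(\<Union>x\<in>U. z ` ((U \<inter> S x) \<inter> V)) = z ` (U \<inter> V)" using S by blast
  ultimately show "(f \<circ> the_inv_into V z) holomorphic_on z ` (U \<inter> V)" by simp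
qed

lemma hfun_continuous:
  assumes "hfun f U" "open U" shows "continuous_on U f"
proof (rule continuous_at_imp_continuous_on, rule ballI)
  fix x assume x: "x \<in> U"
  obtain V z where c: "(V, z) \<in> A" "x \<in> V" using ex_chart[of x] by auto
  have op: "open (U \<inter> V)" using \<open>open U\<close> chartD(1)[OF c(1)] by auto
  have "continuous_on (z ` (U \<inter> V)) (f \<circ> the_inv_into V z)"
    by (rule holomorphic_on_imp_continuous_on[OF hfunD[OF assms(1) c(1)]])
  then have "continuous_on (U \<inter> V) ((f \<circ> the_inv_into V z) \<circ> z)"
    by (rule continuous_on_compose[rotated]) (rule continuous_on_subset[OF chartD(3)[OF c(1)]], simp)
  moreover have "((f \<circ> the_inv_into V z) \<circ> z) y = f y" if "y \<in> U \<inter> V" for y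
    using chartD(6)[OF c(1)] that by simp
  ultimately have "continuous_on (U \<inter> V) f" by (simp cong: continuous_on_cong_simp)
  then show "isCont f x" using op x c(2) by (simp add: continuous_on_eq_continuous_at)
qed

lemma hmatI:
  assumes "\<And>x. x \<in> U \<Longrightarrow> M x \<in> carrier_mat m n" "\<And>i j. i < m \<Longrightarrow> j < n \<Longrightarrow> hfun (\<lambda>x. M x $$ (i,j)) U"
  shows "hmat m n M U"
  using assms by (simp add: hol_mat_on_def)

lemma hmatD:
  assumes "hmat m n M U"
  shows "x \<in> U \<Longrightarrow> M x \<in> carrier_mat m n" "i < m \<Longrightarrow> j < n \<Longrightarrow> hfun (\<lambda>x. M x $$ (i,j)) U"
  using assms by (simp_all add: hol_mat_on_def)

lemma hmat_subset: "hmat m n M U \<Longrightarrow> S \<subseteq> U \<Longrightarrow> hmat m n M S"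
  by (rule hmatI) (auto dest: hmatD intro: hfun_subset)

lemma hmat_mat: "(\<And>i j. i < m \<Longrightarrow> j < n \<Longrightarrow> hfun (\<lambda>x. f x i j) U) \<Longrightarrow> hmat m n (\<lambda>x. mat m n (\<lambda>(i,j). f x i j)) U"
  by (rule hmatI) simp_all

lemma hmat_const: "M \<in> carrier_mat m n \<Longrightarrow> hmat m n (\<lambda>_. M) U"
  by (rule hmatI) (auto intro: hfun_const)

lemma hmat_mult:
  assumes "hmat l m M U" "hmat m n N U" shows "hmat l n (\<lambda>x. M x * N x) U"
proof (rule hmatI)
  show "M x * N x \<in> carrier_mat l n" if "x \<in> U" for x using that assms by (meson hmatD(1) mult_carrier_mat)
  fix i j assume ij: "i < l" "j < n"
  have "hfun (\<lambda>x. \<Sum>k\<in>{0..<m}. M x $$ (i,k) * N x $$ (k,j)) U"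
    using ij by (intro hfun_sum hfun_mult hmatD(2)[OF assms(1)] hmatD(2)[OF assms(2)]) auto
  then show "hfun (\<lambda>x. (M x * N x) $$ (i,j)) U"
  proof (rule hfun_cong)
    fix x assume "x \<in> U"
    from hmatD(1)[OF assms(1) this] hmatD(1)[OF assms(2) this]
    show "(\<Sum>k\<in>{0..<m}. M x $$ (i,k) * N x $$ (k,j)) = (M x * N x) $$ (i,j)"
      using ij by (simp add: scalar_prod_def)
  qed
qed

lemma hfun_det:
  assumes "hmat n n M U" shows "hfun (\<lambda>x. det (M x)) U"
proof -
  have "hfun (\<lambda>x. \<Sum>p | p permutes {0..<n}. signof p * (\<Prod>i=0..<n. M x $$ (i, p i))) U"
    by (intro hfun_sum hfun_mult hfun_prod hfun_const hmatD(2)[OF assms]) (auto simp: permutes_def dest: permutes_in_image)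
  then show ?thesis by (rule hfun_cong) (simp add: det_def'[OF hmatD(1)[OF assms]])
qed

lemma hmat_inv:
  assumes M: "hmat n n M U" and d: "\<And>x. x \<in> U \<Longrightarrow> det (M x) \<noteq> 0"
  shows "hmat n n (\<lambda>x. mat_inv (M x)) U"
proof (rule hmatI)
  show "mat_inv (M x) \<in> carrier_mat n n" if "x \<in> U" for x using mat_inv(1)[OF hmatD(1)[OF M that] d[OF that]] .
  fix i j assume ij: "i < n" "j < n"
  have "hmat (n - 1) (n - 1) (\<lambda>x. mat_delete (M x) j i) U"
  proof (rule hmatI)
    fix a b assume ab: "a < n - 1" "b < n - 1"
    have "hfun (\<lambda>x. M x $$ (if a < j then a else Suc a, if b < i then b else Suc b)) U"
      using ab by (intro hmatD(2)[OF M]) auto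
    then show "hfun (\<lambda>x. mat_delete (M x) j i $$ (a,b)) U"
      by (rule hfun_cong) (use hmatD(1)[OF M] ab in \<open>force simp: mat_delete_def\<close>)
  qed (use hmatD(1)[OF M] in \<open>metis mat_delete_carrier\<close>)
  then have "hfun (\<lambda>x. inverse (det (M x)) * ((-1)^(j+i) * det (mat_delete (M x) j i))) U"
    by (intro hfun_mult hfun_inverse hfun_const hfun_det[OF M] d) (auto intro: hfun_det)
  then show "hfun (\<lambda>x. mat_inv (M x) $$ (i,j)) U"
    by (rule hfun_cong) (use hmatD(1)[OF M] ij in \<open>force simp: mat_inv_def adj_mat_def cofactor_def\<close>)
qed

text \<open>Fibres carry no linear structure of their own, so linearity is a relation between two
  families of coordinates on the same sets. Transition functions, bundle maps, restrictions to
  subbundles and passages to quotients all take this form, and they compose by matrix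
  multiplication.\<close>

definition hol_lin :: "('x \<Rightarrow> 'v set) \<Rightarrow> nat \<Rightarrow> nat \<Rightarrow> ('x \<Rightarrow> 'v \<Rightarrow> complex vec) \<Rightarrow> ('x \<Rightarrow> 'v \<Rightarrow> complex vec) \<Rightarrow> 'x set \<Rightarrow> bool" where
  "hol_lin V n m p q U \<longleftrightarrow> (\<exists>M. hmat m n M U \<and> (\<forall>x\<in>U. \<forall>v\<in>V x. q x v = M x *\<^sub>v p x v))"

lemma hol_linI:
  "hmat m n M U \<Longrightarrow> (\<And>x v. x \<in> U \<Longrightarrow> v \<in> V x \<Longrightarrow> q x v = M x *\<^sub>v p x v) \<Longrightarrow> hol_lin V n m p q U"
  by (auto simp: hol_lin_def)

lemma hol_lin_subset: "hol_lin V n m p q U \<Longrightarrow> S \<subseteq> U \<Longrightarrow> hol_lin V n m p q S"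
  unfolding hol_lin_def by (meson hmat_subset subset_iff)

lemma hol_lin_sub_fibre: "hol_lin V n m p q U \<Longrightarrow> (\<And>x. x \<in> U \<Longrightarrow> V' x \<subseteq> V x) \<Longrightarrow> hol_lin V' n m p q U"
  unfolding hol_lin_def by (meson subset_iff)

lemma hol_lin_trans:
  assumes "hol_lin V n m p q U" "hol_lin V m l q r U"
    and "\<And>x v. x \<in> U \<Longrightarrow> v \<in> V x \<Longrightarrow> p x v \<in> carrier_vec n"
  shows "hol_lin V n l p r U"
proof -
  from assms obtain M N where M: "hmat m n M U" "\<And>x v. x \<in> U \<Longrightarrow> v \<in> V x \<Longrightarrow> q x v = M x *\<^sub>v p x v"
    and N: "hmat l m N U" "\<And>x v. x \<in> U \<Longrightarrow> v \<in> V x \<Longrightarrow> r x v = N x *\<^sub>v q x v"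
    by (auto simp: hol_lin_def)
  show ?thesis
    by (rule hol_linI[OF hmat_mult[OF N(1) M(1)]])
       (simp add: M(2) N(2) assoc_mult_mat_vec[OF hmatD(1)[OF N(1)] hmatD(1)[OF M(1)] assms(3)])
qed

lemma hol_lin_pullback:
  assumes "hol_lin V n m p q U" and "\<And>x v. x \<in> U \<Longrightarrow> v \<in> V' x \<Longrightarrow> h x v \<in> V x"
  shows "hol_lin V' n m (\<lambda>x v. p x (h x v)) (\<lambda>x v. q x (h x v)) U"
  using assms unfolding hol_lin_def by blast

lemma hol_lin_cong:
  assumes "hol_lin V n m p q U" "\<And>x v. x \<in> U \<Longrightarrow> v \<in> V x \<Longrightarrow> p x v = p' x v"
    "\<And>x v. x \<in> U \<Longrightarrow> v \<in> V x \<Longrightarrow> q x v = q' x v"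
  shows "hol_lin V n m p' q' U"
  using assms unfolding hol_lin_def by metis

text \<open>Surjectivity of \<open>p\<close> and injectivity of \<open>q\<close> leave the matrix no
  kernel; Cramer's rule then keeps its inverse holomorphic.\<close>

lemma hol_lin_inverse:
  assumes "hol_lin V n n p q U"
    and p: "\<And>x. x \<in> U \<Longrightarrow> p x ` V x = carrier_vec n"
    and q: "\<And>x. x \<in> U \<Longrightarrow> q x ` V x = carrier_vec n"
    and inj: "\<And>x. x \<in> U \<Longrightarrow> inj_on (q x) (V x)"
  shows "hol_lin V n n q p U"
proof -
  from assms(1) obtain M where M: "hmat n n M U" "\<And>x v. x \<in> U \<Longrightarrow> v \<in> V x \<Longrightarrow> q x v = M x *\<^sub>v p x v"
    by (auto simp: hol_lin_def)
  have d: "det (M x) \<noteq> 0" if x: "x \<in> U" for x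
  proof (rule det_nonzero_if_injective[OF hmatD(1)[OF M(1) x]])
    fix u assume u: "u \<in> carrier_vec n" "M x *\<^sub>v u = 0\<^sub>v n"
    obtain v where v: "v \<in> V x" "u = p x v" using p[OF x] u(1) by blast
    \<comment> \<open>\<open>w\<close> acts as the zero of the fibre, which is available only as the
      point with coordinates 0.\<close>
    obtain w where w: "w \<in> V x" "0\<^sub>v n = p x w" using p[OF x] zero_carrier_vec by blast
    have "q x v = 0\<^sub>v n" using M(2)[OF x v(1)] v u by simp
    moreover have "q x w = 0\<^sub>v n" using M(2)[OF x w(1)] w(2)[symmetric] hmatD(1)[OF M(1) x] by (auto intro!: eq_vecI)
    ultimately show "u = 0\<^sub>v n" using inj_onD[OF inj[OF x]] v w by metis
  qed
  show ?thesis
  proof (rule hol_linI[OF hmat_inv[OF M(1) d]])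
    fix x v assume x: "x \<in> U" "v \<in> V x"
    have "p x v \<in> carrier_vec n" using p[OF x(1)] x(2) by blast
    then show "p x v = mat_inv (M x) *\<^sub>v q x v"
      using mat_inv(4)[OF hmatD(1)[OF M(1) x(1)] d[OF x(1)]] M(2)[OF x] by simp
  qed
qed

text \<open>The matrix of a linear map is unique once the source coordinates are surjective, so local
  matrices glue.\<close>

lemma hol_lin_local:
  assumes U: "open U" and p: "\<And>x. x \<in> U \<Longrightarrow> p x ` V x = carrier_vec n"
    and loc: "\<And>x. x \<in> U \<Longrightarrow> \<exists>S. open S \<and> x \<in> S \<and> hol_lin V n m p q (U \<inter> S)"
  shows "hol_lin V n m p q U"
proof -
  define P where "P x S M \<longleftrightarrow> open S \<and> x \<in> S \<and> hmat m n M (U \<inter> S) \<and> (\<forall>y\<in>U \<inter> S. \<forall>v\<in>V y. q y v = M y *\<^sub>v p y v)" for x S M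
  have "\<forall>x\<in>U. \<exists>S M. P x S M" using loc unfolding hol_lin_def P_def by blast
  then obtain S M where SM: "\<And>x. x \<in> U \<Longrightarrow> P x (S x) (M x)" by metis
  define N where "N x = M x x" for x
  have agree: "N y = M x y" if "x \<in> U" "y \<in> U \<inter> S x" for x y
  proof (rule mat_eq_if_mult_eq[of _ m n])
    have y: "y \<in> U" "y \<in> S x" "y \<in> S y" using that SM[of y] by (auto simp: P_def)
    show "N y \<in> carrier_mat m n" "M x y \<in> carrier_mat m n"
      using SM[OF that(1)] SM[OF y(1)] y hmatD(1) unfolding P_def N_def by blast+
    fix u :: "complex vec" assume "u \<in> carrier_vec n"
    then obtain v where v: "v \<in> V y" "u = p y v" using p[OF y(1)] by blast
    have "q y v = M y y *\<^sub>v p y v" "q y v = M x y *\<^sub>v p y v"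
      using SM[OF that(1)] SM[OF y(1)] y v unfolding P_def by blast+
    then show "N y *\<^sub>v u = M x y *\<^sub>v u" by (simp add: v N_def)
  qed
  show ?thesis
  proof (rule hol_linI[of m n N])
    show "hmat m n N U"
    proof (rule hmatI)
      fix x assume "x \<in> U"
      then show "N x \<in> carrier_mat m n" using SM[of x] hmatD(1) unfolding P_def N_def by blast
    next
      fix i j assume ij: "i < m" "j < n"
      show "hfun (\<lambda>x. N x $$ (i,j)) U"
      proof (rule hfun_local[OF U])
        fix x assume x: "x \<in> U"
        have "hfun (\<lambda>y. M x y $$ (i,j)) (U \<inter> S x)" using SM[OF x] hmatD(2) ij unfolding P_def by blast
        then have "hfun (\<lambda>y. N y $$ (i,j)) (U \<inter> S x)" by (rule hfun_cong) (simp add: agree[OF x])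
        then show "\<exists>S. open S \<and> x \<in> S \<and> hfun (\<lambda>x. N x $$ (i,j)) (U \<inter> S)"
          using SM[OF x] unfolding P_def by blast
      qed
    qed
    fix x v assume "x \<in> U" "v \<in> V x"
    then show "q x v = N x *\<^sub>v p x v" using SM[of x] unfolding P_def N_def by blast
  qed
qed

end

section \<open>Coordinate selections and independent rows\<close>

definition sel_mat :: "nat \<Rightarrow> nat \<Rightarrow> (nat \<Rightarrow> nat) \<Rightarrow> complex mat" where
  "sel_mat m n f = mat m n (\<lambda>(i,j). if j = f i then 1 else 0)"

lemma sel_mat_carrier [simp]: "sel_mat m n f \<in> carrier_mat m n"
  by (simp add: sel_mat_def)

lemma sel_mat_mult:
  assumes "v \<in> carrier_vec n"
  shows "sel_mat m n f *\<^sub>v v = vec m (\<lambda>i. if f i < n then v $ f i else 0)"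
proof (rule eq_vecI)
  fix i assume "i < dim_vec (vec m (\<lambda>i. if f i < n then v $ f i else 0))"
  then have i: "i < m" by simp
  have "(sel_mat m n f *\<^sub>v v) $ i = (\<Sum>j<n. (if j = f i then 1 else 0) * v $ j)"
    using assms i by (simp add: sel_mat_def scalar_prod_def lessThan_atLeast0)
  also have "\<dots> = (if f i < n then v $ f i else 0)"
  proof -
    have "(\<Sum>j<n. (if j = f i then 1 else 0) * v $ j) = (\<Sum>j<n. if j = f i then v $ j else 0)"
      by (intro sum.cong) auto
    then show ?thesis by simp
  qed
  finally show "(sel_mat m n f *\<^sub>v v) $ i = vec m (\<lambda>i. if f i < n then v $ f i else 0) $ i" using i by simp
qed (simp add: sel_mat_def)

lemma vec_first_sel: "m \<le> n \<Longrightarrow> v \<in> carrier_vec n \<Longrightarrow> vec_first v m = sel_mat m n id *\<^sub>v v"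
  by (auto simp: sel_mat_mult vec_first_def)

lemma vec_last_sel: "q \<le> n \<Longrightarrow> v \<in> carrier_vec n \<Longrightarrow> vec_last v q = sel_mat q n (\<lambda>i. n - q + i) *\<^sub>v v"
  by (auto simp: sel_mat_mult vec_last_def)

text \<open>On vectors whose further entries vanish this inverts \<open>vec_first\<close>. In
  \<open>sel_mat\<close> an index out of range selects 0, so padding is again multiplication by a
  constant matrix and in particular holomorphic.\<close>

definition pad :: "nat \<Rightarrow> complex vec \<Rightarrow> complex vec" where
  "pad n v = vec n (\<lambda>i. if i < dim_vec v then v $ i else 0)"

lemma pad_carrier [simp]: "pad n v \<in> carrier_vec n" by (simp add: pad_def)

lemma pad_sel: "v \<in> carrier_vec m \<Longrightarrow> pad n v = sel_mat n m id *\<^sub>v v"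
  by (auto simp: sel_mat_mult pad_def)

lemma vec_first_pad: "v \<in> carrier_vec m \<Longrightarrow> m \<le> n \<Longrightarrow> vec_first (pad n v) m = v"
  by (rule eq_vecI) (auto simp: vec_first_def pad_def)

lemma pad_vec_first:
  "v \<in> carrier_vec n \<Longrightarrow> (\<And>i. m \<le> i \<Longrightarrow> i < n \<Longrightarrow> v $ i = 0) \<Longrightarrow> pad n (vec_first v m) = v"
  by (rule eq_vecI) (auto simp: vec_first_def pad_def)

lemma right_inverse_mat:
  assumes K: "(K :: complex mat) \<in> carrier_mat s m"
    and surj: "\<And>y. y \<in> carrier_vec s \<Longrightarrow> \<exists>w\<in>carrier_vec m. K *\<^sub>v w = y"
  obtains B where "B \<in> carrier_mat m s" "K * B = 1\<^sub>m s"
proof -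
  from surj obtain w where w: "\<And>y. y \<in> carrier_vec s \<Longrightarrow> w y \<in> carrier_vec m \<and> K *\<^sub>v w y = y" by metis
  define B where "B = mat m s (\<lambda>(i,j). w (unit_vec s j) $ i)"
  have B: "B \<in> carrier_mat m s" by (simp add: B_def)
  have "K * B = 1\<^sub>m s"
  proof (rule eq_matI)
    fix i j assume "i < dim_row (1\<^sub>m s)" "j < dim_col (1\<^sub>m s)"
    then have ij: "i < s" "j < s" by simp_all
    have "col B j = w (unit_vec s j)" using ij w[of "unit_vec s j"] by (intro eq_vecI) (auto simp: B_def)
    then have "(K * B) $$ (i,j) = (K *\<^sub>v w (unit_vec s j)) $ i" using ij K B by simp
    also have "\<dots> = 1\<^sub>m s $$ (i,j)" using w[of "unit_vec s j"] ij by simp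
    finally show "(K * B) $$ (i,j) = 1\<^sub>m s $$ (i,j)" .
  qed (use K B in auto)
  with B that show thesis by blast
qed

lemma surjective_mat_wide:
  assumes K: "(K :: complex mat) \<in> carrier_mat s m"
    and surj: "\<And>y. y \<in> carrier_vec s \<Longrightarrow> \<exists>w\<in>carrier_vec m. K *\<^sub>v w = y"
  shows "s \<le> m"
proof -
  obtain B where B: "B \<in> carrier_mat m s" "K * B = 1\<^sub>m s" using right_inverse_mat[OF K surj] by blast
  show ?thesis
  proof (rule injective_mat_tall[OF B(1)])
    fix v :: "complex vec" assume v: "v \<in> carrier_vec s" "B *\<^sub>v v = 0\<^sub>v m"
    have "v = K *\<^sub>v (B *\<^sub>v v)" using assoc_mult_mat_vec[OF K B(1) v(1)] B(2) v(1) by simp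
    then show "v = 0\<^sub>v s" using v K by (auto intro!: eq_vecI)
  qed
qed

lemma det_nonzero_if_surjective:
  assumes K: "(K :: complex mat) \<in> carrier_mat n n"
    and surj: "\<And>y. y \<in> carrier_vec n \<Longrightarrow> \<exists>w\<in>carrier_vec n. K *\<^sub>v w = y"
  shows "det K \<noteq> 0"
proof -
  obtain B where B: "B \<in> carrier_mat n n" "K * B = 1\<^sub>m n" using right_inverse_mat[OF K surj] by blast
  then have "det K * det B = 1" using det_mult[OF K B(1)] by simp
  then show ?thesis by auto
qed

text \<open>The rows are chosen greedily: a kernel vector of the rows chosen so far is detected by some
  further row.\<close>

lemma extend_independent_rows:
  assumes G: "(G :: complex mat) \<in> carrier_mat r m"
    and inj: "\<And>w. w \<in> carrier_vec m \<Longrightarrow> G *\<^sub>v w = 0\<^sub>v r \<Longrightarrow> w = 0\<^sub>v m"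
    and "s \<le> r" and surj: "\<And>y. y \<in> carrier_vec s \<Longrightarrow> \<exists>w\<in>carrier_vec m. \<forall>i<s. (G *\<^sub>v w) $ i = y $ i"
  obtains f where "s \<le> m" "\<And>i. i < s \<Longrightarrow> f i = i" "\<And>i. i < m \<Longrightarrow> f i < r" "\<And>i. s \<le> i \<Longrightarrow> i < m \<Longrightarrow> s \<le> f i"
    "det (mat m m (\<lambda>(i,j). G $$ (f i, j))) \<noteq> 0"
proof -
  define rows where "rows f j = mat j m (\<lambda>(i,l). G $$ (f i, l))" for f :: "nat \<Rightarrow> nat" and j
  have rows_carrier: "rows f j \<in> carrier_mat j m" for f j by (simp add: rows_def)
  have rows_mult: "(rows f j *\<^sub>v w) $ i = (G *\<^sub>v w) $ f i" if "i < j" "f i < r" "w \<in> carrier_vec m" for f j w i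
  proof -
    have "row (rows f j) i = row G (f i)" using that G by (intro eq_vecI) (auto simp: rows_def)
    then show ?thesis using that G rows_carrier[of f j] by (metis carrier_matD(1) index_mult_mat_vec)
  qed
  \<comment> \<open>Independence of the chosen rows is expressed as surjectivity of the matrix they
    form; for \<open>m\<close> rows this yields a nonzero determinant.\<close>
  define good where "good f j \<longleftrightarrow> (\<forall>i<s. f i = i) \<and> (\<forall>i<j. f i < r) \<and> (\<forall>i. s \<le> i \<and> i < j \<longrightarrow> s \<le> f i) \<and>
    (\<forall>y\<in>carrier_vec j. \<exists>w\<in>carrier_vec m. rows f j *\<^sub>v w = y)" for f j
  have base: "good (\<lambda>i. i) s" unfolding good_def
  proof (intro conjI allI impI ballI)
    fix y :: "complex vec" assume y: "y \<in> carrier_vec s"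
    obtain w where w: "w \<in> carrier_vec m" "\<forall>i<s. (G *\<^sub>v w) $ i = y $ i" using surj[OF y] by blast
    have "rows (\<lambda>i. i) s *\<^sub>v w = y"
      by (rule eq_vecI) (use y w \<open>s \<le> r\<close> rows_mult[of _ s "\<lambda>i. i" w] rows_carrier[of "\<lambda>i. i" s] in auto)
    with w(1) show "\<exists>w\<in>carrier_vec m. rows (\<lambda>i. i) s *\<^sub>v w = y" by blast
  qed (use \<open>s \<le> r\<close> in auto)
  have "s \<le> m" using base surjective_mat_wide[OF rows_carrier[of "\<lambda>i. i" s]] unfolding good_def by blast
  have ex: "\<exists>f. good f j" if "s \<le> j" "j \<le> m" for j
    using that
  proof (induction j rule: dec_induct)
    case base
    then show ?case using \<open>good (\<lambda>i. i) s\<close> by blast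
  next
    case (step j)
    then obtain f where f: "good f j" by auto
    have "j < m" using step by simp
    obtain u where u: "u \<in> carrier_vec m" "u \<noteq> 0\<^sub>v m" "rows f j *\<^sub>v u = 0\<^sub>v j"
      using wide_matrix_kernel[OF rows_carrier \<open>j < m\<close>] by blast
    have "G *\<^sub>v u \<noteq> 0\<^sub>v r" using inj u by blast
    then obtain a where a: "a < r" "(G *\<^sub>v u) $ a \<noteq> 0"
      using G by (metis carrier_matD(1) dim_mult_mat_vec eq_vecI index_zero_vec)
    have ku: "(G *\<^sub>v u) $ f i = 0" if "i < j" for i
      using rows_mult[of i j f u] that f u unfolding good_def by simp
    \<comment> \<open>The rows chosen so far, among them the first \<open>s\<close>, kill
      \<open>u\<close>; so the row that detects it lies beyond these.\<close>
    have "s \<le> a" using ku f a(2) \<open>s \<le> j\<close> unfolding good_def by (metis not_le order_less_le_trans)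
    define f' where "f' = f(j := a)"
    have "good f' (Suc j)" unfolding good_def
    proof (intro conjI allI impI ballI)
      show "f' i = i" if "i < s" for i using that f \<open>s \<le> j\<close> by (auto simp: good_def f'_def)
      show lt: "f' i < r" if "i < Suc j" for i using that f a by (auto simp: good_def f'_def)
      show "s \<le> f' i" if "s \<le> i \<and> i < Suc j" for i using that f \<open>s \<le> a\<close> by (auto simp: good_def f'_def)
      fix y :: "complex vec" assume y: "y \<in> carrier_vec (Suc j)"
      obtain w where w: "w \<in> carrier_vec m" "rows f j *\<^sub>v w = vec_first y j"
        using f unfolding good_def by (meson vec_first_carrier)
      \<comment> \<open>Adding a multiple of \<open>u\<close> leaves the earlier entries alone, and
        \<open>t\<close> is the multiple that gives the new entry its value
        \<open>y $ j\<close>.\<close>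
      define t where "t = (y $ j - (G *\<^sub>v w) $ a) / (G *\<^sub>v u) $ a"
      define w' where "w' = w + t \<cdot>\<^sub>v u"
      have w': "w' \<in> carrier_vec m" using w u by (simp add: w'_def)
      have Gw': "(G *\<^sub>v w') $ b = (G *\<^sub>v w) $ b + t * (G *\<^sub>v u) $ b" if "b < r" for b
        using that G w u unfolding w'_def by (simp add: scalar_prod_add_distrib[of _ m])
      have "rows f' (Suc j) *\<^sub>v w' = y"
      proof (rule eq_vecI)
        fix i assume "i < dim_vec y"
        then have i: "i < Suc j" using y by simp
        have 1: "(rows f' (Suc j) *\<^sub>v w') $ i = (G *\<^sub>v w) $ f' i + t * (G *\<^sub>v u) $ f' i"
          using rows_mult[of i "Suc j" f' w', OF i lt[OF i] w'] Gw'[OF lt[OF i]] by simp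
        show "(rows f' (Suc j) *\<^sub>v w') $ i = y $ i"
        proof (cases "i = j")
          case True
          then show ?thesis using 1 a by (simp add: f'_def t_def)
        next
          case False
          then have "i < j" using i by simp
          then have "(G *\<^sub>v w) $ f i = y $ i"
            using rows_mult[of i j f w] f w unfolding good_def by (simp add: vec_first_def)
          then show ?thesis using 1 False ku[OF \<open>i < j\<close>] by (simp add: f'_def)
        qed
      qed (use y rows_carrier[of f' "Suc j"] in auto)
      with w' show "\<exists>w\<in>carrier_vec m. rows f' (Suc j) *\<^sub>v w = y" by blast
    qed
    then show ?case by blast
  qed
  from ex[OF \<open>s \<le> m\<close> order_refl] obtain f where f: "good f m" ..
  then have "det (rows f m) \<noteq> 0" unfolding good_def by (intro det_nonzero_if_surjective[OF rows_carrier]) blast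
  with f \<open>s \<le> m\<close> show thesis unfolding good_def rows_def by (intro that[of f]) auto
qed

section \<open>Subbundles\<close>

context compact_riemann_surface begin

lemma hol_trivD:
  assumes "hol_triv A E c"
  shows "open (fst c)" "x \<in> fst c \<Longrightarrow> bij_betw (snd c x) (fibre E x) (carrier_vec (vb_rank E))"
    "x \<in> fst c \<Longrightarrow> snd c x ` fibre E x = carrier_vec (vb_rank E)"
    "x \<in> fst c \<Longrightarrow> inj_on (snd c x) (fibre E x)"
    "x \<in> fst c \<Longrightarrow> v \<in> fibre E x \<Longrightarrow> snd c x v \<in> carrier_vec (vb_rank E)"
    "b \<in> trivs E \<Longrightarrow> hol_lin (fibre E) (vb_rank E) (vb_rank E) (snd b) (snd c) (fst b \<inter> fst c)"
proof -
  show "open (fst c)" "x \<in> fst c \<Longrightarrow> bij_betw (snd c x) (fibre E x) (carrier_vec (vb_rank E))"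
    using assms by (auto simp: hol_triv_def)
  then show "x \<in> fst c \<Longrightarrow> snd c x ` fibre E x = carrier_vec (vb_rank E)"
    "x \<in> fst c \<Longrightarrow> inj_on (snd c x) (fibre E x)"
    "x \<in> fst c \<Longrightarrow> v \<in> fibre E x \<Longrightarrow> snd c x v \<in> carrier_vec (vb_rank E)"
    by (auto simp: bij_betw_def)
  show "b \<in> trivs E \<Longrightarrow> hol_lin (fibre E) (vb_rank E) (vb_rank E) (snd b) (snd c) (fst b \<inter> fst c)"
    using assms unfolding hol_triv_def hol_lin_def by blast
qed

lemma hol_trivI:
  assumes "open (fst c)" "\<And>x. x \<in> fst c \<Longrightarrow> bij_betw (snd c x) (fibre E x) (carrier_vec (vb_rank E))"
    "\<And>b. b \<in> trivs E \<Longrightarrow> hol_lin (fibre E) (vb_rank E) (vb_rank E) (snd b) (snd c) (fst b \<inter> fst c)"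
  shows "hol_triv A E c"
  using assms unfolding hol_triv_def hol_lin_def by blast

lemma hol_vbundle_triv: "hol_vbundle A E \<Longrightarrow> c \<in> trivs E \<Longrightarrow> hol_triv A E c"
  by (auto simp: hol_vbundle_def)

lemma hol_vbundle_ex: "hol_vbundle A E \<Longrightarrow> \<exists>c\<in>trivs E. x \<in> fst c"
  by (auto simp: hol_vbundle_def)

lemma triv_coords_ex:
  assumes "hol_triv A E c" "x \<in> fst c" "y \<in> carrier_vec (vb_rank E)"
  obtains v where "v \<in> fibre E x" "snd c x v = y"
proof -
  from assms(3) have "y \<in> snd c x ` fibre E x" unfolding hol_trivD(3)[OF assms(1,2)] .
  then show thesis using that by (elim imageE) simp
qed

text \<open>Holomorphic trivializations are by definition compared only with the members of
  \<open>trivs E\<close>. Two of them are compared through such a member near each point, and the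
  local matrices glue.\<close>

lemma hol_triv_transition:
  assumes E: "hol_vbundle A E" and c: "hol_triv A E c" and d: "hol_triv A E d"
  shows "hol_lin (fibre E) (vb_rank E) (vb_rank E) (snd c) (snd d) (fst c \<inter> fst d)"
proof (rule hol_lin_local)
  show "open (fst c \<inter> fst d)" by (intro open_Int hol_trivD(1)[OF c] hol_trivD(1)[OF d])
  show "snd c x ` fibre E x = carrier_vec (vb_rank E)" if "x \<in> fst c \<inter> fst d" for x
    using hol_trivD(3)[OF c] that by blast
  fix x assume x: "x \<in> fst c \<inter> fst d"
  obtain b where b: "b \<in> trivs E" "x \<in> fst b" using hol_vbundle_ex[OF E] by blast
  have bt: "hol_triv A E b" using hol_vbundle_triv[OF E b(1)] .
  let ?r = "vb_rank E" and ?U = "fst c \<inter> fst d \<inter> fst b"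
  have "hol_lin (fibre E) ?r ?r (snd c) (snd d) ?U"
  proof (rule hol_lin_trans)
    show "hol_lin (fibre E) ?r ?r (snd c) (snd b) ?U"
    proof (rule hol_lin_inverse)
      show "hol_lin (fibre E) ?r ?r (snd b) (snd c) ?U"
        by (rule hol_lin_subset[OF hol_trivD(6)[OF c b(1)]]) auto
    qed (use hol_trivD(3,4)[OF c] hol_trivD(3)[OF bt] in auto)
    show "hol_lin (fibre E) ?r ?r (snd b) (snd d) ?U"
      by (rule hol_lin_subset[OF hol_trivD(6)[OF d b(1)]]) auto
  qed (use hol_trivD(5)[OF c] in auto)
  then show "\<exists>S. open S \<and> x \<in> S \<and> hol_lin (fibre E) ?r ?r (snd c) (snd d) (fst c \<inter> fst d \<inter> S)"
    using b hol_trivD(1)[OF bt] by blast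
qed

lemma transition_mat:
  assumes E: "hol_vbundle A E" and c: "hol_triv A E c" "x \<in> fst c" and d: "hol_triv A E d" "x \<in> fst d"
  obtains g where "g \<in> carrier_mat (vb_rank E) (vb_rank E)" "\<And>v. v \<in> fibre E x \<Longrightarrow> snd d x v = g *\<^sub>v snd c x v"
  using hol_triv_transition[OF E c(1) d(1)] c(2) d(2) hmatD(1) unfolding hol_lin_def by blast

text \<open>Transition matrices act linearly, so adding coordinates singles out the same point in
  every trivialization, including those outside \<open>trivs E\<close>.\<close>

lemma fibre_add_unique:
  assumes E: "hol_vbundle A E" and vw: "v \<in> fibre E x" "w \<in> fibre E x"
    and c: "hol_triv A E c" "x \<in> fst c" and u: "u \<in> fibre E x" "snd c x u = snd c x v + snd c x w"
  shows "fibre_add E x v w = u"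
  unfolding fibre_add_def
proof (rule the_equality)
  have tr: "snd d x u' = snd d x v + snd d x w"
    if b: "hol_triv A E b" "x \<in> fst b" and d: "hol_triv A E d" "x \<in> fst d"
      and u': "u' \<in> fibre E x" "snd b x u' = snd b x v + snd b x w" for b d u'
  proof -
    obtain g where g: "g \<in> carrier_mat (vb_rank E) (vb_rank E)" "\<And>v. v \<in> fibre E x \<Longrightarrow> snd d x v = g *\<^sub>v snd b x v"
      using transition_mat[OF E b d] by blast
    show ?thesis
      using g(2)[OF vw(1)] g(2)[OF vw(2)] g(2)[OF u'(1)] u'(2)
        mult_add_distrib_mat_vec[OF g(1) hol_trivD(5)[OF b vw(1)] hol_trivD(5)[OF b vw(2)]] by simp
  qed
  obtain b where b: "b \<in> trivs E" "x \<in> fst b" using hol_vbundle_ex[OF E] by blast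
  show "u \<in> fibre E x \<and> (\<exists>c\<in>trivs_at E x. snd c x u = snd c x v + snd c x w)"
    using tr[OF c hol_vbundle_triv[OF E b(1)] b(2) u] u(1) b unfolding trivs_at_def by blast
  fix u' assume "u' \<in> fibre E x \<and> (\<exists>c\<in>trivs_at E x. snd c x u' = snd c x v + snd c x w)"
  then obtain d where d: "u' \<in> fibre E x" "d \<in> trivs E" "x \<in> fst d" "snd d x u' = snd d x v + snd d x w"
    by (auto simp: trivs_at_def)
  have "snd c x u' = snd c x v + snd c x w"
    using tr[OF hol_vbundle_triv[OF E d(2)] d(3) c d(1,4)] .
  then have "snd c x u' = snd c x u" using u by simp
  then show "u' = u" using inj_onD[OF hol_trivD(4)[OF c]] d(1) u(1) by blast
qed

lemma fibre_add:
  assumes E: "hol_vbundle A E" and vw: "v \<in> fibre E x" "w \<in> fibre E x"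
  shows "fibre_add E x v w \<in> fibre E x"
    and "hol_triv A E c \<Longrightarrow> x \<in> fst c \<Longrightarrow> snd c x (fibre_add E x v w) = snd c x v + snd c x w"
proof -
  have *: "fibre_add E x v w \<in> fibre E x \<and> snd c x (fibre_add E x v w) = snd c x v + snd c x w"
    if c: "hol_triv A E c" "x \<in> fst c" for c
  proof -
    have "snd c x v + snd c x w \<in> carrier_vec (vb_rank E)"
      by (intro add_carrier_vec hol_trivD(5)[OF c] vw)
    then obtain u where "u \<in> fibre E x" "snd c x u = snd c x v + snd c x w"
      by (rule triv_coords_ex[OF c])
    with fibre_add_unique[OF E vw c this] show ?thesis by simp
  qed
  show "fibre_add E x v w \<in> fibre E x"
    using * hol_vbundle_ex[OF E, of x] hol_vbundle_triv[OF E] by blast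
  show "hol_triv A E c \<Longrightarrow> x \<in> fst c \<Longrightarrow> snd c x (fibre_add E x v w) = snd c x v + snd c x w"
    using * by blast
qed

lemma zero_sub_iff:
  assumes E: "hol_vbundle A E" and c: "hol_triv A E c" "x \<in> fst c"
  shows "v \<in> zero_sub E x \<longleftrightarrow> v \<in> fibre E x \<and> snd c x v = 0\<^sub>v (vb_rank E)"
proof -
  have tr: "snd d x v = 0\<^sub>v (vb_rank E)"
    if b: "hol_triv A E b" "x \<in> fst b" and d: "hol_triv A E d" "x \<in> fst d"
      and v: "v \<in> fibre E x" "snd b x v = 0\<^sub>v (vb_rank E)" for b d
  proof -
    obtain g where g: "g \<in> carrier_mat (vb_rank E) (vb_rank E)" "\<And>v. v \<in> fibre E x \<Longrightarrow> snd d x v = g *\<^sub>v snd b x v"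
      using transition_mat[OF E b d] by blast
    show ?thesis using g(2)[OF v(1)] v(2) g(1) by (auto intro!: eq_vecI)
  qed
  obtain b where b: "b \<in> trivs E" "x \<in> fst b" using hol_vbundle_ex[OF E] by blast
  show ?thesis
  proof
    assume "v \<in> zero_sub E x"
    then obtain d where "v \<in> fibre E x" "d \<in> trivs E" "x \<in> fst d" "snd d x v = 0\<^sub>v (vb_rank E)"
      by (auto simp: zero_sub_def trivs_at_def)
    then show "v \<in> fibre E x \<and> snd c x v = 0\<^sub>v (vb_rank E)"
      using tr[OF hol_vbundle_triv[OF E] _ c] by blast
  next
    assume "v \<in> fibre E x \<and> snd c x v = 0\<^sub>v (vb_rank E)"
    then show "v \<in> zero_sub E x"
      using tr[OF c hol_vbundle_triv[OF E b(1)] b(2)] b unfolding zero_sub_def trivs_at_def by blast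
  qed
qed

lemma adapted_trivD:
  assumes "adapted_triv A E m S c" shows "hol_triv A E c"
    "x \<in> fst c \<Longrightarrow> snd c x ` S x = {v \<in> carrier_vec (vb_rank E). \<forall>i. m \<le> i \<and> i < vb_rank E \<longrightarrow> v $ i = 0}"
  using assms by (auto simp: adapted_triv_def)

lemma adapted_mem_iff:
  assumes c: "adapted_triv A E m S c" "x \<in> fst c" and S: "S x \<subseteq> fibre E x" and v: "v \<in> fibre E x"
  shows "v \<in> S x \<longleftrightarrow> (\<forall>i. m \<le> i \<and> i < vb_rank E \<longrightarrow> snd c x v $ i = 0)"
proof
  assume "v \<in> S x"
  then show "\<forall>i. m \<le> i \<and> i < vb_rank E \<longrightarrow> snd c x v $ i = 0"
    using adapted_trivD(2)[OF c] by blast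
next
  assume "\<forall>i. m \<le> i \<and> i < vb_rank E \<longrightarrow> snd c x v $ i = 0"
  then have "snd c x v \<in> snd c x ` S x"
    using adapted_trivD(2)[OF c] hol_trivD(5)[OF adapted_trivD(1)[OF c(1)] c(2) v] by simp
  then show "v \<in> S x"
    using inj_on_image_mem_iff[OF hol_trivD(4)[OF adapted_trivD(1)[OF c(1)] c(2)] v S] by blast
qed

lemma subbundleD:
  assumes "subbundle_of_rank A E m S"
  shows "m \<le> vb_rank E" "S x \<subseteq> fibre E x" "\<exists>c. x \<in> fst c \<and> adapted_triv A E m S c"
  using assms by (auto simp: subbundle_of_rank_def)

lemma adapted_coords:
  assumes c: "adapted_triv A E m S c" "x \<in> fst c" and S: "subbundle_of_rank A E m S"
  shows "v \<in> S x \<Longrightarrow> snd c x v = pad (vb_rank E) (vec_first (snd c x v) m)"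
    and "y \<in> carrier_vec m \<Longrightarrow> \<exists>v\<in>S x. snd c x v = pad (vb_rank E) y"
proof -
  show "snd c x v = pad (vb_rank E) (vec_first (snd c x v) m)" if "v \<in> S x"
    using pad_vec_first[of "snd c x v" "vb_rank E" m] adapted_trivD(2)[OF c] that by fastforce
  assume y: "y \<in> carrier_vec m"
  have "pad (vb_rank E) y \<in> snd c x ` S x"
    using y subbundleD(1)[OF S] unfolding adapted_trivD(2)[OF c] by (auto simp: pad_def)
  then show "\<exists>v\<in>S x. snd c x v = pad (vb_rank E) y" by force
qed

text \<open>Over a point, the identity of \<open>S\<close>, read from one kind of adapted
  coordinates to the other, is an injective matrix with \<open>m'\<close> columns and
  \<open>m\<close> rows. With the roles exchanged this gives uniqueness of the rank.\<close>

lemma sub_rank_le: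
  assumes E: "hol_vbundle A E" and S: "subbundle_of_rank A E m S" and S': "subbundle_of_rank A E m' S"
  shows "m' \<le> m"
proof -
  fix x :: 'x
  let ?r = "vb_rank E"
  obtain c where c: "x \<in> fst c" "adapted_triv A E m S c" using subbundleD(3)[OF S] by blast
  obtain d where d: "x \<in> fst d" "adapted_triv A E m' S d" using subbundleD(3)[OF S'] by blast
  note ct = adapted_trivD(1)[OF c(2)] and dt = adapted_trivD(1)[OF d(2)]
  obtain g where g: "g \<in> carrier_mat ?r ?r" "\<And>v. v \<in> fibre E x \<Longrightarrow> snd c x v = g *\<^sub>v snd d x v"
    using transition_mat[OF E dt d(1) ct c(1)] by blast
  \<comment> \<open>Pad with zeros, change the trivialization, truncate. Truncation loses nothing,
    as the dropped coordinates vanish on \<open>S\<close>.\<close>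
  define K where "K = sel_mat m ?r id * (g * sel_mat ?r m' id)"
  show ?thesis
  proof (rule injective_mat_tall[of K])
    show "K \<in> carrier_mat m m'" using g(1) unfolding K_def by (meson mult_carrier_mat sel_mat_carrier)
    fix y :: "complex vec" assume y: "y \<in> carrier_vec m'" "K *\<^sub>v y = 0\<^sub>v m"
    obtain v where v: "v \<in> S x" "snd d x v = pad ?r y" using adapted_coords(2)[OF d(2,1) S' y(1)] by blast
    have vf: "v \<in> fibre E x" using v subbundleD(2)[OF S] by blast
    have "K *\<^sub>v y = sel_mat m ?r id *\<^sub>v (g *\<^sub>v (sel_mat ?r m' id *\<^sub>v y))"
      unfolding K_def using g(1) y(1)
      by (metis assoc_mult_mat_vec mult_carrier_mat mult_mat_vec_carrier sel_mat_carrier)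
    also have "\<dots> = vec_first (snd c x v) m"
      using pad_sel[OF y(1), of ?r] v(2) g(2)[OF vf] vec_first_sel[OF subbundleD(1)[OF S] hol_trivD(5)[OF ct c(1) vf]] by simp
    finally have "vec_first (snd c x v) m = 0\<^sub>v m" using y by simp
    then have "snd c x v = 0\<^sub>v ?r" using adapted_coords(1)[OF c(2,1) S v(1)] by (auto simp: pad_def)
    then have "snd d x v = 0\<^sub>v ?r" using zero_sub_iff[OF E ct c(1)] zero_sub_iff[OF E dt d(1)] vf by blast
    then have "pad ?r y = 0\<^sub>v ?r" using v(2) by simp
    then have "vec_first (0\<^sub>v ?r) m' = y" using vec_first_pad[OF y(1) subbundleD(1)[OF S']] by simp
    then show "y = 0\<^sub>v m'" using subbundleD(1)[OF S'] by (auto simp: vec_first_def)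
  qed
qed

lemma sub_rank_eq: "hol_vbundle A E \<Longrightarrow> subbundle_of_rank A E m S \<Longrightarrow> sub_rank A E S = m"
  unfolding sub_rank_def by (rule the_equality) (auto intro: antisym sub_rank_le)

lemma sub_rank: "hol_vbundle A E \<Longrightarrow> subbundle A E S \<Longrightarrow> subbundle_of_rank A E (sub_rank A E S) S"
  using sub_rank_eq by (auto simp: subbundle_def)

lemma sub_bundle_simps:
  assumes "hol_vbundle A E" "subbundle_of_rank A E m S"
  shows "vb_rank (sub_bundle A E S) = m" "fibre (sub_bundle A E S) = S"
    "trivs (sub_bundle A E S) = {(fst c, \<lambda>x v. vec_first (snd c x v) m) | c. adapted_triv A E m S c}"
  using sub_rank_eq[OF assms] by (simp_all add: sub_bundle_def)

lemma hol_lin_vec_first: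
  assumes "\<And>x v. x \<in> U \<Longrightarrow> v \<in> V x \<Longrightarrow> q x v \<in> carrier_vec n" "m \<le> n"
  shows "hol_lin V n m q (\<lambda>x v. vec_first (q x v) m) U"
  by (rule hol_linI[OF hmat_const[OF sel_mat_carrier]]) (use assms vec_first_sel in auto)

lemma hol_lin_vec_last:
  assumes "\<And>x v. x \<in> U \<Longrightarrow> v \<in> V x \<Longrightarrow> q x v \<in> carrier_vec n" "m \<le> n"
  shows "hol_lin V n m q (\<lambda>x v. vec_last (q x v) m) U"
  by (rule hol_linI[OF hmat_const[OF sel_mat_carrier]]) (use assms vec_last_sel in auto)

lemma hol_lin_pad:
  assumes "\<And>x v. x \<in> U \<Longrightarrow> v \<in> V x \<Longrightarrow> q x v \<in> carrier_vec m"
  shows "hol_lin V m n q (\<lambda>x v. pad n (q x v)) U"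
  by (rule hol_linI[OF hmat_const[OF sel_mat_carrier[of n m id]]]) (use assms pad_sel in auto)

lemma bij_adapted:
  assumes c: "adapted_triv A E m S c" "x \<in> fst c" and S: "subbundle_of_rank A E m S"
  shows "bij_betw (\<lambda>v. vec_first (snd c x v) m) (S x) (carrier_vec m)"
proof (rule bij_betw_imageI)
  show "inj_on (\<lambda>v. vec_first (snd c x v) m) (S x)"
  proof (rule inj_onI)
    fix v w assume vw: "v \<in> S x" "w \<in> S x" "vec_first (snd c x v) m = vec_first (snd c x w) m"
    then have "snd c x v = snd c x w"
      using adapted_coords(1)[OF c S vw(1)] adapted_coords(1)[OF c S vw(2)] by simp
    then show "v = w"
      using inj_onD[OF hol_trivD(4)[OF adapted_trivD(1)[OF c(1)] c(2)]] vw(1,2) subbundleD(2)[OF S, of x] by blast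
  qed
  show "(\<lambda>v. vec_first (snd c x v) m) ` S x = carrier_vec m"
  proof (intro equalityI subsetI)
    fix y :: "complex vec" assume y: "y \<in> carrier_vec m"
    then obtain v where v: "v \<in> S x" "snd c x v = pad (vb_rank E) y" using adapted_coords(2)[OF c S] by blast
    show "y \<in> (\<lambda>v. vec_first (snd c x v) m) ` S x"
      by (rule image_eqI[OF _ v(1)]) (simp add: v(2) vec_first_pad[OF y subbundleD(1)[OF S]])
  qed auto
qed

text \<open>Between adapted trivializations the transition functions of the subbundle are the upper
  left blocks of the ambient ones.\<close>

lemma hol_vbundle_sub_bundle:
  assumes E: "hol_vbundle A E" and S: "subbundle_of_rank A E m S"
  shows "hol_vbundle A (sub_bundle A E S)"
proof -
  note simps = sub_bundle_simps[OF E S]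
  let ?r = "vb_rank E"
  have "hol_triv A (sub_bundle A E S) d" if "d \<in> trivs (sub_bundle A E S)" for d
  proof -
    from that obtain c where c: "adapted_triv A E m S c" and d: "d = (fst c, \<lambda>x v. vec_first (snd c x v) m)"
      by (auto simp: simps)
    note ct = adapted_trivD(1)[OF c]
    show ?thesis
    proof (rule hol_trivI)
      show "open (fst d)" using hol_trivD(1)[OF ct] d by simp
      show "bij_betw (snd d x) (fibre (sub_bundle A E S) x) (carrier_vec (vb_rank (sub_bundle A E S)))" if "x \<in> fst d" for x
        using bij_adapted[OF c _ S] that by (simp add: simps d)
      fix b assume "b \<in> trivs (sub_bundle A E S)"
      then obtain e where e: "adapted_triv A E m S e" and b: "b = (fst e, \<lambda>x v. vec_first (snd e x v) m)"
        by (auto simp: simps)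
      note et = adapted_trivD(1)[OF e]
      have 1: "hol_lin S m ?r (\<lambda>x v. vec_first (snd e x v) m) (snd e) (fst e \<inter> fst c)"
        by (rule hol_lin_cong[OF hol_lin_pad[of _ S "\<lambda>x v. vec_first (snd e x v) m"]])
           (use adapted_coords(1)[OF e _ S] in auto)
      have 2: "hol_lin S ?r ?r (snd e) (snd c) (fst e \<inter> fst c)"
        by (rule hol_lin_sub_fibre[OF hol_triv_transition[OF E et ct] subbundleD(2)[OF S]])
      have 3: "hol_lin S ?r m (snd c) (\<lambda>x v. vec_first (snd c x v) m) (fst e \<inter> fst c)"
        by (rule hol_lin_vec_first) (use hol_trivD(5)[OF ct] subbundleD[OF S] in blast)+
      have 4: "hol_lin S m ?r (\<lambda>x v. vec_first (snd e x v) m) (snd c) (fst e \<inter> fst c)"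
        by (rule hol_lin_trans[OF 1 2]) simp
      show "hol_lin (fibre (sub_bundle A E S)) (vb_rank (sub_bundle A E S)) (vb_rank (sub_bundle A E S)) (snd b) (snd d) (fst b \<inter> fst d)"
        unfolding simps b d fst_conv snd_conv by (rule hol_lin_trans[OF 4 3]) simp
    qed
  qed
  moreover have "\<exists>d\<in>trivs (sub_bundle A E S). x \<in> fst d" for x
  proof -
    obtain c where c: "x \<in> fst c" "adapted_triv A E m S c" using subbundleD(3)[OF S] by blast
    then have "(fst c, \<lambda>x v. vec_first (snd c x v) m) \<in> trivs (sub_bundle A E S)" unfolding simps by blast
    with c(1) show ?thesis by (metis fst_conv)
  qed
  ultimately show ?thesis by (auto simp: hol_vbundle_def)
qed

lemma sub_bundle_coords:
  assumes E: "hol_vbundle A E" and S: "subbundle_of_rank A E m S"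
    and e: "adapted_triv A E m S e" and d: "hol_triv A (sub_bundle A E S) d"
  shows "hol_lin S (vb_rank E) m (snd e) (snd d) (fst e \<inter> fst d)"
proof (rule hol_lin_trans)
  note simps = sub_bundle_simps[OF E S]
  show "hol_lin S (vb_rank E) m (snd e) (\<lambda>x v. vec_first (snd e x v) m) (fst e \<inter> fst d)"
    by (rule hol_lin_vec_first) (use hol_trivD(5)[OF adapted_trivD(1)[OF e]] subbundleD[OF S] in blast)+
  have "(fst e, \<lambda>x v. vec_first (snd e x v) m) \<in> trivs (sub_bundle A E S)" using e unfolding simps by blast
  from hol_trivD(6)[OF d this]
  show "hol_lin S m m (\<lambda>x v. vec_first (snd e x v) m) (snd d) (fst e \<inter> fst d)" by (simp add: simps)
  show "snd e x v \<in> carrier_vec (vb_rank E)" if "x \<in> fst e \<inter> fst d" "v \<in> S x" for x v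
    using hol_trivD(5)[OF adapted_trivD(1)[OF e]] subbundleD[OF S] that by blast
qed

text \<open>Cosets in the graded pieces are formed with the addition of the subbundle, internal sums
  with that of the ambient bundle; this identifies the two.\<close>

lemma subbundle_add:
  assumes E: "hol_vbundle A E" and S: "subbundle_of_rank A E m S" and v: "v \<in> S x" "w \<in> S x"
  shows "fibre_add E x v w \<in> S x" "fibre_add (sub_bundle A E S) x v w = fibre_add E x v w"
proof -
  obtain c where c: "x \<in> fst c" "adapted_triv A E m S c" using subbundleD(3)[OF S] by blast
  note ct = adapted_trivD(1)[OF c(2)]
  have f: "v \<in> fibre E x" "w \<in> fibre E x" using v subbundleD(2)[OF S] by blast+
  note fa = fibre_add(1)[OF E f] fibre_add(2)[OF E f ct c(1)]
  note mem = adapted_mem_iff[OF c(2,1) subbundleD(2)[OF S]]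
  show in_S: "fibre_add E x v w \<in> S x" unfolding mem[OF fa(1)]
  proof (intro allI impI)
    fix i assume i: "m \<le> i \<and> i < vb_rank E"
    then have "snd c x v $ i = 0" "snd c x w $ i = 0" using mem f v by blast+
    then show "snd c x (fibre_add E x v w) $ i = 0"
      using fa(2) i hol_trivD(5)[OF ct c(1) f(1)] hol_trivD(5)[OF ct c(1) f(2)] by simp
  qed
  note simps = sub_bundle_simps[OF E S] and B = hol_vbundle_sub_bundle[OF E S]
  have d: "(fst c, \<lambda>x v. vec_first (snd c x v) m) \<in> trivs (sub_bundle A E S)" using c unfolding simps by blast
  show "fibre_add (sub_bundle A E S) x v w = fibre_add E x v w"
  proof (rule fibre_add_unique[OF B _ _ hol_vbundle_triv[OF B d]])
    show "snd (fst c, \<lambda>x v. vec_first (snd c x v) m) x (fibre_add E x v w) =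
      snd (fst c, \<lambda>x v. vec_first (snd c x v) m) x v + snd (fst c, \<lambda>x v. vec_first (snd c x v) m) x w"
      using fa(2) hol_trivD(5)[OF ct c(1) f(1)] hol_trivD(5)[OF ct c(1) f(2)] subbundleD(1)[OF S]
      by (auto simp: vec_first_def)
  qed (use v in_S c in \<open>auto simp: simps\<close>)
qed

lemma zero_sub_subset:
  assumes E: "hol_vbundle A E" and S: "subbundle_of_rank A E m S"
  shows "zero_sub E x \<subseteq> S x" "zero_sub E x \<noteq> {}"
proof -
  obtain c where c: "x \<in> fst c" "adapted_triv A E m S c" using subbundleD(3)[OF S] by blast
  note ct = adapted_trivD(1)[OF c(2)]
  show "zero_sub E x \<subseteq> S x"
    using adapted_mem_iff[OF c(2,1) subbundleD(2)[OF S]] zero_sub_iff[OF E ct c(1)] by auto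
  obtain v where "v \<in> fibre E x" "snd c x v = 0\<^sub>v (vb_rank E)"
    using triv_coords_ex[OF ct c(1) zero_carrier_vec] by blast
  then show "zero_sub E x \<noteq> {}" using zero_sub_iff[OF E ct c(1)] by blast
qed

lemma zero_sub_subbundle: "hol_vbundle A E \<Longrightarrow> subbundle_of_rank A E 0 (zero_sub E)"
  unfolding subbundle_of_rank_def
proof (intro conjI allI)
  fix x assume E: "hol_vbundle A E"
  then obtain c where c: "c \<in> trivs E" "x \<in> fst c" using hol_vbundle_ex by blast
  note ct = hol_vbundle_triv[OF E c(1)]
  have "snd c y ` zero_sub E y = {v \<in> carrier_vec (vb_rank E). \<forall>i. 0 \<le> i \<and> i < vb_rank E \<longrightarrow> v $ i = 0}"
    if yf: "y \<in> fst c" for y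
  proof -
    obtain u where "u \<in> fibre E y" "snd c y u = 0\<^sub>v (vb_rank E)"
      using triv_coords_ex[OF ct yf zero_carrier_vec] by blast
    then have "u \<in> zero_sub E y" using zero_sub_iff[OF E ct yf] by blast
    then have "snd c y ` zero_sub E y = {0\<^sub>v (vb_rank E)}"
      using zero_sub_iff[OF E ct yf] by (auto simp: image_iff)
    also have "\<dots> = {v \<in> carrier_vec (vb_rank E). \<forall>i. 0 \<le> i \<and> i < vb_rank E \<longrightarrow> v $ i = 0}"
      by (auto intro!: eq_vecI)
    finally show ?thesis .
  qed
  then have "adapted_triv A E 0 (zero_sub E) c" unfolding adapted_triv_def using ct by blast
  with c show "\<exists>c. x \<in> fst c \<and> adapted_triv A E 0 (zero_sub E) c" by blast
qed (auto simp: zero_sub_def)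

lemma adapted_fibre: "hol_triv A E c \<Longrightarrow> adapted_triv A E (vb_rank E) (fibre E) c"
  unfolding adapted_triv_def using hol_trivD(3)[of E c] by auto

lemma fibre_subbundle: "hol_vbundle A E \<Longrightarrow> subbundle_of_rank A E (vb_rank E) (fibre E)"
  unfolding subbundle_of_rank_def
proof (intro conjI allI)
  fix x assume E: "hol_vbundle A E"
  obtain c where c: "c \<in> trivs E" "x \<in> fst c" using hol_vbundle_ex[OF E] by blast
  then show "\<exists>c. x \<in> fst c \<and> adapted_triv A E (vb_rank E) (fibre E) c"
    using adapted_fibre[OF hol_vbundle_triv[OF E c(1)]] by blast
qed auto

end

section \<open>Trivializations of a subbundle adapted to a smaller one\<close>

lemma bij_mult_mat_vec:
  assumes M: "(M :: complex mat) \<in> carrier_mat n n" and d: "det M \<noteq> 0"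
  shows "bij_betw (\<lambda>v. M *\<^sub>v v) (carrier_vec n) (carrier_vec n)"
proof (rule bij_betw_byWitness[of _ "\<lambda>v. mat_inv M *\<^sub>v v"])
  show "(*\<^sub>v) M ` carrier_vec n \<subseteq> carrier_vec n" using M mult_mat_vec_carrier by blast
  show "(*\<^sub>v) (mat_inv M) ` carrier_vec n \<subseteq> carrier_vec n" using mat_inv(1)[OF M d] mult_mat_vec_carrier by blast
qed (use mat_inv(4,5)[OF M d] in auto)

lemma vec_last_eq_0_iff:
  assumes "m \<le> r" "(v :: complex vec) \<in> carrier_vec r"
  shows "vec_last v (r - m) = 0\<^sub>v (r - m) \<longleftrightarrow> (\<forall>i. m \<le> i \<and> i < r \<longrightarrow> v $ i = 0)"
proof
  assume a: "vec_last v (r - m) = 0\<^sub>v (r - m)"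
  show "\<forall>i. m \<le> i \<and> i < r \<longrightarrow> v $ i = 0"
  proof (intro allI impI)
    fix i assume i: "m \<le> i \<and> i < r"
    then have "vec_last v (r - m) $ (i - m) = 0" unfolding a by (intro index_zero_vec) arith
    moreover have "i - m < r - m" "r - (r - m) + (i - m) = i" using i assms(1) by arith+
    ultimately show "v $ i = 0" using assms(2) by (simp add: vec_last_def)
  qed
qed (use assms in \<open>auto simp: vec_last_def\<close>)

lemma vec_last_add:
  "q \<le> r \<Longrightarrow> v \<in> carrier_vec r \<Longrightarrow> w \<in> carrier_vec r \<Longrightarrow> vec_last (v + w) q = vec_last v q + (vec_last w q :: complex vec)"
  by (auto simp: vec_last_def intro!: eq_vecI)

context compact_riemann_surface begin

text \<open>Ambient coordinates adapted to \<open>S\<close>, restricted to \<open>S'\<close>, form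
  an injective matrix with one row per coordinate. Its first \<open>s\<close> rows are independent
  because \<open>S\<close> lies in \<open>S'\<close>; they are completed by some of the other rows,
  whose coordinates vanish on \<open>S\<close>. The \<open>m\<close> selected coordinates trivialize
  \<open>S'\<close> near the point, and \<open>S\<close> is where the last \<open>m - s\<close> of
  them vanish.\<close>

lemma nested_subbundle:
  assumes E: "hol_vbundle A E" and S: "subbundle_of_rank A E s S" and S': "subbundle_of_rank A E m S'"
    and sub: "\<And>x. S x \<subseteq> S' x"
  shows "subbundle_of_rank A (sub_bundle A E S') s S"
proof -
  let ?r = "vb_rank E"
  note simps = sub_bundle_simps[OF E S'] and B = hol_vbundle_sub_bundle[OF E S']
  have main: "s \<le> m \<and> (\<exists>d. x0 \<in> fst d \<and> adapted_triv A (sub_bundle A E S') s S d)" for x0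
  proof -
    obtain c where c: "x0 \<in> fst c" "adapted_triv A E s S c" using subbundleD(3)[OF S] by blast
    obtain e where e: "x0 \<in> fst e" "adapted_triv A E m S' e" using subbundleD(3)[OF S'] by blast
    note ct = adapted_trivD(1)[OF c(2)] and et = adapted_trivD(1)[OF e(2)]
    define d' where "d' = (fst e, \<lambda>x v. vec_first (snd e x v) m)"
    have d': "d' \<in> trivs (sub_bundle A E S')" unfolding simps d'_def using e(2) by blast
    define U where "U = fst c \<inter> fst e"
    have U: "open U" "x0 \<in> U" using hol_trivD(1)[OF ct] hol_trivD(1)[OF et] c e by (auto simp: U_def)
    have bij: "bij_betw (snd d' x) (S' x) (carrier_vec m)" if "x \<in> U" for x
      using bij_adapted[OF e(2) _ S'] that by (simp add: d'_def U_def)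
    have 1: "hol_lin S' m ?r (snd d') (snd e) U"
      unfolding d'_def snd_conv
      by (rule hol_lin_cong[OF hol_lin_pad[of _ S' "\<lambda>x v. vec_first (snd e x v) m"]])
         (use adapted_coords(1)[OF e(2) _ S'] in \<open>auto simp: U_def\<close>)
    have 2: "hol_lin S' ?r ?r (snd e) (snd c) U"
      by (rule hol_lin_sub_fibre[OF hol_lin_subset[OF hol_triv_transition[OF E et ct]] subbundleD(2)[OF S']]) (auto simp: U_def)
    have "hol_lin S' m ?r (snd d') (snd c) U"
      by (rule hol_lin_trans[OF 1 2]) (simp add: d'_def)
    then obtain G where G: "hmat ?r m G U" "\<And>x v. x \<in> U \<Longrightarrow> v \<in> S' x \<Longrightarrow> snd c x v = G x *\<^sub>v snd d' x v"
      unfolding hol_lin_def by blast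
    have in_fib: "v \<in> S' x \<Longrightarrow> v \<in> fibre E x" for v x using subbundleD(2)[OF S'] by blast
    have inj: "w = 0\<^sub>v m" if w: "w \<in> carrier_vec m" "G x0 *\<^sub>v w = 0\<^sub>v ?r" for w
    proof -
      obtain v where v: "v \<in> S' x0" "w = snd d' x0 v" using bij[OF U(2)] w(1) by (metis bij_betw_imp_surj_on imageE)
      then have "snd c x0 v = 0\<^sub>v ?r" using G(2)[OF U(2)] w(2) by simp
      then have "snd e x0 v = 0\<^sub>v ?r" using zero_sub_iff[OF E ct c(1)] zero_sub_iff[OF E et e(1)] in_fib[OF v(1)] by blast
      then show ?thesis using subbundleD(1)[OF S'] by (auto simp: v(2) d'_def vec_first_def)
    qed
    have surj: "\<exists>w\<in>carrier_vec m. \<forall>i<s. (G x0 *\<^sub>v w) $ i = y $ i" if y: "y \<in> carrier_vec s" for y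
    proof -
      obtain v where v: "v \<in> S x0" "snd c x0 v = pad ?r y" using adapted_coords(2)[OF c(2,1) S y] by blast
      then have "v \<in> S' x0" using sub by blast
      moreover from this have "snd d' x0 v \<in> carrier_vec m" using bij[OF U(2)] by (metis bij_betwE)
      ultimately show ?thesis
        using G(2)[OF U(2)] v(2) y subbundleD(1)[OF S] by (intro bexI[of _ "snd d' x0 v"]) (auto simp: pad_def)
    qed
    obtain f where f: "s \<le> m" "\<And>i. i < s \<Longrightarrow> f i = i" "\<And>i. i < m \<Longrightarrow> f i < ?r" "\<And>i. s \<le> i \<Longrightarrow> i < m \<Longrightarrow> s \<le> f i"
      "det (mat m m (\<lambda>(i,j). G x0 $$ (f i, j))) \<noteq> 0"
      by (rule extend_independent_rows[OF hmatD(1)[OF G(1) U(2)] inj subbundleD(1)[OF S] surj]) (assumption | rule that)+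
    define Gf where "Gf x = mat m m (\<lambda>(i,j). G x $$ (f i, j))" for x
    have Gf: "hmat m m Gf U" unfolding Gf_def by (rule hmat_mat) (use f(3) hmatD(2)[OF G(1)] in blast)
    \<comment> \<open>The rows are selected at \<open>x0\<close> only; they stay independent on the
      open set where their minor does not vanish.\<close>
    define N where "N = U \<inter> (\<lambda>x. det (Gf x)) -` (- {0})"
    have N: "open N" "x0 \<in> N"
      using continuous_open_preimage[OF hfun_continuous[OF hfun_det[OF Gf] U(1)] U(1), of "- {0}"] U(2) f(5)
      by (auto simp: N_def Gf_def)
    \<comment> \<open>These are ambient coordinates picked by \<open>f\<close>; relative to the
      coordinates \<open>d'\<close> of \<open>S'\<close> they are given by the invertible minor
      \<open>Gf\<close>.\<close>
    define d where "d = (N, \<lambda>x v. vec m (\<lambda>i. snd c x v $ f i))"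
    have d_Gf: "snd d x v = Gf x *\<^sub>v snd d' x v" if x: "x \<in> N" and v: "v \<in> S' x" for x v
    proof (rule eq_vecI)
      have xU: "x \<in> U" using x by (simp add: N_def)
      note Gx = hmatD(1)[OF G(1) xU] and Gfx = hmatD(1)[OF Gf xU]
      show "dim_vec (snd d x v) = dim_vec (Gf x *\<^sub>v snd d' x v)" using Gfx by (simp add: d_def)
      fix i assume "i < dim_vec (Gf x *\<^sub>v snd d' x v)"
      then have i: "i < m" using Gfx by simp
      have "row (Gf x) i = row (G x) (f i)" using i f(3)[OF i] Gx by (intro eq_vecI) (auto simp: Gf_def)
      then show "snd d x v $ i = (Gf x *\<^sub>v snd d' x v) $ i"
        using i f(3)[OF i] Gx Gfx G(2)[OF xU v] by (simp add: d_def)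
    qed
    have "adapted_triv A (sub_bundle A E S') s S d" unfolding adapted_triv_def
    proof (intro conjI ballI)
      show "hol_triv A (sub_bundle A E S') d"
      proof (rule hol_trivI)
        show "open (fst d)" using N by (simp add: d_def)
        show "bij_betw (snd d x) (fibre (sub_bundle A E S') x) (carrier_vec (vb_rank (sub_bundle A E S')))" if "x \<in> fst d" for x
        proof -
          have x: "x \<in> N" "x \<in> U" "det (Gf x) \<noteq> 0" using that by (auto simp: d_def N_def)
          have "bij_betw ((\<lambda>v. Gf x *\<^sub>v v) \<circ> snd d' x) (S' x) (carrier_vec m)"
            by (rule bij_betw_trans[OF bij[OF x(2)] bij_mult_mat_vec[OF hmatD(1)[OF Gf x(2)] x(3)]])
          then have "bij_betw (snd d x) (S' x) (carrier_vec m)"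
            by (rule bij_betw_cong[THEN iffD1, rotated]) (simp add: d_Gf[OF x(1)])
          then show ?thesis by (simp add: simps)
        qed
        fix b assume b: "b \<in> trivs (sub_bundle A E S')"
        have 1: "hol_lin S' m m (snd b) (snd d') (fst b \<inter> N)"
          using hol_lin_subset[OF hol_triv_transition[OF B hol_vbundle_triv[OF B b] hol_vbundle_triv[OF B d']], of "fst b \<inter> N"]
          by (auto simp: simps d'_def N_def U_def)
        have 2: "hol_lin S' m m (snd d') (snd d) (fst b \<inter> N)"
          by (rule hol_linI[OF hmat_subset[OF Gf]]) (use d_Gf in \<open>auto simp: N_def\<close>)
        have "hol_lin S' m m (snd b) (snd d) (fst b \<inter> N)"
          by (rule hol_lin_trans[OF 1 2]) (use hol_trivD(5)[OF hol_vbundle_triv[OF B b]] in \<open>simp add: simps\<close>)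
        then show "hol_lin (fibre (sub_bundle A E S')) (vb_rank (sub_bundle A E S')) (vb_rank (sub_bundle A E S')) (snd b) (snd d) (fst b \<inter> fst d)"
          by (simp add: simps d_def)
      qed
      fix x assume "x \<in> fst d"
      then have xc: "x \<in> fst c" by (simp add: d_def N_def U_def)
      have "snd d x ` S x = {v \<in> carrier_vec m. \<forall>i. s \<le> i \<and> i < m \<longrightarrow> v $ i = 0}"
      proof (intro equalityI subsetI)
        fix w assume "w \<in> snd d x ` S x"
        then obtain v where v: "v \<in> S x" "w = snd d x v" by blast
        have "snd c x v $ j = 0" if "s \<le> j" "j < ?r" for j
          using adapted_mem_iff[OF c(2) xc subbundleD(2)[OF S]] v(1) subbundleD(2)[OF S] that by blast
        then show "w \<in> {v \<in> carrier_vec m. \<forall>i. s \<le> i \<and> i < m \<longrightarrow> v $ i = 0}"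
          using f(3,4) by (simp add: v(2) d_def)
      next
        fix w :: "complex vec" assume w: "w \<in> {v \<in> carrier_vec m. \<forall>i. s \<le> i \<and> i < m \<longrightarrow> v $ i = 0}"
        \<comment> \<open>The first \<open>s\<close> entries determine the point of
          \<open>S\<close>. A later entry picks an ambient coordinate of index at least
          \<open>s\<close>, which is 0 on \<open>S\<close>, in agreement with
          \<open>w\<close>.\<close>
        obtain v where v: "v \<in> S x" "snd c x v = pad ?r (vec_first w s)"
          using adapted_coords(2)[OF c(2) xc S vec_first_carrier] by blast
        have "snd d x v = w"
        proof (rule eq_vecI)
          fix i assume "i < dim_vec w"
          then have i: "i < m" using w by auto
          show "snd d x v $ i = w $ i"
          proof (cases "i < s")
            case True
            then show ?thesis using i f(2)[OF True] f(3)[OF i] by (simp add: d_def v(2) pad_def vec_first_def)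
          next
            case False
            then have "f i \<ge> s" using f(4) i by simp
            then show ?thesis using False i f(3)[OF i] w by (simp add: d_def v(2) pad_def vec_first_def)
          qed
        qed (use w in \<open>auto simp: d_def\<close>)
        with v(1) show "w \<in> snd d x ` S x" by blast
      qed
      then show "snd d x ` S x = {v \<in> carrier_vec (vb_rank (sub_bundle A E S')). \<forall>i. s \<le> i \<and> i < vb_rank (sub_bundle A E S') \<longrightarrow> v $ i = 0}"
        by (simp add: simps)
    qed
    with f(1) N(2) show ?thesis by (intro conjI exI[of _ d]) (auto simp: d_def)
  qed
  then show ?thesis unfolding subbundle_of_rank_def using sub by (simp add: simps)
qed

section \<open>The projection onto a summand\<close>

definition proj_on :: "('x, 'v) vbundle \<Rightarrow> ('x \<Rightarrow> 'v set) \<Rightarrow> ('x \<Rightarrow> 'v set) \<Rightarrow> 'x \<Rightarrow> 'v \<Rightarrow> 'v" where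
  "proj_on E S T x v = fst (THE p. p \<in> S x \<times> T x \<and> v = fibre_add E x (fst p) (snd p))"

lemma proj_on:
  assumes "internal_sum E S T" "v \<in> fibre E x"
  shows "proj_on E S T x v \<in> S x" "\<exists>t\<in>T x. v = fibre_add E x (proj_on E S T x v) t"
    and "s \<in> S x \<Longrightarrow> t \<in> T x \<Longrightarrow> v = fibre_add E x s t \<Longrightarrow> proj_on E S T x v = s"
proof -
  have ex: "\<exists>!p. p \<in> S x \<times> T x \<and> v = fibre_add E x (fst p) (snd p)"
    using assms by (simp add: internal_sum_def)
  from theI'[OF ex] show "proj_on E S T x v \<in> S x" "\<exists>t\<in>T x. v = fibre_add E x (proj_on E S T x v) t"
    unfolding proj_on_def by auto
  show "proj_on E S T x v = s" if "s \<in> S x" "t \<in> T x" "v = fibre_add E x s t"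
    unfolding proj_on_def using the1_equality[OF ex, of "(s,t)"] that by simp
qed

text \<open>A vector agrees with its projection modulo \<open>T\<close>. The coordinates detecting
  classes modulo \<open>T\<close> are, on \<open>S\<close>, an invertible matrix \<open>K\<close>
  applied to the coordinates of \<open>S\<close>. The projection is thus obtained from these
  coordinates by the inverse of \<open>K\<close>, which is holomorphic.\<close>

lemma hol_proj_on:
  assumes E: "hol_vbundle A E" and S: "subbundle_of_rank A E m S" and T: "subbundle_of_rank A E m' T"
    and sum: "internal_sum E S T" and b: "hol_triv A E b"
  shows "hol_lin (fibre E) (vb_rank E) (vb_rank E) (snd b) (\<lambda>x v. snd b x (proj_on E S T x v)) (fst b)"
proof (rule hol_lin_local[OF hol_trivD(1)[OF b] hol_trivD(3)[OF b]])
  let ?r = "vb_rank E" and ?q = "vb_rank E - m'" and ?\<pi> = "proj_on E S T"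
  fix x0 assume x0: "x0 \<in> fst b"
  obtain c where c: "x0 \<in> fst c" "adapted_triv A E m S c" using subbundleD(3)[OF S] by blast
  obtain e where e: "x0 \<in> fst e" "adapted_triv A E m' T e" using subbundleD(3)[OF T] by blast
  note ct = adapted_trivD(1)[OF c(2)] and et = adapted_trivD(1)[OF e(2)]
  define N where "N = fst b \<inter> (fst c \<inter> fst e)"
  have N: "x \<in> fst b" "x \<in> fst c" "x \<in> fst e" if "x \<in> N" for x using that by (auto simp: N_def)
  have Sf: "v \<in> S x \<Longrightarrow> v \<in> fibre E x" and Tf: "v \<in> T x \<Longrightarrow> v \<in> fibre E x" for v x
    using subbundleD(2)[OF S] subbundleD(2)[OF T] by blast+
  note cc = hol_trivD(5)[OF ct] and ec = hol_trivD(5)[OF et] and bc = hol_trivD(5)[OF b]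
  have 1: "hol_lin S m ?r (\<lambda>x v. vec_first (snd c x v) m) (snd c) N"
    by (rule hol_lin_cong[OF hol_lin_pad[of _ S "\<lambda>x v. vec_first (snd c x v) m"]])
       (use adapted_coords(1)[OF c(2) _ S] in \<open>auto simp: N_def\<close>)
  have 2: "hol_lin S ?r ?r (snd c) (snd e) N"
    by (rule hol_lin_sub_fibre[OF hol_lin_subset[OF hol_triv_transition[OF E ct et]] subbundleD(2)[OF S]]) (auto simp: N_def)
  have 3: "hol_lin S ?r ?q (snd e) (\<lambda>x v. vec_last (snd e x v) ?q) N"
    by (rule hol_lin_vec_last) (use ec Sf N in auto)
  have 4: "hol_lin S m ?q (\<lambda>x v. vec_first (snd c x v) m) (\<lambda>x v. vec_last (snd e x v) ?q) N"
    by (rule hol_lin_trans[OF hol_lin_trans[OF 1 2] 3]) auto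
  then obtain K where K: "hmat ?q m K N"
    "\<And>x v. x \<in> N \<Longrightarrow> v \<in> S x \<Longrightarrow> vec_last (snd e x v) ?q = K x *\<^sub>v vec_first (snd c x v) m"
    unfolding hol_lin_def by blast
  have T_iff: "v \<in> T x \<longleftrightarrow> vec_last (snd e x v) ?q = 0\<^sub>v ?q" if "x \<in> N" "v \<in> fibre E x" for x v
    using adapted_mem_iff[OF e(2) N(3)[OF that(1)] subbundleD(2)[OF T] that(2)]
      vec_last_eq_0_iff[OF subbundleD(1)[OF T] ec[OF N(3)[OF that(1)] that(2)]] by simp
  have last_add: "vec_last (snd e x (fibre_add E x v w)) ?q = vec_last (snd e x v) ?q + vec_last (snd e x w) ?q"
    if x: "x \<in> N" and v: "v \<in> fibre E x" and w: "w \<in> fibre E x" for x v w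
    using fibre_add(2)[OF E v w et N(3)[OF x]] ec[OF N(3)[OF x] v] ec[OF N(3)[OF x] w]
    by (auto simp: vec_last_def intro!: eq_vecI)
  have \<pi>: "?\<pi> x v \<in> S x" "?\<pi> x v \<in> fibre E x" "vec_last (snd e x v) ?q = vec_last (snd e x (?\<pi> x v)) ?q"
    if x: "x \<in> N" and v: "v \<in> fibre E x" for x v
  proof -
    show S1: "?\<pi> x v \<in> S x" using proj_on(1)[OF sum v] .
    then show f: "?\<pi> x v \<in> fibre E x" by (rule Sf)
    obtain t where t: "t \<in> T x" "v = fibre_add E x (?\<pi> x v) t" using proj_on(2)[OF sum v] by blast
    have "vec_last (snd e x v) ?q = vec_last (snd e x (?\<pi> x v)) ?q + vec_last (snd e x t) ?q"
      using last_add[OF x f Tf[OF t(1)]] unfolding t(2)[symmetric] .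
    also have "vec_last (snd e x t) ?q = 0\<^sub>v ?q" using T_iff[OF x Tf[OF t(1)]] t(1) by simp
    finally show "vec_last (snd e x v) ?q = vec_last (snd e x (?\<pi> x v)) ?q" by simp
  qed
  \<comment> \<open>Every class modulo \<open>T\<close> is the class of a projection, so
    \<open>K\<close> is onto; it is injective because \<open>S\<close> and \<open>T\<close> meet
    only in 0. In particular the ranks are complementary.\<close>
  have Kx: "m = ?q \<and> det (K x) \<noteq> 0" if x: "x \<in> N" for x
  proof -
    note Kc = hmatD(1)[OF K(1) x]
    have surj: "\<exists>w\<in>carrier_vec m. K x *\<^sub>v w = y" if y: "y \<in> carrier_vec ?q" for y
    proof -
      \<comment> \<open>A lift of the class \<open>y\<close>, with zeros in the coordinates along
        \<open>T\<close>.\<close>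
      define y' where "y' = vec ?r (\<lambda>i. if m' \<le> i then y $ (i - m') else 0)"
      have "y' \<in> carrier_vec ?r" by (simp add: y'_def)
      then obtain v where v: "v \<in> fibre E x" "snd e x v = y'" by (rule triv_coords_ex[OF et N(3)[OF x]])
      have "vec_last y' ?q = y" using y subbundleD(1)[OF T] by (auto simp: y'_def vec_last_def intro!: eq_vecI)
      then have "vec_last (snd e x v) ?q = y" unfolding v(2) .
      have "K x *\<^sub>v vec_first (snd c x (?\<pi> x v)) m = vec_last (snd e x (?\<pi> x v)) ?q"
        by (rule K(2)[OF x \<pi>(1)[OF x v(1)], symmetric])
      also have "\<dots> = vec_last (snd e x v) ?q" by (rule \<pi>(3)[OF x v(1), symmetric])
      also have "\<dots> = y" by fact
      finally have "K x *\<^sub>v vec_first (snd c x (?\<pi> x v)) m = y" .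
      then show ?thesis using vec_first_carrier by blast
    qed
    have inj: "w = 0\<^sub>v m" if w: "w \<in> carrier_vec m" "K x *\<^sub>v w = 0\<^sub>v ?q" for w
    proof -
      obtain v where v: "v \<in> S x" "snd c x v = pad ?r w" using adapted_coords(2)[OF c(2) N(2)[OF x] S w(1)] by blast
      have vw: "vec_first (snd c x v) m = w" using v(2) vec_first_pad[OF w(1) subbundleD(1)[OF S]] by simp
      then have "v \<in> T x" using T_iff[OF x Sf[OF v(1)]] K(2)[OF x v(1)] w(2) by simp
      obtain z where z: "z \<in> zero_sub E x" using zero_sub_subset(2)[OF E S] by blast
      have zST: "z \<in> S x" "z \<in> T x" using z zero_sub_subset(1)[OF E S] zero_sub_subset(1)[OF E T] by blast+
      have z0: "snd c x z = 0\<^sub>v ?r" using z zero_sub_iff[OF E ct N(2)[OF x]] by blast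
      \<comment> \<open>A vector \<open>v\<close> in both summands decomposes as
        \<open>v + 0\<close> and as \<open>0 + v\<close>; uniqueness makes it 0.\<close>
      have "fibre_add E x v z = v" "fibre_add E x z v = v"
        by (rule fibre_add_unique[OF E _ _ ct N(2)[OF x]]; use Sf v(1) zST z0 cc[OF N(2)[OF x]] in simp)+
      then have "v = z"
        using proj_on(3)[OF sum Sf[OF v(1)] v(1) zST(2)] proj_on(3)[OF sum Sf[OF v(1)] zST(1) \<open>v \<in> T x\<close>] by simp
      then show ?thesis using vw z0 subbundleD(1)[OF S] by (auto simp: vec_first_def)
    qed
    have "m \<le> ?q" by (rule injective_mat_tall[OF Kc inj])
    moreover have "?q \<le> m" by (rule surjective_mat_wide[OF Kc surj])
    ultimately have mq: "m = ?q" by simp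
    have "det (K x) \<noteq> 0" by (rule det_nonzero_if_injective[of _ m]) (use Kc mq inj in auto)
    with mq show ?thesis by blast
  qed
  have "x0 \<in> N" using x0 c e by (simp add: N_def)
  then have mq: "?q = m" using Kx by simp
  have 5: "hol_lin (fibre E) ?r ?r (snd b) (snd e) N"
    by (rule hol_lin_subset[OF hol_triv_transition[OF E b et]]) (auto simp: N_def)
  have 6: "hol_lin (fibre E) ?r m (snd e) (\<lambda>x v. vec_last (snd e x v) m) N"
    by (rule hol_lin_vec_last) (use ec N subbundleD(1)[OF S] in auto)
  have 7: "hol_lin (fibre E) m m (\<lambda>x v. vec_last (snd e x v) m) (\<lambda>x v. vec_first (snd c x (?\<pi> x v)) m) N"
  proof (rule hol_linI[OF hmat_inv])
    show "hmat m m K N" using K(1) mq by simp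
    show "det (K x) \<noteq> 0" if "x \<in> N" for x using Kx that by blast
    fix x v assume x: "x \<in> N" and v: "v \<in> fibre E x"
    have Km: "K x \<in> carrier_mat m m" using hmatD(1)[OF K(1) x] mq by simp
    have dK: "det (K x) \<noteq> 0" using Kx[OF x] ..
    have "vec_last (snd e x v) m = vec_last (snd e x (?\<pi> x v)) m" using \<pi>(3)[OF x v] unfolding mq .
    also have "\<dots> = K x *\<^sub>v vec_first (snd c x (?\<pi> x v)) m" using K(2)[OF x \<pi>(1)[OF x v]] unfolding mq .
    finally show "vec_first (snd c x (?\<pi> x v)) m = mat_inv (K x) *\<^sub>v vec_last (snd e x v) m"
      by (simp only: mat_inv(4)[OF Km dK vec_first_carrier])
  qed
  have 8: "hol_lin (fibre E) m ?r (\<lambda>x v. vec_first (snd c x (?\<pi> x v)) m) (\<lambda>x v. snd c x (?\<pi> x v)) N"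
    by (rule hol_lin_cong[OF hol_lin_pad[of _ "fibre E" "\<lambda>x v. vec_first (snd c x (?\<pi> x v)) m"]])
       (use adapted_coords(1)[OF c(2) _ S] \<pi> N in auto)
  have 9: "hol_lin (fibre E) ?r ?r (\<lambda>x v. snd c x (?\<pi> x v)) (\<lambda>x v. snd b x (?\<pi> x v)) N"
    by (rule hol_lin_pullback[OF hol_lin_subset[OF hol_triv_transition[OF E ct b]]]) (use \<pi>(2) in \<open>auto simp: N_def\<close>)
  have bcN: "snd b x v \<in> carrier_vec ?r" if "x \<in> N" "v \<in> fibre E x" for x v using bc N that by blast
  have "hol_lin (fibre E) ?r ?r (snd b) (\<lambda>x v. snd b x (?\<pi> x v)) N"
    by (rule hol_lin_trans[OF hol_lin_trans[OF hol_lin_trans[OF hol_lin_trans[OF 5 6 bcN] 7 bcN] 8 bcN] 9 bcN])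
  then show "\<exists>S'. open S' \<and> x0 \<in> S' \<and> hol_lin (fibre E) ?r ?r (snd b) (\<lambda>x v. snd b x (?\<pi> x v)) (fst b \<inter> S')"
    using hol_trivD(1)[OF ct] hol_trivD(1)[OF et] c(1) e(1) unfolding N_def by blast
qed

end

section \<open>Degrees of the zero subbundle and of the whole bundle\<close>

context compact_riemann_surface begin

text \<open>Dividing by the nowhere vanishing holomorphic section \<open>s0\<close> turns a
  meromorphic section into a meromorphic function with the same divisor, whose degree is 0. The
  condition \<open>cross\<close> says that this quotient is the same in all trivializations. The
  hypotheses are listed singly because this is the form in which they are verified for
  \<open>det_bundle\<close>.\<close>

lemma line_degree_eq_0:
  assumes cover: "\<And>x. \<exists>c\<in>trivs E. x \<in> fst c" and opn: "\<And>c. c \<in> trivs E \<Longrightarrow> open (fst c)"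
    and s0: "\<And>x. s0 x \<in> fibre E x"
    and hol: "\<And>c. c \<in> trivs E \<Longrightarrow> hfun (\<lambda>x. snd c x (s0 x) $ 0) (fst c)"
    and nz: "\<And>c x. c \<in> trivs E \<Longrightarrow> x \<in> fst c \<Longrightarrow> snd c x (s0 x) $ 0 \<noteq> 0"
    and cross: "\<And>c d x v. c \<in> trivs E \<Longrightarrow> d \<in> trivs E \<Longrightarrow> x \<in> fst c \<Longrightarrow> x \<in> fst d \<Longrightarrow> v \<in> fibre E x \<Longrightarrow>
       snd c x v $ 0 * snd d x (s0 x) $ 0 = snd d x v $ 0 * snd c x (s0 x) $ 0"
  shows "line_degree A E = 0"
proof -
  have im_open: "open (snd a ` (fst a \<inter> fst c))" if "a \<in> A" "c \<in> trivs E" for a c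
    using open_chart_image[of "fst a" "snd a" "fst c"] that opn by simp
  have ls_hol: "local_section a c s0 holomorphic_on snd a ` (fst a \<inter> fst c)" if "a \<in> A" "c \<in> trivs E" for a c
  proof -
    have "((\<lambda>x. snd c x (s0 x) $ 0) \<circ> the_inv_into (fst a) (snd a)) holomorphic_on snd a ` (fst c \<inter> fst a)"
      using hfunD[OF hol[OF that(2)], of "fst a" "snd a"] that(1) by simp
    moreover have "(\<lambda>x. snd c x (s0 x) $ 0) \<circ> the_inv_into (fst a) (snd a) = local_section a c s0"
      by (simp add: fun_eq_iff local_section_def Let_def)
    ultimately show ?thesis by (simp add: Int_commute)
  qed
  have ls_nz: "local_section a c s0 w \<noteq> 0" if "a \<in> A" "c \<in> trivs E" "w \<in> snd a ` (fst a \<inter> fst c)" for a c w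
  proof -
    from that(3) obtain x where "x \<in> fst a" "x \<in> fst c" "w = snd a x" by blast
    then show ?thesis
      using nz[OF that(2)] chartD(6)[of "fst a" "snd a" x] that(1) by (simp add: local_section_def Let_def)
  qed
  have ls_zo: "zorder (local_section a c s0) w = 0" if "a \<in> A" "c \<in> trivs E" "w \<in> snd a ` (fst a \<inter> fst c)" for a c w
    by (rule zorder_eq_0I) (use ls_hol[OF that(1,2)] im_open[OF that(1,2)] that(3) ls_nz[OF that] analytic_at in blast)+
  have deg0: "(\<Sum>x | section_order A E s x \<noteq> 0. section_order A E s x) = 0" if s: "nonzero_mero_section A E s" for s
  proof -
    from cover obtain d where d: "\<And>x. d x \<in> trivs E" "\<And>x. x \<in> fst (d x)" by metis
    \<comment> \<open>The quotient is formed in an arbitrarily chosen trivialization at each point;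
      \<open>f_eq\<close> then admits any other, which makes it meromorphic.\<close>
    define f where "f x = snd (d x) x (s x) $ 0 / snd (d x) x (s0 x) $ 0" for x
    have sf: "s x \<in> fibre E x" for x using s by (simp add: nonzero_mero_section_def)
    have f_eq: "f x = snd c x (s x) $ 0 / snd c x (s0 x) $ 0" if "c \<in> trivs E" "x \<in> fst c" for c x
      using cross[OF d(1) that(1) d(2) that(2) sf] nz[OF d] nz[OF that] by (simp add: f_def frac_eq_eq)
    have in_f: "in_chart a f w = local_section a c s w / local_section a c s0 w"
      if "a \<in> A" "c \<in> trivs E" "w \<in> snd a ` (fst a \<inter> fst c)" for a c w
    proof -
      from that(3) obtain x where "x \<in> fst a" "x \<in> fst c" "w = snd a x" by blast
      then show ?thesis
        using f_eq[OF that(2)] chartD(6)[of "fst a" "snd a" x] that(1) by (simp add: in_chart_def local_section_def Let_def)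
    qed
    have ev: "\<forall>\<^sub>F w in at (snd a x). in_chart a f w = local_section a c s w / local_section a c s0 w"
      if "a \<in> A" "c \<in> trivs E" "x \<in> fst a" "x \<in> fst c" for a c x
    proof -
      have "\<forall>\<^sub>F w in at (snd a x). w \<in> snd a ` (fst a \<inter> fst c)"
        using im_open[OF that(1,2)] that(3,4) by (intro eventually_at_in_open') auto
      then show ?thesis by eventually_elim (rule in_f[OF that(1,2)])
    qed
    have ls_mero: "local_section a c s meromorphic_on {snd a x}" "local_section a c s0 meromorphic_on {snd a x}"
      "\<exists>\<^sub>F w in at (snd a x). local_section a c s w \<noteq> 0" "\<exists>\<^sub>F w in at (snd a x). local_section a c s0 w \<noteq> 0"
      if a: "a \<in> A" and c: "c \<in> trivs E" and x: "x \<in> fst a" "x \<in> fst c" for a c x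
    proof -
      have xi: "snd a x \<in> snd a ` (fst a \<inter> fst c)" using x by blast
      show "local_section a c s meromorphic_on {snd a x}"
        by (rule meromorphic_on_subset[of _ "snd a ` (fst a \<inter> fst c)"]) (use s a c xi in \<open>auto simp: nonzero_mero_section_def\<close>)
      show "local_section a c s0 meromorphic_on {snd a x}"
        by (rule analytic_on_imp_meromorphic_on) (use ls_hol[OF a c] im_open[OF a c] xi analytic_at in blast)
      show "\<exists>\<^sub>F w in at (snd a x). local_section a c s w \<noteq> 0"
        using s a c x unfolding nonzero_mero_section_def by blast
      have "\<forall>\<^sub>F w in at (snd a x). w \<in> snd a ` (fst a \<inter> fst c)"
        using im_open[OF a c] xi by (intro eventually_at_in_open') auto
      then have "\<forall>\<^sub>F w in at (snd a x). local_section a c s0 w \<noteq> 0"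
        by eventually_elim (rule ls_nz[OF a c])
      then show "\<exists>\<^sub>F w in at (snd a x). local_section a c s0 w \<noteq> 0" by (simp add: eventually_frequently)
    qed
    have mero: "mero_fun f" unfolding mero_fun_def
    proof
      fix a assume a: "a \<in> A"
      show "in_chart a f meromorphic_on snd a ` fst a"
      proof (subst meromorphic_on_meromorphic_at, rule ballI)
        fix w assume "w \<in> snd a ` fst a"
        then obtain x where x: "x \<in> fst a" "w = snd a x" by blast
        obtain c where c: "c \<in> trivs E" "x \<in> fst c" using cover by blast
        have "(\<lambda>w. local_section a c s w / local_section a c s0 w) meromorphic_on {snd a x}"
          using ls_mero(1,2)[OF a c(1) x(1) c(2)] by (rule meromorphic_on_divide)
        then show "in_chart a f meromorphic_on {w}"
          using meromorphic_on_cong[of "{w}" "in_chart a f" "\<lambda>w. local_section a c s w / local_section a c s0 w" "{w}"]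
            ev[OF a c(1) x(1) c(2)] x(2) by simp
      qed
    qed
    have fnz: "\<exists>\<^sub>F y in at x. f y \<noteq> 0" for x
    proof -
      obtain c where c: "c \<in> trivs E" "x \<in> fst c" using cover by blast
      note a = chart_at[of x]
      have xi: "snd (chart_at x) x \<in> snd (chart_at x) ` (fst (chart_at x) \<inter> fst c)" using a c by blast
      have "\<forall>\<^sub>F w in at (snd (chart_at x) x). w \<in> snd (chart_at x) ` (fst (chart_at x) \<inter> fst c)"
        using im_open[OF a(1) c(1)] xi by (intro eventually_at_in_open') auto
      from frequently_eventually_frequently[OF ls_mero(3)[OF a(1) c(1) a(2) c(2)] this]
      have "\<exists>\<^sub>F w in at (snd (chart_at x) x). in_chart (chart_at x) f w \<noteq> 0"
        by (rule frequently_elim1) (use in_f[OF a(1) c(1)] ls_nz[OF a(1) c(1)] in auto)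
      then show ?thesis by (simp add: frequently_in_chart_at)
    qed
    have ord: "zorder (local_section a c s) (snd a x) = ord_at f x"
      if a: "a \<in> A" and c: "c \<in> trivs E" and x: "x \<in> fst a" "x \<in> fst c" for a c x
    proof -
      have "ord_at f x = zorder (in_chart a f) (snd a x)"
        using ord_at_chart[OF mero fnz a x(1)] by simp
      also have "\<dots> = zorder (\<lambda>w. local_section a c s w / local_section a c s0 w) (snd a x)"
        by (rule zorder_cong[OF ev[OF a c x] refl])
      also have "\<dots> = zorder (local_section a c s) (snd a x) - zorder (local_section a c s0) (snd a x)"
        using ls_mero[OF a c x] by (intro zorder_divide)
      also have "zorder (local_section a c s0) (snd a x) = 0"
        by (rule ls_zo[OF a c]) (use x in blast)
      finally show ?thesis by simp
    qed
    have "section_order A E s x = ord_at f x" for x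
    proof -
      obtain c where c: "c \<in> trivs E" "x \<in> fst c" using cover by blast
      show ?thesis unfolding section_order_def
      proof (rule the_equality)
        show "\<forall>a\<in>A. \<forall>c\<in>trivs E. x \<in> fst a \<inter> fst c \<longrightarrow> zorder (local_section a c s) (snd a x) = ord_at f x"
          using ord by blast
        fix n assume "\<forall>a\<in>A. \<forall>c\<in>trivs E. x \<in> fst a \<inter> fst c \<longrightarrow> zorder (local_section a c s) (snd a x) = n"
        then have "zorder (local_section (chart_at x) c s) (snd (chart_at x) x) = n"
          using chart_at[of x] c by blast
        then show "n = ord_at f x" using ord[OF chart_at(1) c(1) chart_at(2) c(2)] by simp
      qed
    qed
    then show ?thesis using principal_divisor_degree[OF mero fnz] by simp
  qed
  \<comment> \<open>The definite description also needs some nonzero meromorphic section to exist,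
    and \<open>s0\<close> is one.\<close>
  have s0n: "nonzero_mero_section A E s0" unfolding nonzero_mero_section_def
  proof (intro conjI allI ballI)
    fix a c assume a: "a \<in> A" and c: "c \<in> trivs E"
    show "local_section a c s0 meromorphic_on snd a ` (fst a \<inter> fst c)"
      by (rule analytic_on_imp_meromorphic_on) (use ls_hol[OF a c] im_open[OF a c] in \<open>simp add: analytic_on_open\<close>)
    fix x assume x: "x \<in> fst a \<inter> fst c"
    have "\<forall>\<^sub>F w in at (snd a x). w \<in> snd a ` (fst a \<inter> fst c)"
      using im_open[OF a c] x by (intro eventually_at_in_open') auto
    then have "\<forall>\<^sub>F w in at (snd a x). local_section a c s0 w \<noteq> 0"
      by eventually_elim (rule ls_nz[OF a c])
    then show "\<exists>\<^sub>F w in at (snd a x). local_section a c s0 w \<noteq> 0" by (simp add: eventually_frequently)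
  qed (rule s0)
  show ?thesis unfolding line_degree_def
  proof (rule the_equality)
    show "\<exists>s. nonzero_mero_section A E s \<and> 0 = (\<Sum>x | section_order A E s x \<noteq> 0. section_order A E s x)"
      using s0n deg0[OF s0n] by (intro exI[of _ s0]) simp
    fix d assume "\<exists>s. nonzero_mero_section A E s \<and> d = (\<Sum>x | section_order A E s x \<noteq> 0. section_order A E s x)"
    then show "d = 0" using deg0 by blast
  qed
qed

section \<open>Determinants of transition matrices and degrees\<close>

lemma transition_eq:
  assumes b: "hol_triv A E b" "x \<in> fst b"
    and g: "g \<in> carrier_mat (vb_rank E) (vb_rank E)" "\<And>v. v \<in> fibre E x \<Longrightarrow> snd c x v = g *\<^sub>v snd b x v"
  shows "transition E b c x = g"
  unfolding transition_def
proof (rule the_equality)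
  fix h assume h: "h \<in> carrier_mat (vb_rank E) (vb_rank E) \<and> (\<forall>v\<in>fibre E x. snd c x v = h *\<^sub>v snd b x v)"
  show "h = g"
  proof (rule mat_eq_if_mult_eq[of _ "vb_rank E" "vb_rank E"])
    fix y :: "complex vec" assume "y \<in> carrier_vec (vb_rank E)"
    then obtain v where "v \<in> fibre E x" "snd b x v = y" by (rule triv_coords_ex[OF b])
    with h g(2) show "h *\<^sub>v y = g *\<^sub>v y" by metis
  qed (use h g in auto)
qed (use g in auto)

lemma transition:
  assumes E: "hol_vbundle A E" and b: "hol_triv A E b" "x \<in> fst b" and c: "hol_triv A E c" "x \<in> fst c"
  shows "transition E b c x \<in> carrier_mat (vb_rank E) (vb_rank E)"
    "v \<in> fibre E x \<Longrightarrow> snd c x v = transition E b c x *\<^sub>v snd b x v"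
proof -
  obtain g where g: "g \<in> carrier_mat (vb_rank E) (vb_rank E)" "\<And>v. v \<in> fibre E x \<Longrightarrow> snd c x v = g *\<^sub>v snd b x v"
    using transition_mat[OF E b c] by blast
  then have "transition E b c x = g" by (intro transition_eq[OF b])
  with g show "transition E b c x \<in> carrier_mat (vb_rank E) (vb_rank E)"
    "v \<in> fibre E x \<Longrightarrow> snd c x v = transition E b c x *\<^sub>v snd b x v" by simp_all
qed

lemma transition_cocycle:
  assumes E: "hol_vbundle A E" and b: "hol_triv A E b" "x \<in> fst b" and c: "hol_triv A E c" "x \<in> fst c"
    and d: "hol_triv A E d" "x \<in> fst d"
  shows "det (transition E b d x) = det (transition E c d x) * det (transition E b c x)"
proof -
  note bc = transition[OF E b c] and cd = transition[OF E c d]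
  have "transition E b d x = transition E c d x * transition E b c x"
  proof (rule transition_eq[OF b])
    show "transition E c d x * transition E b c x \<in> carrier_mat (vb_rank E) (vb_rank E)"
      using bc(1) cd(1) by (rule mult_carrier_mat[rotated])
    show "snd d x v = transition E c d x * transition E b c x *\<^sub>v snd b x v" if "v \<in> fibre E x" for v
      using bc(2)[OF that] cd(2)[OF that] assoc_mult_mat_vec[OF cd(1) bc(1) hol_trivD(5)[OF b that]] by simp
  qed
  then show ?thesis using det_mult[OF cd(1) bc(1)] by simp
qed

lemma transition_refl: "hol_triv A E b \<Longrightarrow> x \<in> fst b \<Longrightarrow> transition E b b x = 1\<^sub>m (vb_rank E)"
  by (rule transition_eq) (use hol_trivD(5)[of E b x] in auto)

lemma det_transition_nonzero:
  assumes E: "hol_vbundle A E" and b: "hol_triv A E b" "x \<in> fst b" and c: "hol_triv A E c" "x \<in> fst c"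
  shows "det (transition E b c x) \<noteq> 0"
  using transition_cocycle[OF E b c b] transition_refl[OF b] by auto

lemma hfun_det_transition:
  assumes E: "hol_vbundle A E" and b: "hol_triv A E b" and c: "hol_triv A E c"
  shows "hfun (\<lambda>x. det (transition E b c x)) (fst b \<inter> fst c)"
proof -
  obtain M where M: "hmat (vb_rank E) (vb_rank E) M (fst b \<inter> fst c)"
    "\<And>x v. x \<in> fst b \<inter> fst c \<Longrightarrow> v \<in> fibre E x \<Longrightarrow> snd c x v = M x *\<^sub>v snd b x v"
    using hol_triv_transition[OF E b c] unfolding hol_lin_def by blast
  show ?thesis
    by (rule hfun_cong[OF hfun_det[OF M(1)]]) (use transition_eq[OF b _ hmatD(1)[OF M(1)]] M(2) in auto)
qed

lemma det_bundle_trivs: "trivs (det_bundle E) = {(fst c, \<lambda>x \<delta>. vec 1 (\<lambda>_. \<delta> c)) | c. c \<in> trivs E}"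
  by (simp only: det_bundle_def vbundle.simps)

lemma det_bundle_fibre_iff: "\<delta> \<in> fibre (det_bundle E) x \<longleftrightarrow> \<delta> \<in> extensional (trivs_at E x) \<and>
    (\<forall>b\<in>trivs_at E x. \<forall>c\<in>trivs_at E x. \<delta> c = det (transition E b c x) * \<delta> b)"
  by (simp only: det_bundle_def vbundle.simps mem_Collect_eq)

lemma vb_degree_eq_0:
  assumes E: "hol_vbundle A E"
    and \<sigma>: "\<And>x. \<sigma> x \<in> fibre (det_bundle E) x"
    and hol: "\<And>c. c \<in> trivs E \<Longrightarrow> hfun (\<lambda>x. \<sigma> x c) (fst c)"
    and nz: "\<And>c x. c \<in> trivs E \<Longrightarrow> x \<in> fst c \<Longrightarrow> \<sigma> x c \<noteq> 0"
  shows "vb_degree A E = 0"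
  unfolding vb_degree_def
proof (rule line_degree_eq_0[where ?s0.0=\<sigma>])
  have tr: "\<exists>c\<in>trivs E. d = (fst c, \<lambda>x \<delta>. vec 1 (\<lambda>_. \<delta> c))" if "d \<in> trivs (det_bundle E)" for d
    using that unfolding det_bundle_trivs by blast
  show "\<exists>c\<in>trivs (det_bundle E). x \<in> fst c" for x
  proof -
    obtain c where "c \<in> trivs E" "x \<in> fst c" using hol_vbundle_ex[OF E] by blast
    then have "(fst c, \<lambda>x \<delta>. vec 1 (\<lambda>_. \<delta> c)) \<in> trivs (det_bundle E)" unfolding det_bundle_trivs by blast
    then show ?thesis using \<open>x \<in> fst c\<close> by force
  qed
  show "open (fst d)" if "d \<in> trivs (det_bundle E)" for d
    using tr[OF that] hol_trivD(1)[OF hol_vbundle_triv[OF E]] by auto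
  show "\<sigma> x \<in> fibre (det_bundle E) x" for x by (rule \<sigma>)
  show "hfun (\<lambda>x. snd d x (\<sigma> x) $ 0) (fst d)" if "d \<in> trivs (det_bundle E)" for d
    using tr[OF that] hol by auto
  show "snd d x (\<sigma> x) $ 0 \<noteq> 0" if "d \<in> trivs (det_bundle E)" "x \<in> fst d" for d x
    using tr[OF that(1)] nz that(2) by auto
  fix d d' x v assume dd: "d \<in> trivs (det_bundle E)" "d' \<in> trivs (det_bundle E)" "x \<in> fst d" "x \<in> fst d'"
    and v: "v \<in> fibre (det_bundle E) x"
  obtain c where c: "c \<in> trivs E" "d = (fst c, \<lambda>x \<delta>. vec 1 (\<lambda>_. \<delta> c))" using tr[OF dd(1)] by blast
  obtain c' where c': "c' \<in> trivs E" "d' = (fst c', \<lambda>x \<delta>. vec 1 (\<lambda>_. \<delta> c'))" using tr[OF dd(2)] by blast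
  have cc: "c \<in> trivs_at E x" "c' \<in> trivs_at E x" using c c' dd by (auto simp: trivs_at_def)
  have eq: "\<And>\<delta>. \<delta> \<in> fibre (det_bundle E) x \<Longrightarrow> \<delta> c' = det (transition E c c' x) * \<delta> c"
    using cc unfolding det_bundle_fibre_iff by blast
  show "snd d x v $ 0 * snd d' x (\<sigma> x) $ 0 = snd d' x v $ 0 * snd d x (\<sigma> x) $ 0"
    using eq[OF v] eq[OF \<sigma>[of x]] by (simp add: c(2) c'(2))
qed

text \<open>In rank 0 the transition matrices are 0 x 0 and have determinant 1, so the constant
  family 1 is a nowhere vanishing section of the determinant.\<close>

lemma sub_degree_zero_sub:
  assumes E: "hol_vbundle A E" shows "sub_degree A E (zero_sub E) = 0"
  unfolding sub_degree_def
proof (rule vb_degree_eq_0[where \<sigma>="\<lambda>x. restrict (\<lambda>_. 1) (trivs_at (sub_bundle A E (zero_sub E)) x)"])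
  let ?B = "sub_bundle A E (zero_sub E)"
  note Z = zero_sub_subbundle[OF E]
  show B: "hol_vbundle A ?B" by (rule hol_vbundle_sub_bundle[OF E Z])
  note simps = sub_bundle_simps[OF E Z]
  have "det (transition ?B b c x) = 1" if "b \<in> trivs_at ?B x" "c \<in> trivs_at ?B x" for b c x
    using transition(1)[OF B hol_vbundle_triv[OF B, of b] _ hol_vbundle_triv[OF B, of c]] that simps(1)
    by (simp add: trivs_at_def)
  then show "restrict (\<lambda>_. 1) (trivs_at ?B x) \<in> fibre (det_bundle ?B) x" for x
    unfolding det_bundle_fibre_iff by simp
  show "hfun (\<lambda>x. restrict (\<lambda>_. 1) (trivs_at ?B x) c) (fst c)" if "c \<in> trivs ?B" for c
    by (rule hfun_cong[OF hfun_const[of 1]]) (use that in \<open>simp add: trivs_at_def\<close>)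
  show "restrict (\<lambda>_. 1) (trivs_at ?B x) c \<noteq> (0::complex)" if "c \<in> trivs ?B" "x \<in> fst c" for c x
    using that by (simp add: trivs_at_def)
qed

text \<open>The trivialization \<open>\<tau>\<close> concerns the determinant formed with the atlas
  of \<open>E\<close>, whereas the atlas of \<open>sub_bundle A E (fibre E)\<close> comes from all
  holomorphic trivializations of \<open>E\<close>. The section corresponding to 1 therefore has to
  be extended to the larger atlas by determinants of transition matrices.\<close>

lemma sub_degree_fibre:
  assumes E: "hol_vbundle A E" and \<tau>: "vb_iso A (det_bundle E) trivial_line_bundle \<tau>"
  shows "sub_degree A E (fibre E) = 0"
proof -
  let ?B = "sub_bundle A E (fibre E)" and ?r = "vb_rank E"
  note F = fibre_subbundle[OF E]
  have B: "hol_vbundle A ?B" by (rule hol_vbundle_sub_bundle[OF E F])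
  note simps = sub_bundle_simps[OF E F]
  have tr: "transition ?B = transition E" by (simp add: fun_eq_iff transition_def simps)
  have Bt: "hol_triv A E c" if c: "c \<in> trivs ?B" for c
  proof -
    obtain e where e: "adapted_triv A E ?r (fibre E) e" and ce: "c = (fst e, \<lambda>x v. vec_first (snd e x v) ?r)"
      using c unfolding simps by blast
    note et = adapted_trivD(1)[OF e]
    have eq: "snd c x v = snd e x v" if "x \<in> fst c" "v \<in> fibre E x" for x v
      using hol_trivD(5)[OF et _ that(2)] that(1) by (auto simp: ce vec_first_def intro!: eq_vecI)
    show ?thesis
    proof (rule hol_trivI)
      show "open (fst c)" using hol_trivD(1)[OF et] by (simp add: ce)
      show "bij_betw (snd c x) (fibre E x) (carrier_vec ?r)" if "x \<in> fst c" for x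
        using bij_betw_cong[of "fibre E x" "snd c x" "snd e x", OF eq[OF that]] hol_trivD(2)[OF et, of x] that
        by (simp add: ce)
      fix b assume "b \<in> trivs E"
      from hol_trivD(6)[OF et this] have "hol_lin (fibre E) ?r ?r (snd b) (snd e) (fst b \<inter> fst c)" by (simp add: ce)
      then show "hol_lin (fibre E) ?r ?r (snd b) (snd c) (fst b \<inter> fst c)"
        by (rule hol_lin_cong) (simp_all add: eq)
    qed
  qed
  have hom: "vb_hom A (det_bundle E) trivial_line_bundle \<tau>"
    and bij: "bij_betw (\<tau> x) (fibre (det_bundle E) x) (fibre trivial_line_bundle x)" for x
    using \<tau> unfolding vb_iso_def by blast+
  have "\<exists>\<delta>\<in>fibre (det_bundle E) x. \<tau> x \<delta> = 1" for x
  proof -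
    have "1 \<in> \<tau> x ` fibre (det_bundle E) x"
      unfolding bij_betw_imp_surj_on[OF bij] by (simp add: trivial_line_bundle_def)
    then show ?thesis by force
  qed
  then obtain \<delta> where \<delta>: "\<And>x. \<delta> x \<in> fibre (det_bundle E) x" "\<And>x. \<tau> x (\<delta> x) = 1" by metis
  have \<delta>_hol: "hfun (\<lambda>x. \<delta> x b) (fst b)" and \<delta>_nz: "\<And>x. x \<in> fst b \<Longrightarrow> \<delta> x b \<noteq> 0" if b: "b \<in> trivs E" for b
  proof -
    have bt: "(fst b, \<lambda>x \<delta>. vec 1 (\<lambda>_. \<delta> b)) \<in> trivs (det_bundle E)" using b unfolding det_bundle_trivs by blast
    have ut: "(UNIV, \<lambda>_ a. vec 1 (\<lambda>_. a)) \<in> trivs (trivial_line_bundle :: ('x, complex) vbundle)"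
      by (simp add: trivial_line_bundle_def)
    have ranks: "vb_rank (det_bundle E) = 1" "vb_rank (trivial_line_bundle :: ('x, complex) vbundle) = 1"
      by (simp_all add: det_bundle_def trivial_line_bundle_def)
    from bspec[OF bspec[OF conjunct2[OF hom[unfolded vb_hom_def]] bt] ut]
    obtain M where M: "hmat 1 1 M (fst b)"
      "\<And>x v. x \<in> fst b \<Longrightarrow> v \<in> fibre (det_bundle E) x \<Longrightarrow> vec 1 (\<lambda>_. \<tau> x v) = M x *\<^sub>v vec 1 (\<lambda>_. v b)"
      unfolding ranks fst_conv snd_conv Int_UNIV_right by blast
    \<comment> \<open>The coordinate of the section is the reciprocal of the 1 x 1 matrix of
      \<open>\<tau>\<close>; this makes it both holomorphic and nonzero.\<close>
    have one: "M x $$ (0,0) * \<delta> x b = 1" if x: "x \<in> fst b" for x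
    proof -
      have "vec 1 (\<lambda>_. \<tau> x (\<delta> x)) $ 0 = (M x *\<^sub>v vec 1 (\<lambda>_. \<delta> x b)) $ 0" using M(2)[OF x \<delta>(1)] by simp
      then show ?thesis using hmatD(1)[OF M(1) x] \<delta>(2) by (simp add: scalar_prod_def)
    qed
    then show "\<And>x. x \<in> fst b \<Longrightarrow> \<delta> x b \<noteq> 0" by force
    have "hfun (\<lambda>x. inverse (M x $$ (0,0))) (fst b)"
      by (rule hfun_inverse[OF hmatD(2)[OF M(1)]]) (use one in force)+
    then show "hfun (\<lambda>x. \<delta> x b) (fst b)"
      by (rule hfun_cong) (metis one inverse_unique)
  qed
  from hol_vbundle_ex[OF E] obtain b where b: "\<And>x. b x \<in> trivs E" "\<And>x. x \<in> fst (b x)" by metis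
  note bt = hol_vbundle_triv[OF E b(1)]
  \<comment> \<open>At each point one atlas member is selected and its coordinate carried over to
    \<open>c\<close>. By \<open>\<sigma>_eq\<close> the selection does not matter, so near a given
    point a fixed member can be used to prove holomorphy.\<close>
  define \<sigma> where "\<sigma> x = restrict (\<lambda>c. det (transition E (b x) c x) * \<delta> x (b x)) (trivs_at ?B x)" for x
  have \<sigma>_eq: "\<sigma> x c = det (transition E b' c x) * \<delta> x b'"
    if c: "c \<in> trivs ?B" "x \<in> fst c" and b': "b' \<in> trivs E" "x \<in> fst b'" for x c b'
  proof -
    have "\<delta> x b' = det (transition E (b x) b' x) * \<delta> x (b x)"
      using \<delta>(1)[of x] b b' unfolding det_bundle_fibre_iff trivs_at_def by blast
    moreover have "det (transition E (b x) c x) = det (transition E b' c x) * det (transition E (b x) b' x)"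
      by (rule transition_cocycle[OF E bt b(2) hol_vbundle_triv[OF E b'(1)] b'(2) Bt[OF c(1)] c(2)])
    ultimately show ?thesis using c by (simp add: \<sigma>_def trivs_at_def)
  qed
  show ?thesis unfolding sub_degree_def
  proof (rule vb_degree_eq_0[OF B, where \<sigma>=\<sigma>])
    show "\<sigma> x \<in> fibre (det_bundle ?B) x" for x
    proof -
      have "\<sigma> x d = det (transition E c d x) * \<sigma> x c" if cd: "c \<in> trivs ?B" "x \<in> fst c" "d \<in> trivs ?B" "x \<in> fst d" for c d
        unfolding \<sigma>_eq[OF cd(1,2) b] \<sigma>_eq[OF cd(3,4) b]
        using transition_cocycle[OF E bt b(2) Bt[OF cd(1)] cd(2) Bt[OF cd(3)] cd(4)] by simp
      then have "\<forall>c\<in>trivs_at ?B x. \<forall>d\<in>trivs_at ?B x. \<sigma> x d = det (transition E c d x) * \<sigma> x c"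
        unfolding trivs_at_def by blast
      moreover have "\<sigma> x \<in> extensional (trivs_at ?B x)" by (simp add: \<sigma>_def)
      ultimately show ?thesis unfolding det_bundle_fibre_iff tr by blast
    qed
    fix c assume c: "c \<in> trivs ?B"
    show "hfun (\<lambda>x. \<sigma> x c) (fst c)"
    proof (rule hfun_local[OF hol_trivD(1)[OF Bt[OF c]]])
      fix x assume x: "x \<in> fst c"
      have "hfun (\<lambda>y. det (transition E (b x) c y) * \<delta> y (b x)) (fst c \<inter> fst (b x))"
        by (intro hfun_mult hfun_subset[OF hfun_det_transition[OF E bt Bt[OF c]]] hfun_subset[OF \<delta>_hol[OF b(1)]]) auto
      then have "hfun (\<lambda>y. \<sigma> y c) (fst c \<inter> fst (b x))"
        by (rule hfun_cong) (use \<sigma>_eq[OF c _ b(1)] in auto)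
      then show "\<exists>S. open S \<and> x \<in> S \<and> hfun (\<lambda>x. \<sigma> x c) (fst c \<inter> S)"
        using hol_trivD(1)[OF bt[of x]] b(2) by blast
    qed
    show "\<sigma> x c \<noteq> 0" if "x \<in> fst c" for x
      unfolding \<sigma>_eq[OF c that b]
      using det_transition_nonzero[OF E bt b(2) Bt[OF c] that] \<delta>_nz[OF b] by simp
  qed
qed

end

section \<open>Quotients and the splitting of a filtration\<close>

text \<open>Subbundles are mere sets in each fibre; their images in a trivialization are the linear
  subspaces to which the algebra below applies.\<close>

definition vsub :: "nat \<Rightarrow> complex vec set \<Rightarrow> bool" where
  "vsub n X \<longleftrightarrow> X \<subseteq> carrier_vec n \<and> 0\<^sub>v n \<in> X \<and> (\<forall>u\<in>X. \<forall>v\<in>X. u + v \<in> X) \<and> (\<forall>a. \<forall>u\<in>X. a \<cdot>\<^sub>v u \<in> X)"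

lemma vsubD:
  assumes "vsub n X"
  shows "u \<in> X \<Longrightarrow> u \<in> carrier_vec n" "0\<^sub>v n \<in> X" "u \<in> X \<Longrightarrow> v \<in> X \<Longrightarrow> u + v \<in> X"
    "u \<in> X \<Longrightarrow> a \<cdot>\<^sub>v u \<in> X" "u \<in> X \<Longrightarrow> v \<in> X \<Longrightarrow> u - v \<in> X"
proof -
  show *: "u \<in> X \<Longrightarrow> u \<in> carrier_vec n" "0\<^sub>v n \<in> X" "u \<in> X \<Longrightarrow> v \<in> X \<Longrightarrow> u + v \<in> X" "u \<in> X \<Longrightarrow> a \<cdot>\<^sub>v u \<in> X"
    for u v a using assms unfolding vsub_def by blast+
  show "u - v \<in> X" if "u \<in> X" "v \<in> X"
  proof -
    have "u - v = u + (-1) \<cdot>\<^sub>v v" using *(1)[OF that(1)] *(1)[OF that(2)] by (intro eq_vecI) auto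
    with *(3)[OF that(1) *(4)[OF that(2)]] show ?thesis by simp
  qed
qed

text \<open>The map \<open>v \<mapsto> (P i v mod F (i - 1))\<^sub>i\<close> to the graded space is bijective because it is the
  identity on each graded piece.\<close>

locale filtered_projections =
  fixes n k :: nat and F :: "nat \<Rightarrow> complex vec set" and P :: "nat \<Rightarrow> complex mat"
  assumes F_sub: "i \<le> k \<Longrightarrow> vsub n (F i)"
    and F_zero: "F 0 = {0\<^sub>v n}" and F_top: "F k = carrier_vec n"
    and F_mono: "i \<le> j \<Longrightarrow> j \<le> k \<Longrightarrow> F i \<subseteq> F j"
    and P_mat: "i \<in> {1..k} \<Longrightarrow> P i \<in> carrier_mat n n"
    and P_in: "i \<in> {1..k} \<Longrightarrow> v \<in> carrier_vec n \<Longrightarrow> P i *\<^sub>v v \<in> F i"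
    and P_id: "i \<in> {1..k} \<Longrightarrow> v \<in> F i \<Longrightarrow> P i *\<^sub>v v = v"
begin

text \<open>Descent along the filtration: once \<open>v\<close> lies in \<open>F i\<close>, it is
  fixed by \<open>P i\<close>, so the hypothesis puts it into \<open>F (i - 1)\<close>; at the
  bottom it is 0.\<close>

lemma graded_injective:
  assumes v: "v \<in> carrier_vec n" and 0: "\<And>i. i \<in> {1..k} \<Longrightarrow> P i *\<^sub>v v \<in> F (i - 1)"
  shows "v = 0\<^sub>v n"
proof -
  have "v \<in> F (k - j)" if "j \<le> k" for j
    using that
  proof (induction j)
    case 0
    then show ?case using v F_top by simp
  next
    case (Suc j)
    then have i: "k - j \<in> {1..k}" and v': "v \<in> F (k - j)" by auto
    have "k - j - 1 = k - Suc j" by simp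
    then show ?case using 0[OF i] P_id[OF i v'] by simp
  qed
  from this[of k] show ?thesis using F_zero by simp
qed

text \<open>The top class is met by \<open>w = r (Suc j)\<close> itself. This disturbs the lower
  classes by \<open>P i *\<^sub>v w\<close>, and the induction hypothesis corrects them with a
  vector of \<open>F j\<close>, which does not affect the top class. The induction runs over all
  \<open>r\<close> because the targets change.\<close>

lemma graded_surjective:
  assumes "j \<le> k" "\<And>i. i \<in> {1..k} \<Longrightarrow> r i \<in> F i"
  shows "\<exists>v\<in>F j. \<forall>i\<in>{1..j}. P i *\<^sub>v v - r i \<in> F (i - 1)"
  using assms
proof (induction j arbitrary: r)
  case 0
  then show ?case using F_zero by auto
next
  case (Suc j)
  have jk: "Suc j \<in> {1..k}" using Suc.prems(1) by simp
  define w where "w = r (Suc j)"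
  have w: "w \<in> F (Suc j)" using Suc.prems(2)[OF jk] by (simp add: w_def)
  have wc: "w \<in> carrier_vec n" using vsubD(1)[OF F_sub w] Suc.prems(1) by simp
  have "\<exists>v\<in>F j. \<forall>i\<in>{1..j}. P i *\<^sub>v v - (r i - P i *\<^sub>v w) \<in> F (i - 1)"
  proof (rule Suc.IH)
    fix i assume i: "i \<in> {1..k}"
    then show "r i - P i *\<^sub>v w \<in> F i" using vsubD(5)[OF F_sub] Suc.prems(2)[OF i] P_in[OF i wc] by simp
  qed (use Suc.prems(1) in simp)
  then obtain v where v: "v \<in> F j" "\<And>i. i \<in> {1..j} \<Longrightarrow> P i *\<^sub>v v - (r i - P i *\<^sub>v w) \<in> F (i - 1)" by blast
  have vc: "v \<in> carrier_vec n" using vsubD(1)[OF F_sub v(1)] Suc.prems(1) by simp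
  have v': "v \<in> F (Suc j)" using F_mono[of j "Suc j"] v(1) Suc.prems(1) by auto
  have vw: "v + w \<in> F (Suc j)" using vsubD(3)[OF F_sub v' w] Suc.prems(1) by simp
  have "P i *\<^sub>v (v + w) - r i \<in> F (i - 1)" if i: "i \<in> {1..Suc j}" for i
  proof (cases "i = Suc j")
    case True
    have "P i *\<^sub>v (v + w) - r i = v"
      using P_id[OF jk vw] vc wc by (auto simp: True w_def intro!: eq_vecI)
    then show ?thesis using v(1) True by simp
  next
    case False
    then have i: "i \<in> {1..j}" "i \<in> {1..k}" using that Suc.prems(1) by auto
    have "r i \<in> carrier_vec n" using vsubD(1)[OF F_sub Suc.prems(2)[OF i(2)]] i(2) by simp
    then have "P i *\<^sub>v (v + w) - r i = P i *\<^sub>v v - (r i - P i *\<^sub>v w)"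
      using mult_add_distrib_mat_vec[OF P_mat[OF i(2)] vc wc] P_mat[OF i(2)]
      by (intro eq_vecI) (auto simp: algebra_simps)
    then show ?thesis using v(2)[OF i(1)] by simp
  qed
  with vw show ?case by blast
qed

end

lemma vec_of_list_append: "vec_of_list (xs @ ys) = vec_of_list xs @\<^sub>v vec_of_list ys"
  by (rule eq_vecI) (auto simp: nth_append vec_of_list_index)

lemma append_mult_mat_vec:
  assumes "M \<in> carrier_mat a n" "N \<in> carrier_mat b n" "v \<in> carrier_vec n"
  shows "mat (a + b) n (\<lambda>(i,j). if i < a then M $$ (i,j) else N $$ (i - a, j)) *\<^sub>v v = (M *\<^sub>v v) @\<^sub>v (N *\<^sub>v (v :: complex vec))"
proof (rule eq_vecI)
  let ?K = "mat (a + b) n (\<lambda>(i,j). if i < a then M $$ (i,j) else N $$ (i - a, j))"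
  fix i assume "i < dim_vec ((M *\<^sub>v v) @\<^sub>v (N *\<^sub>v v))"
  then have i: "i < a + b" using assms by simp
  have "row ?K i = (if i < a then row M i else row N (i - a))"
    using i assms by (intro eq_vecI) auto
  then show "(?K *\<^sub>v v) $ i = ((M *\<^sub>v v) @\<^sub>v (N *\<^sub>v v)) $ i" using i assms by simp
qed (use assms in simp)

context compact_riemann_surface begin

lemma hol_lin_concat:
  assumes "\<And>i. i \<in> set xs \<Longrightarrow> hol_lin V n (q i) p (f i) U"
    and "\<And>x v. x \<in> U \<Longrightarrow> v \<in> V x \<Longrightarrow> p x v \<in> carrier_vec n"
  shows "hol_lin V n (sum_list (map q xs)) p (\<lambda>x v. vec_of_list (concat (map (\<lambda>i. list_of_vec (f i x v)) xs))) U"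
  using assms(1)
proof (induction xs)
  case Nil
  show ?case
    by (rule hol_linI[OF hmat_const[of "0\<^sub>m 0 n"]]) (auto intro!: eq_vecI)
next
  case (Cons a xs)
  let ?g = "\<lambda>x v. vec_of_list (concat (map (\<lambda>i. list_of_vec (f i x v)) xs))"
  obtain M where M: "hmat (q a) n M U" "\<And>x v. x \<in> U \<Longrightarrow> v \<in> V x \<Longrightarrow> f a x v = M x *\<^sub>v p x v"
    using Cons.prems[of a] unfolding hol_lin_def by auto
  have "hol_lin V n (sum_list (map q xs)) p ?g U" using Cons by simp
  then obtain N where N: "hmat (sum_list (map q xs)) n N U" "\<And>x v. x \<in> U \<Longrightarrow> v \<in> V x \<Longrightarrow> ?g x v = N x *\<^sub>v p x v"
    unfolding hol_lin_def by blast
  have "hmat (q a + sum_list (map q xs)) n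
    (\<lambda>x. mat (q a + sum_list (map q xs)) n (\<lambda>(i,j). if i < q a then M x $$ (i,j) else N x $$ (i - q a, j))) U"
  proof (rule hmat_mat)
    fix i j assume "i < q a + sum_list (map q xs)" "j < n"
    then show "hfun (\<lambda>x. if i < q a then M x $$ (i,j) else N x $$ (i - q a, j)) U"
      using hmatD(2)[OF M(1), of i j] hmatD(2)[OF N(1), of "i - q a" j] by (cases "i < q a") auto
  qed
  then show ?case unfolding list.map(2)[of q] sum_list.Cons
  proof (rule hol_linI)
    fix x v assume x: "x \<in> U" "v \<in> V x"
    have "vec_of_list (concat (map (\<lambda>i. list_of_vec (f i x v)) (a # xs))) = vec_of_list (list_of_vec (f a x v)) @\<^sub>v ?g x v"
      by (simp only: list.map concat.simps vec_of_list_append)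
    then have "vec_of_list (concat (map (\<lambda>i. list_of_vec (f i x v)) (a # xs))) = M x *\<^sub>v p x v @\<^sub>v N x *\<^sub>v p x v"
      by (simp only: vec_list M(2)[OF x] N(2)[OF x])
    then show "vec_of_list (concat (map (\<lambda>i. list_of_vec (f i x v)) (a # xs))) =
      mat (q a + sum_list (map q xs)) n (\<lambda>(i,j). if i < q a then M x $$ (i,j) else N x $$ (i - q a, j)) *\<^sub>v p x v"
      by (simp only: append_mult_mat_vec[OF hmatD(1)[OF M(1) x(1)] hmatD(1)[OF N(1) x(1)] assms(2)[OF x]])
  qed
qed

text \<open>In coordinates \<open>S\<close> is the common kernel of the last rows of the transition
  matrix to an adapted trivialization.\<close>

lemma subbundle_vsub:
  assumes E: "hol_vbundle A E" and S: "subbundle_of_rank A E m S" and b: "hol_triv A E b" "x \<in> fst b"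
  shows "vsub (vb_rank E) (snd b x ` S x)"
proof -
  let ?r = "vb_rank E"
  obtain c where c: "x \<in> fst c" "adapted_triv A E m S c" using subbundleD(3)[OF S] by blast
  note ct = adapted_trivD(1)[OF c(2)]
  obtain g where g: "g \<in> carrier_mat ?r ?r" "\<And>v. v \<in> fibre E x \<Longrightarrow> snd c x v = g *\<^sub>v snd b x v"
    using transition_mat[OF E b ct c(1)] by blast
  have eq: "snd b x ` S x = {y \<in> carrier_vec ?r. \<forall>i. m \<le> i \<and> i < ?r \<longrightarrow> (g *\<^sub>v y) $ i = 0}"
  proof (intro equalityI subsetI)
    fix y assume "y \<in> snd b x ` S x"
    then obtain v where v: "v \<in> S x" "y = snd b x v" by blast
    then have vf: "v \<in> fibre E x" using subbundleD(2)[OF S] by blast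
    with v(1) show "y \<in> {y \<in> carrier_vec ?r. \<forall>i. m \<le> i \<and> i < ?r \<longrightarrow> (g *\<^sub>v y) $ i = 0}"
      using adapted_mem_iff[OF c(2,1) subbundleD(2)[OF S] vf] g(2)[OF vf] hol_trivD(5)[OF b vf] by (simp add: v(2))
  next
    fix y assume y: "y \<in> {y \<in> carrier_vec ?r. \<forall>i. m \<le> i \<and> i < ?r \<longrightarrow> (g *\<^sub>v y) $ i = 0}"
    then obtain v where v: "v \<in> fibre E x" "snd b x v = y" using triv_coords_ex[OF b] by blast
    then have "v \<in> S x"
      using adapted_mem_iff[OF c(2,1) subbundleD(2)[OF S] v(1)] g(2)[OF v(1)] y by simp
    with v(2) show "y \<in> snd b x ` S x" by blast
  qed
  have "g *\<^sub>v 0\<^sub>v ?r = 0\<^sub>v ?r" using g(1) by (intro eq_vecI) auto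
  then show ?thesis unfolding eq vsub_def
    using g(1) by (auto simp: mult_add_distrib_mat_vec[OF g(1)] mult_mat_vec[OF g(1)] simp del: index_mult_mat_vec)
qed

section \<open>Cosets and the quotient bundle\<close>

context
  fixes B :: "('x, 'v) vbundle" and s :: nat and S :: "'x \<Rightarrow> 'v set"
  assumes B: "hol_vbundle A B" and S: "subbundle_of_rank A B s S"
begin

text \<open>In an adapted trivialization \<open>S\<close> is the kernel of the last coordinates, so
  its cosets are their level sets.\<close>

lemma coset_iff:
  assumes c: "adapted_triv A B s S c" "x \<in> fst c" and v: "v \<in> fibre B x"
  shows "u \<in> fibre_add B x v ` S x \<longleftrightarrow>
    u \<in> fibre B x \<and> vec_last (snd c x u) (vb_rank B - s) = vec_last (snd c x v) (vb_rank B - s)"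
proof -
  let ?r = "vb_rank B" and ?q = "vb_rank B - s"
  note ct = adapted_trivD(1)[OF c(1)]
  note cc = hol_trivD(5)[OF ct c(2)]
  have last_S: "w \<in> S x \<longleftrightarrow> vec_last (snd c x w) ?q = 0\<^sub>v ?q" if "w \<in> fibre B x" for w
    using adapted_mem_iff[OF c subbundleD(2)[OF S] that] vec_last_eq_0_iff[OF subbundleD(1)[OF S] cc[OF that]] by simp
  have add: "vec_last (snd c x (fibre_add B x v w)) ?q = vec_last (snd c x v) ?q + vec_last (snd c x w) ?q"
    if "w \<in> fibre B x" for w
    using fibre_add(2)[OF B v that ct c(2)] vec_last_add[of ?q ?r, OF _ cc[OF v] cc[OF that]] by simp
  show ?thesis
  proof
    assume "u \<in> fibre_add B x v ` S x"
    then obtain w where w: "w \<in> S x" "u = fibre_add B x v w" by blast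
    have wf: "w \<in> fibre B x" using w(1) subbundleD(2)[OF S] by blast
    show "u \<in> fibre B x \<and> vec_last (snd c x u) ?q = vec_last (snd c x v) ?q"
      using fibre_add(1)[OF B v wf] add[OF wf] last_S[OF wf] w by simp
  next
    assume u: "u \<in> fibre B x \<and> vec_last (snd c x u) ?q = vec_last (snd c x v) ?q"
    have "snd c x u - snd c x v \<in> carrier_vec ?r" using cc u v by simp
    then obtain w where w: "w \<in> fibre B x" "snd c x w = snd c x u - snd c x v" by (rule triv_coords_ex[OF ct c(2)])
    have "fibre_add B x v w = u"
      by (rule fibre_add_unique[OF B v w(1) ct c(2)])
         (use u w(2) cc[of u] cc[OF v] in \<open>auto intro!: eq_vecI\<close>)
    moreover from this have "vec_last (snd c x w) ?q = 0\<^sub>v ?q"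
    proof (intro eq_vecI)
      fix i assume "i < dim_vec (0\<^sub>v ?q :: complex vec)"
      moreover have "vec_last (snd c x v) ?q = vec_last (snd c x v) ?q + vec_last (snd c x w) ?q"
        using add[OF w(1)] u unfolding \<open>fibre_add B x v w = u\<close> by simp
      then have "vec_last (snd c x v) ?q $ i = (vec_last (snd c x v) ?q + vec_last (snd c x w) ?q) $ i" by simp
      ultimately show "vec_last (snd c x w) ?q $ i = 0\<^sub>v ?q $ i" by simp
    qed simp
    ultimately show "u \<in> fibre_add B x v ` S x" using last_S[OF w(1)] by blast
  qed
qed

lemma quot_simps:
  "vb_rank (quot_bundle A B S) = vb_rank B - s"
  "fibre (quot_bundle A B S) = (\<lambda>x. (\<lambda>v. fibre_add B x v ` S x) ` fibre B x)"
  "trivs (quot_bundle A B S) = {(fst c, \<lambda>x C. vec_last (snd c x (SOME v. v \<in> C)) (vb_rank B - s)) | c. adapted_triv A B s S c}"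
  unfolding quot_bundle_def Let_def sub_rank_eq[OF B S] by (simp_all only: vbundle.simps)

text \<open>Trivializations of the quotient evaluate a representative picked by \<open>SOME\<close>;
  by the description as level sets every representative gives the same value.\<close>

lemma coset_rep:
  assumes c: "adapted_triv A B s S c" "x \<in> fst c" and v: "v \<in> fibre B x"
  shows "vec_last (snd c x (SOME u. u \<in> fibre_add B x v ` S x)) (vb_rank B - s) = vec_last (snd c x v) (vb_rank B - s)"
proof -
  have "v \<in> fibre_add B x v ` S x" using coset_iff[OF c v, of v] v by simp
  from someI[of "\<lambda>u. u \<in> fibre_add B x v ` S x", OF this] show ?thesis
    unfolding coset_iff[OF c v] by simp
qed

lemma coset_eq_iff:
  assumes u: "u \<in> fibre B x" and v: "v \<in> fibre B x"
  shows "fibre_add B x u ` S x = fibre_add B x v ` S x \<longleftrightarrow> u \<in> fibre_add B x v ` S x"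
proof -
  obtain c where c: "x \<in> fst c" "adapted_triv A B s S c" using subbundleD(3)[OF S] by blast
  note iff = coset_iff[OF c(2,1)]
  show ?thesis
  proof
    assume "fibre_add B x u ` S x = fibre_add B x v ` S x"
    moreover have "u \<in> fibre_add B x u ` S x" using iff[OF u] u by blast
    ultimately show "u \<in> fibre_add B x v ` S x" by simp
  next
    assume "u \<in> fibre_add B x v ` S x"
    then have "vec_last (snd c x u) (vb_rank B - s) = vec_last (snd c x v) (vb_rank B - s)" using iff[OF v] by blast
    then show "fibre_add B x u ` S x = fibre_add B x v ` S x"
      using iff[OF u] iff[OF v] by (intro equalityI subsetI) simp_all
  qed
qed

lemma coset_zero_iff:
  assumes v: "v \<in> fibre B x"
  shows "fibre_add B x v ` S x \<in> zero_sub (quot_bundle A B S) x \<longleftrightarrow> v \<in> S x"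
proof -
  let ?q = "vb_rank B - s" and ?C = "fibre_add B x v ` S x"
  have last_S: "v \<in> S x \<longleftrightarrow> vec_last (snd c x v) ?q = 0\<^sub>v ?q" if c: "adapted_triv A B s S c" "x \<in> fst c" for c
    using adapted_mem_iff[OF c subbundleD(2)[OF S] v]
      vec_last_eq_0_iff[OF subbundleD(1)[OF S] hol_trivD(5)[OF adapted_trivD(1)[OF c(1)] c(2) v]] by simp
  obtain c where c: "x \<in> fst c" "adapted_triv A B s S c" using subbundleD(3)[OF S] by blast
  show ?thesis
  proof
    assume "?C \<in> zero_sub (quot_bundle A B S) x"
    then obtain t where "t \<in> trivs (quot_bundle A B S)" "x \<in> fst t" "snd t x ?C = 0\<^sub>v ?q"
      unfolding zero_sub_def trivs_at_def quot_simps(1) by blast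
    then obtain d where d: "adapted_triv A B s S d" "x \<in> fst d" "vec_last (snd d x (SOME v. v \<in> ?C)) ?q = 0\<^sub>v ?q"
      unfolding quot_simps(3) by auto
    then show "v \<in> S x" using last_S[OF d(1,2)] coset_rep[OF d(1,2) v] by simp
  next
    assume "v \<in> S x"
    let ?t = "(fst c, \<lambda>x C. vec_last (snd c x (SOME v. v \<in> C)) ?q)"
    have "?t \<in> trivs_at (quot_bundle A B S) x" unfolding trivs_at_def quot_simps(3) using c by auto
    moreover have "snd ?t x ?C = 0\<^sub>v (vb_rank (quot_bundle A B S))"
      using last_S[OF c(2,1)] coset_rep[OF c(2,1) v] \<open>v \<in> S x\<close> by (simp add: quot_simps(1))
    moreover have "?C \<in> fibre (quot_bundle A B S) x" unfolding quot_simps(2) using v by blast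
    ultimately show "?C \<in> zero_sub (quot_bundle A B S) x" unfolding zero_sub_def by blast
  qed
qed

end

section \<open>Tensor products with the line bundle and the matrix of the Higgs field\<close>

lemma tensor_coords_transfer:
  assumes L: "hol_vbundle A L" "vb_rank L = 1" and W: "hol_vbundle A W"
    and b: "hol_triv A L b" "x \<in> fst b" and b': "hol_triv A L b'" "x \<in> fst b'"
    and c: "hol_triv A W c" "x \<in> fst c" and c': "hol_triv A W c'" "x \<in> fst c'"
    and l: "l \<in> fibre L x" "l' \<in> fibre L x" and v: "v \<in> fibre W x" "v' \<in> fibre W x"
    and eq: "tensor_coords b c x l v = tensor_coords b c x l' v'"
  shows "tensor_coords b' c' x l v = tensor_coords b' c' x l' v'"
proof -
  obtain g where g: "g \<in> carrier_mat 1 1" "\<And>l. l \<in> fibre L x \<Longrightarrow> snd b' x l = g *\<^sub>v snd b x l"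
    using transition_mat[OF L(1) b b'] unfolding L(2) by blast
  obtain h where h: "h \<in> carrier_mat (vb_rank W) (vb_rank W)" "\<And>v. v \<in> fibre W x \<Longrightarrow> snd c' x v = h *\<^sub>v snd c x v"
    using transition_mat[OF W c c'] by blast
  \<comment> \<open>Changing both trivializations multiplies tensor coordinates by a scalar and a
    matrix that are the same for all pure tensors.\<close>
  have "tensor_coords b' c' x l v = g $$ (0,0) \<cdot>\<^sub>v (h *\<^sub>v tensor_coords b c x l v)"
    if "l \<in> fibre L x" "v \<in> fibre W x" for l v
  proof -
    have "snd b x l \<in> carrier_vec 1" using hol_trivD(5)[OF b that(1)] L(2) by simp
    then have "snd b' x l $ 0 = g $$ (0,0) * snd b x l $ 0"
      using g(1) g(2)[OF that(1)] by (simp add: scalar_prod_def)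
    then show ?thesis unfolding tensor_coords_def h(2)[OF that(2)]
      using mult_mat_vec[OF h(1) hol_trivD(5)[OF c that(2)]] by (simp add: smult_smult_assoc)
  qed
  with l v eq show ?thesis by simp
qed

lemma mem_pure_tensor:
  assumes L: "hol_vbundle A L" "vb_rank L = 1" and W: "hol_vbundle A W"
    and b: "b \<in> trivs L" "x \<in> fst b" and c: "c \<in> trivs W" "x \<in> fst c"
    and l: "l \<in> fibre L x" and v: "v \<in> fibre W x"
  shows "(l', v') \<in> pure_tensor L W x l v \<longleftrightarrow>
    l' \<in> fibre L x \<and> v' \<in> fibre W x \<and> tensor_coords b c x l' v' = tensor_coords b c x l v"
proof
  assume "(l', v') \<in> pure_tensor L W x l v"
  then obtain b' c' where "l' \<in> fibre L x" "v' \<in> fibre W x" "b' \<in> trivs L" "x \<in> fst b'" "c' \<in> trivs W" "x \<in> fst c'"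
    "tensor_coords b' c' x l' v' = tensor_coords b' c' x l v"
    unfolding pure_tensor_def trivs_at_def by blast
  then show "l' \<in> fibre L x \<and> v' \<in> fibre W x \<and> tensor_coords b c x l' v' = tensor_coords b c x l v"
    using tensor_coords_transfer[OF L W hol_vbundle_triv[OF L(1)] _ hol_vbundle_triv[OF L(1) b(1)] b(2)
        hol_vbundle_triv[OF W] _ hol_vbundle_triv[OF W c(1)] c(2)] l v by blast
next
  assume "l' \<in> fibre L x \<and> v' \<in> fibre W x \<and> tensor_coords b c x l' v' = tensor_coords b c x l v"
  then show "(l', v') \<in> pure_tensor L W x l v"
    unfolding pure_tensor_def trivs_at_def using b c by blast
qed

lemma tensor_triv_pure:
  assumes L: "hol_vbundle A L" "vb_rank L = 1" and W: "hol_vbundle A W"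
    and b: "b \<in> trivs L" "x \<in> fst b" and c: "c \<in> trivs W" "x \<in> fst c"
    and l: "l \<in> fibre L x" and v: "v \<in> fibre W x"
  shows "snd (tensor_triv b c) x (pure_tensor L W x l v) = tensor_coords b c x l v"
proof -
  note mem = mem_pure_tensor[OF L W b c l v]
  have "(THE y. \<exists>(l', v')\<in>pure_tensor L W x l v. y = tensor_coords b c x l' v') = tensor_coords b c x l v"
  proof (rule the_equality)
    show "\<exists>(l', v')\<in>pure_tensor L W x l v. tensor_coords b c x l v = tensor_coords b c x l' v'"
      using mem[of l v] l v by blast
    fix y assume "\<exists>(l', v')\<in>pure_tensor L W x l v. y = tensor_coords b c x l' v'"
    then show "y = tensor_coords b c x l v" using mem by blast
  qed
  then show ?thesis by (simp add: tensor_triv_def)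
qed

lemma pure_tensor_eqI:
  assumes L: "hol_vbundle A L" "vb_rank L = 1" and W: "hol_vbundle A W"
    and b: "b \<in> trivs L" "x \<in> fst b" and c: "c \<in> trivs W" "x \<in> fst c"
    and l: "l \<in> fibre L x" "l' \<in> fibre L x" and v: "v \<in> fibre W x" "v' \<in> fibre W x"
    and eq: "tensor_coords b c x l v = tensor_coords b c x l' v'"
  shows "pure_tensor L W x l v = pure_tensor L W x l' v'"
  using mem_pure_tensor[OF L W b c l(1) v(1)] mem_pure_tensor[OF L W b c l(2) v(2)] eq
  by (intro equalityI subrelI) simp_all

lemma higgs_matrix:
  assumes L: "hol_vbundle A L" "vb_rank L = 1" and W: "hol_vbundle A W"
    and \<Phi>: "vb_hom A W (line_tensor L W) \<Phi>"
    and b: "b \<in> trivs L" "x \<in> fst b" and c: "c \<in> trivs W" "x \<in> fst c"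
  obtains M where "M \<in> carrier_mat (vb_rank W) (vb_rank W)"
    "\<And>l v w. v \<in> fibre W x \<Longrightarrow> l \<in> fibre L x \<Longrightarrow> w \<in> fibre W x \<Longrightarrow> \<Phi> x v = pure_tensor L W x l w \<Longrightarrow>
       M *\<^sub>v snd c x v = tensor_coords b c x l w"
proof -
  have t: "tensor_triv b c \<in> trivs (line_tensor L W)" using b c unfolding line_tensor_def vbundle.simps by blast
  have r: "vb_rank (line_tensor L W) = vb_rank W" by (simp add: line_tensor_def)
  from bspec[OF bspec[OF conjunct2[OF \<Phi>[unfolded vb_hom_def]] c(1)] t]
  obtain M where M: "hmat (vb_rank W) (vb_rank W) M (fst c \<inter> fst (tensor_triv b c))"
    "\<And>x v. x \<in> fst c \<inter> fst (tensor_triv b c) \<Longrightarrow> v \<in> fibre W x \<Longrightarrow> snd (tensor_triv b c) x (\<Phi> x v) = M x *\<^sub>v snd c x v"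
    unfolding r by blast
  have x: "x \<in> fst c \<inter> fst (tensor_triv b c)" using b c by (simp add: tensor_triv_def)
  show thesis
  proof (rule that[OF hmatD(1)[OF M(1) x]])
    fix l v w assume "v \<in> fibre W x" "l \<in> fibre L x" "w \<in> fibre W x" "\<Phi> x v = pure_tensor L W x l w"
    then show "M x *\<^sub>v snd c x v = tensor_coords b c x l w"
      using M(2)[OF x] tensor_triv_pure[OF L W b c] by metis
  qed
qed

lemma higgs_range:
  assumes "vb_hom A W (line_tensor L W) \<Phi>"
  shows "higgs_invariant L W \<Phi> (fibre W)"
  using assms by (auto simp: vb_hom_def higgs_invariant_def line_tensor_def)

text \<open>With a trivialization of \<open>L\<close> chosen, the Higgs field at \<open>x\<close> is
  a matrix \<open>M\<close>, and invariance becomes invariance under \<open>M\<close>. The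
  coordinates of a pure tensor are a multiple of those of its second factor; the first direction
  absorbs the multiple into the subspace, the second normalizes the factor in \<open>L\<close> to
  have coordinate 1.\<close>

lemma higgs_pointwise:
  assumes L: "hol_vbundle A L" "vb_rank L = 1" and W: "hol_vbundle A W"
    and \<Phi>: "vb_hom A W (line_tensor L W) \<Phi>" and c: "c \<in> trivs W" "x \<in> fst c"
  obtains M where "M \<in> carrier_mat (vb_rank W) (vb_rank W)"
    "\<And>S y. S x \<subseteq> fibre W x \<Longrightarrow> vsub (vb_rank W) (snd c x ` S x) \<Longrightarrow> \<Phi> x ` S x \<subseteq> tensor_sub L W S x \<Longrightarrow>
       y \<in> snd c x ` S x \<Longrightarrow> M *\<^sub>v y \<in> snd c x ` S x"
    "\<And>S. S x \<subseteq> fibre W x \<Longrightarrow> (\<And>y. y \<in> snd c x ` S x \<Longrightarrow> M *\<^sub>v y \<in> snd c x ` S x) \<Longrightarrow>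
       \<Phi> x ` S x \<subseteq> tensor_sub L W S x"
proof -
  obtain b where b: "b \<in> trivs L" "x \<in> fst b" using hol_vbundle_ex[OF L(1)] by blast
  obtain M where M: "M \<in> carrier_mat (vb_rank W) (vb_rank W)"
    "\<And>l v w. v \<in> fibre W x \<Longrightarrow> l \<in> fibre L x \<Longrightarrow> w \<in> fibre W x \<Longrightarrow> \<Phi> x v = pure_tensor L W x l w \<Longrightarrow>
       M *\<^sub>v snd c x v = tensor_coords b c x l w"
    by (rule higgs_matrix[OF L W \<Phi> b c]) blast
  show thesis
  proof (rule that[OF M(1)])
    fix S y assume S: "S x \<subseteq> fibre W x" "vsub (vb_rank W) (snd c x ` S x)" "\<Phi> x ` S x \<subseteq> tensor_sub L W S x"
      "y \<in> snd c x ` S x"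
    then obtain v where v: "v \<in> S x" "y = snd c x v" by blast
    then obtain l w where lw: "l \<in> fibre L x" "w \<in> S x" "\<Phi> x v = pure_tensor L W x l w"
      using S(3) unfolding tensor_sub_def by blast
    have "M *\<^sub>v y = snd b x l $ 0 \<cdot>\<^sub>v snd c x w"
      using M(2)[OF _ lw(1) _ lw(3)] v lw(2) S(1) by (auto simp: tensor_coords_def)
    then show "M *\<^sub>v y \<in> snd c x ` S x" using vsubD(4)[OF S(2)] lw(2) by simp
  next
    fix S assume S: "S x \<subseteq> fibre W x" "\<And>y. y \<in> snd c x ` S x \<Longrightarrow> M *\<^sub>v y \<in> snd c x ` S x"
    have "vec 1 (\<lambda>_. 1) \<in> carrier_vec (vb_rank L)" by (simp add: L(2))
    \<comment> \<open>\<open>l1\<close> generates the fibre of \<open>L\<close>: a tensor with the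
      coordinates of \<open>u\<close> equals \<open>l1\<close> tensored with
      \<open>u\<close>.\<close>
    then obtain l1 where l1: "l1 \<in> fibre L x" "snd b x l1 = vec 1 (\<lambda>_. 1)"
      by (rule triv_coords_ex[OF hol_vbundle_triv[OF L(1) b(1)] b(2)])
    show "\<Phi> x ` S x \<subseteq> tensor_sub L W S x"
    proof
      fix t assume "t \<in> \<Phi> x ` S x"
      then obtain v where v: "v \<in> S x" "t = \<Phi> x v" by blast
      have vf: "v \<in> fibre W x" using v S(1) by blast
      then have "\<Phi> x v \<in> tensor_sub L W (fibre W) x" using higgs_range[OF \<Phi>] unfolding higgs_invariant_def by blast
      then obtain l w where lw: "l \<in> fibre L x" "w \<in> fibre W x" "\<Phi> x v = pure_tensor L W x l w"
        unfolding tensor_sub_def by blast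
      have "M *\<^sub>v snd c x v \<in> snd c x ` S x" using S(2) v(1) by blast
      then obtain u where u: "u \<in> S x" "M *\<^sub>v snd c x v = snd c x u" by blast
      have "tensor_coords b c x l w = tensor_coords b c x l1 u"
        using M(2)[OF vf lw] u(2) l1(2) by (simp add: tensor_coords_def)
      then have "\<Phi> x v = pure_tensor L W x l1 u"
        using pure_tensor_eqI[OF L W b c lw(1) l1(1) lw(2)] u(1) S(1) lw(3) by auto
      then show "t \<in> tensor_sub L W S x" unfolding tensor_sub_def using v(2) l1(1) u(1) by blast
    qed
  qed
qed

section \<open>The splitting of a filtration along complements\<close>

lemma direct_sum_simps:
  "vb_rank (direct_sum k G) = (\<Sum>i=1..k. vb_rank (G i))"
  "fibre (direct_sum k G) x = PiE {1..k} (\<lambda>i. fibre (G i) x)"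
  "trivs (direct_sum k G) = {(\<Inter>i\<in>{1..k}. fst (c i),
                \<lambda>x u. vec_of_list (concat (map (\<lambda>i. list_of_vec (snd (c i) x (u i))) [1..<Suc k])))
               | c. \<forall>i\<in>{1..k}. c i \<in> trivs (G i)}"
  by (simp_all only: direct_sum_def vbundle.simps)

text \<open>On \<open>F\<^sub>j\<close> the projections with \<open>i \<ge> j\<close> are the identity, so the splitting respects the
  filtration and is the identity on the graded pieces.\<close>

definition splitting ::
  "('x, 'w) vbundle \<Rightarrow> nat \<Rightarrow> (nat \<Rightarrow> 'x \<Rightarrow> 'w set) \<Rightarrow> (nat \<Rightarrow> 'x \<Rightarrow> 'w set) \<Rightarrow> 'x \<Rightarrow> 'w \<Rightarrow> nat \<Rightarrow> 'w set" where
  "splitting W k F T x v = restrict (\<lambda>i. fibre_add (sub_bundle A W (F i)) x (proj_on W (F i) (T i) x v) ` F (i - 1) x) {1..k}"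

lemma filtration_mono:
  assumes "filtration A W k F" "i \<le> j" "j \<le> k" shows "F i x \<subseteq> F j x"
  using assms(2,3)
proof (induction j rule: dec_induct)
  case (step j)
  then have "F i x \<subseteq> F j x" by simp
  also have "F j x \<subseteq> F (Suc j) x" using assms(1) step unfolding filtration_def by simp
  finally show ?case .
qed simp

context
  fixes W :: "('x, 'w) vbundle" and k :: nat and F T :: "nat \<Rightarrow> 'x \<Rightarrow> 'w set" and sr :: "nat \<Rightarrow> nat"
  assumes W: "hol_vbundle A W" and filt: "filtration A W k F"
    and F_sub: "i \<le> k \<Longrightarrow> subbundle_of_rank A W (sr i) (F i)"
    and T_sub: "i \<in> {1..k} \<Longrightarrow> subbundle A W (T i)"
    and sum: "i \<in> {1..k} \<Longrightarrow> internal_sum W (F i) (T i)"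
begin

abbreviation (input) "\<pi> i \<equiv> proj_on W (F i) (T i)"
abbreviation (input) "Bd i \<equiv> sub_bundle A W (F i)"

lemma filtration_fibre: "i \<le> k \<Longrightarrow> v \<in> F i x \<Longrightarrow> v \<in> fibre W x"
  using subbundleD(2)[OF F_sub] by blast

lemma complement_rank: "i \<in> {1..k} \<Longrightarrow> \<exists>m. subbundle_of_rank A W m (T i)"
  using T_sub by (simp add: subbundle_def)

lemma filtration_piece:
  assumes "i \<in> {1..k}"
  shows "hol_vbundle A (Bd i)" "subbundle_of_rank A (Bd i) (sr (i - 1)) (F (i - 1))"
    "vb_rank (Bd i) = sr i" "fibre (Bd i) = F i"
proof -
  have i: "i \<le> k" "i - 1 \<le> k" "i - 1 \<le> i" using assms by auto
  show "hol_vbundle A (Bd i)" by (rule hol_vbundle_sub_bundle[OF W F_sub[OF i(1)]])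
  show "subbundle_of_rank A (Bd i) (sr (i - 1)) (F (i - 1))"
    by (rule nested_subbundle[OF W F_sub[OF i(2)] F_sub[OF i(1)] filtration_mono[OF filt i(3,1)]])
  show "vb_rank (Bd i) = sr i" "fibre (Bd i) = F i" by (simp_all add: sub_bundle_simps[OF W F_sub[OF i(1)]])
qed

text \<open>Equality in a graded piece becomes membership of a difference in a subspace, which is
  the form used by the fibrewise algebra. The addition of \<open>F i\<close> is replaced by that of
  \<open>W\<close> on the way.\<close>

lemma graded_coset_eq_iff:
  assumes i: "i \<in> {1..k}" and c: "hol_triv A W c" "x \<in> fst c" and u: "u \<in> F i x" and v: "v \<in> F i x"
  shows "fibre_add (Bd i) x u ` F (i - 1) x = fibre_add (Bd i) x v ` F (i - 1) x \<longleftrightarrow>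
    snd c x u - snd c x v \<in> snd c x ` F (i - 1) x"
proof -
  have i': "i \<le> k" "i - 1 \<le> k" "i - 1 \<le> i" using i by auto
  have fs: "w \<in> fibre W x" "w \<in> F i x" if "w \<in> F (i - 1) x" for w
    using filtration_fibre[OF i'(2)] filtration_mono[OF filt i'(3,1)] that by blast+
  note uf = filtration_fibre[OF i'(1) u] and vf = filtration_fibre[OF i'(1) v]
  note uc = hol_trivD(5)[OF c uf] and vc = hol_trivD(5)[OF c vf]
  have "fibre_add (Bd i) x u ` F (i - 1) x = fibre_add (Bd i) x v ` F (i - 1) x \<longleftrightarrow> u \<in> fibre_add (Bd i) x v ` F (i - 1) x"
    by (rule coset_eq_iff[OF filtration_piece(1,2)[OF i]]) (use u v filtration_piece(4)[OF i] in simp_all)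
  also have "\<dots> \<longleftrightarrow> (\<exists>w\<in>F (i - 1) x. u = fibre_add W x v w)"
    using subbundle_add(2)[OF W F_sub[OF i'(1)] v fs(2)] by (auto simp: image_iff)
  also have "\<dots> \<longleftrightarrow> snd c x u - snd c x v \<in> snd c x ` F (i - 1) x"
  proof
    assume "\<exists>w\<in>F (i - 1) x. u = fibre_add W x v w"
    then obtain w where w: "w \<in> F (i - 1) x" "u = fibre_add W x v w" by blast
    have "snd c x u = snd c x v + snd c x w" using fibre_add(2)[OF W vf fs(1)[OF w(1)] c] w(2) by simp
    then have "snd c x u - snd c x v = snd c x w"
      using vc hol_trivD(5)[OF c fs(1)[OF w(1)]] by (intro eq_vecI) auto
    with w(1) show "snd c x u - snd c x v \<in> snd c x ` F (i - 1) x" by simp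
  next
    assume "snd c x u - snd c x v \<in> snd c x ` F (i - 1) x"
    then obtain w where w: "w \<in> F (i - 1) x" "snd c x w = snd c x u - snd c x v" by force
    have "fibre_add W x v w = u"
      by (rule fibre_add_unique[OF W vf fs(1)[OF w(1)] c uf]) (use w(2) uc vc in \<open>auto intro!: eq_vecI\<close>)
    with w(1) show "\<exists>w\<in>F (i - 1) x. u = fibre_add W x v w" by blast
  qed
  finally show ?thesis .
qed

text \<open>A vector of \<open>F i\<close> decomposes as itself plus the zero of the
  complement.\<close>

lemma filtration_proj_id:
  assumes i: "i \<in> {1..k}" and v: "v \<in> F i x" shows "\<pi> i x v = v"
proof -
  have vf: "v \<in> fibre W x" using filtration_fibre[of i v x] v i by simp
  obtain m where m: "subbundle_of_rank A W m (T i)" using complement_rank[OF i] by blast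
  obtain z where z: "z \<in> zero_sub W x" using zero_sub_subset(2)[OF W m] by blast
  obtain c where c: "c \<in> trivs W" "x \<in> fst c" using hol_vbundle_ex[OF W] by blast
  note ct = hol_vbundle_triv[OF W c(1)]
  have zf: "z \<in> fibre W x" "snd c x z = 0\<^sub>v (vb_rank W)" using z zero_sub_iff[OF W ct c(2)] by blast+
  have "fibre_add W x v z = v"
    by (rule fibre_add_unique[OF W vf zf(1) ct c(2) vf]) (use zf hol_trivD(5)[OF ct c(2) vf] in simp)
  then show ?thesis using proj_on(3)[OF sum[OF i] vf v, of z] zero_sub_subset(1)[OF W m] z by auto
qed

lemma filtration_proj_in: "i \<in> {1..k} \<Longrightarrow> v \<in> fibre W x \<Longrightarrow> \<pi> i x v \<in> F i x"
  by (rule proj_on(1)[OF sum])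

text \<open>Near a point this is a chain of holomorphic steps: to a trivialization adapted to
  \<open>F i\<close>, the projection, to the coordinates of the bundle \<open>F i\<close>, and
  truncation.\<close>

lemma hol_graded_coords:
  assumes i: "i \<in> {1..k}" and b: "hol_triv A W b" and d: "hol_triv A (Bd i) d" and q: "q \<le> sr i"
  shows "hol_lin (fibre W) (vb_rank W) q (snd b) (\<lambda>x v. vec_last (snd d x (\<pi> i x v)) q) (fst b \<inter> fst d)"
proof (rule hol_lin_local)
  have i': "i \<le> k" using i by simp
  note Fi = F_sub[OF i']
  obtain m where m: "subbundle_of_rank A W m (T i)" using complement_rank[OF i] by blast
  show "open (fst b \<inter> fst d)" by (intro open_Int hol_trivD(1)[OF b] hol_trivD(1)[OF d])
  show "snd b x ` fibre W x = carrier_vec (vb_rank W)" if "x \<in> fst b \<inter> fst d" for x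
    using hol_trivD(3)[OF b] that by blast
  fix x assume x: "x \<in> fst b \<inter> fst d"
  obtain e where e: "x \<in> fst e" "adapted_triv A W (sr i) (F i) e" using subbundleD(3)[OF Fi] by blast
  note et = adapted_trivD(1)[OF e(2)]
  let ?N = "fst b \<inter> fst d \<inter> fst e" and ?n = "vb_rank W"
  have 1: "hol_lin (fibre W) ?n ?n (snd b) (snd e) ?N"
    by (rule hol_lin_subset[OF hol_triv_transition[OF W b et]]) auto
  have 2: "hol_lin (fibre W) ?n ?n (snd e) (\<lambda>x v. snd e x (\<pi> i x v)) ?N"
    by (rule hol_lin_subset[OF hol_proj_on[OF W Fi m sum[OF i] et]]) auto
  have 3: "hol_lin (fibre W) ?n (sr i) (\<lambda>x v. snd e x (\<pi> i x v)) (\<lambda>x v. snd d x (\<pi> i x v)) ?N"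
    by (rule hol_lin_pullback[OF hol_lin_subset[OF sub_bundle_coords[OF W Fi e(2) d]]]) (auto intro: filtration_proj_in[OF i])
  have 4: "hol_lin (fibre W) (sr i) q (\<lambda>x v. snd d x (\<pi> i x v)) (\<lambda>x v. vec_last (snd d x (\<pi> i x v)) q) ?N"
    by (rule hol_lin_vec_last[OF _ q]) (use hol_trivD(5)[OF d] filtration_proj_in[OF i] filtration_piece(3,4)[OF i] in auto)
  have bN: "snd b x v \<in> carrier_vec ?n" if "x \<in> ?N" "v \<in> fibre W x" for x v
    using hol_trivD(5)[OF b] that by blast
  have "hol_lin (fibre W) ?n q (snd b) (\<lambda>x v. vec_last (snd d x (\<pi> i x v)) q) ?N"
    by (rule hol_lin_trans[OF hol_lin_trans[OF hol_lin_trans[OF 1 2 bN] 3 bN] 4 bN])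
  then show "\<exists>S. open S \<and> x \<in> S \<and> hol_lin (fibre W) ?n q (snd b) (\<lambda>x v. vec_last (snd d x (\<pi> i x v)) q) (fst b \<inter> fst d \<inter> S)"
    using hol_trivD(1)[OF et] e(1) by blast
qed

lemma graded_simps:
  assumes i: "i \<in> {1..k}"
  shows "vb_rank (graded A W F i) = sr i - sr (i - 1)"
    "fibre (graded A W F i) x = (\<lambda>v. fibre_add (Bd i) x v ` F (i - 1) x) ` F i x"
    "trivs (graded A W F i) = {(fst c, \<lambda>x C. vec_last (snd c x (SOME v. v \<in> C)) (sr i - sr (i - 1))) | c.
       adapted_triv A (Bd i) (sr (i - 1)) (F (i - 1)) c}"
  unfolding graded_def quot_simps[OF filtration_piece(1,2)[OF i]] filtration_piece(3,4)[OF i] by (rule refl)+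

lemma splitting_in: "v \<in> fibre W x \<Longrightarrow> splitting W k F T x v \<in> fibre (direct_sum k (graded A W F)) x"
  unfolding direct_sum_simps(2) splitting_def
  by (rule restrict_PiE_iff[THEN iffD2]) (use filtration_proj_in in \<open>auto simp: graded_simps(2)\<close>)

lemma splitting_hom: "vb_hom A W (direct_sum k (graded A W F)) (splitting W k F T)"
  unfolding vb_hom_def
proof (intro conjI ballI allI)
  show "splitting W k F T x ` fibre W x \<subseteq> fibre (direct_sum k (graded A W F)) x" for x
    using splitting_in by blast
  fix b t assume b: "b \<in> trivs W" and t: "t \<in> trivs (direct_sum k (graded A W F))"
  note bt = hol_vbundle_triv[OF W b]
  let ?q = "\<lambda>i. sr i - sr (i - 1)" and ?n = "vb_rank W"
  obtain c where c: "\<And>i. i \<in> {1..k} \<Longrightarrow> c i \<in> trivs (graded A W F i)"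
    and t_eq: "t = (\<Inter>i\<in>{1..k}. fst (c i), \<lambda>x u. vec_of_list (concat (map (\<lambda>i. list_of_vec (snd (c i) x (u i))) [1..<Suc k])))"
    using t unfolding direct_sum_simps(3) by blast
  have "\<exists>d. adapted_triv A (Bd i) (sr (i - 1)) (F (i - 1)) d \<and>
      c i = (fst d, \<lambda>x C. vec_last (snd d x (SOME v. v \<in> C)) (?q i))" if "i \<in> {1..k}" for i
    using c[OF that] unfolding graded_simps(3)[OF that] by blast
  then obtain d where d: "\<And>i. i \<in> {1..k} \<Longrightarrow> adapted_triv A (Bd i) (sr (i - 1)) (F (i - 1)) (d i)"
    "\<And>i. i \<in> {1..k} \<Longrightarrow> c i = (fst (d i), \<lambda>x C. vec_last (snd (d i) x (SOME v. v \<in> C)) (?q i))" by metis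
  let ?U = "fst b \<inter> fst t"
  have Ud: "x \<in> fst (d i)" if "x \<in> ?U" "i \<in> {1..k}" for x i
  proof -
    have "x \<in> fst (c i)" using that unfolding t_eq fst_conv by blast
    then show ?thesis unfolding d(2)[OF that(2)] fst_conv .
  qed
  \<comment> \<open>The representative chosen by \<open>SOME\<close> in the quotient coordinates may
    be replaced by the projection itself, whose coordinates are known to be holomorphic.\<close>
  have sp: "snd (c i) x (splitting W k F T x v i) = vec_last (snd (d i) x (\<pi> i x v)) (?q i)"
    if x: "x \<in> ?U" and v: "v \<in> fibre W x" and i: "i \<in> {1..k}" for x v i
    using coset_rep[OF filtration_piece(1,2)[OF i] d(1)[OF i] Ud[OF x i], of "\<pi> i x v"] filtration_proj_in[OF i v] i
    unfolding d(2)[OF i] snd_conv splitting_def filtration_piece(3,4)[OF i] by simp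
  have "hol_lin (fibre W) ?n (sum_list (map ?q [1..<Suc k])) (snd b)
     (\<lambda>x v. vec_of_list (concat (map (\<lambda>i. list_of_vec (vec_last (snd (d i) x (\<pi> i x v)) (?q i))) [1..<Suc k]))) ?U"
  proof (rule hol_lin_concat)
    fix i assume "i \<in> set [1..<Suc k]"
    then have i: "i \<in> {1..k}" by auto
    show "hol_lin (fibre W) ?n (?q i) (snd b) (\<lambda>x v. vec_last (snd (d i) x (\<pi> i x v)) (?q i)) ?U"
      by (rule hol_lin_subset[OF hol_graded_coords[OF i bt adapted_trivD(1)[OF d(1)[OF i]]]]) (use Ud[OF _ i] in auto)
  qed (use hol_trivD(5)[OF bt] in auto)
  then have "hol_lin (fibre W) ?n (sum_list (map ?q [1..<Suc k])) (snd b) (\<lambda>x v. snd t x (splitting W k F T x v)) ?U"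
  proof (rule hol_lin_cong)
    fix x v assume xv: "x \<in> ?U" "v \<in> fibre W x"
    have "map (\<lambda>i. list_of_vec (vec_last (snd (d i) x (\<pi> i x v)) (?q i))) [1..<Suc k] =
      map (\<lambda>i. list_of_vec (snd (c i) x (splitting W k F T x v i))) [1..<Suc k]"
      by (rule map_cong[OF refl]) (use sp[OF xv] in auto)
    then show "vec_of_list (concat (map (\<lambda>i. list_of_vec (vec_last (snd (d i) x (\<pi> i x v)) (?q i))) [1..<Suc k])) =
        snd t x (splitting W k F T x v)" unfolding t_eq snd_conv by (rule arg_cong)
  qed simp
  moreover have "sum_list (map ?q [1..<Suc k]) = vb_rank (direct_sum k (graded A W F))"
    unfolding direct_sum_simps(1) by (subst interv_sum_list_conv_sum_set_nat) (auto simp: graded_simps(1) intro!: sum.cong)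
  ultimately show "\<exists>M. hmat (vb_rank (direct_sum k (graded A W F))) ?n M ?U \<and>
    (\<forall>x\<in>?U. \<forall>v\<in>fibre W x. snd t x (splitting W k F T x v) = M x *\<^sub>v snd b x v)"
    unfolding hol_lin_def by simp
qed

text \<open>Over a single point the trivialization \<open>c\<close> gives an instance of the algebra
  of filtered projections, from which bijectivity of the splitting is read off.\<close>

lemma pointwise_projections:
  assumes c: "c \<in> trivs W" "x \<in> fst c"
  obtains P where "filtered_projections (vb_rank W) k (\<lambda>i. snd c x ` F i x) P"
    "\<And>i v. i \<in> {1..k} \<Longrightarrow> v \<in> fibre W x \<Longrightarrow> snd c x (\<pi> i x v) = P i *\<^sub>v snd c x v"
proof -
  let ?n = "vb_rank W"
  note ct = hol_vbundle_triv[OF W c(1)]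
  have "\<exists>M. M \<in> carrier_mat ?n ?n \<and> (\<forall>v\<in>fibre W x. snd c x (\<pi> i x v) = M *\<^sub>v snd c x v)" if i: "i \<in> {1..k}" for i
  proof -
    have i': "i \<le> k" using i by simp
    obtain m where m: "subbundle_of_rank A W m (T i)" using complement_rank[OF i] by blast
    show ?thesis using hol_proj_on[OF W F_sub[OF i'] m sum[OF i] ct] c(2) hmatD(1) unfolding hol_lin_def by blast
  qed
  then obtain P where P: "\<And>i. i \<in> {1..k} \<Longrightarrow> P i \<in> carrier_mat ?n ?n"
    "\<And>i v. i \<in> {1..k} \<Longrightarrow> v \<in> fibre W x \<Longrightarrow> snd c x (\<pi> i x v) = P i *\<^sub>v snd c x v" by metis
  have "filtered_projections ?n k (\<lambda>i. snd c x ` F i x) P"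
  proof
    show "vsub ?n (snd c x ` F i x)" if "i \<le> k" for i
      by (rule subbundle_vsub[OF W F_sub[OF that] ct c(2)])
    have "F 0 = zero_sub W" "F k = fibre W" using filt by (simp_all add: filtration_def)
    obtain z where z: "z \<in> fibre W x" "snd c x z = 0\<^sub>v ?n" using triv_coords_ex[OF ct c(2) zero_carrier_vec] by blast
    then have "z \<in> zero_sub W x" using zero_sub_iff[OF W ct c(2)] by blast
    then show "snd c x ` F 0 x = {0\<^sub>v ?n}" unfolding \<open>F 0 = zero_sub W\<close>
      using zero_sub_iff[OF W ct c(2)] by (auto simp: image_iff)
    show "snd c x ` F k x = carrier_vec ?n" unfolding \<open>F k = fibre W\<close> by (rule hol_trivD(3)[OF ct c(2)])
    show "snd c x ` F i x \<subseteq> snd c x ` F j x" if "i \<le> j" "j \<le> k" for i j using filtration_mono[OF filt that] by (rule image_mono)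
    fix i assume i: "i \<in> {1..k}"
    show "P i \<in> carrier_mat ?n ?n" by (rule P(1)[OF i])
    show "P i *\<^sub>v y \<in> snd c x ` F i x" if y: "y \<in> carrier_vec ?n" for y
    proof -
      obtain v where v: "v \<in> fibre W x" "snd c x v = y" using triv_coords_ex[OF ct c(2) y] by blast
      show ?thesis using P(2)[OF i v(1)] filtration_proj_in[OF i v(1)] v(2) by (metis imageI)
    qed
    show "P i *\<^sub>v y = y" if yF: "y \<in> snd c x ` F i x" for y
    proof -
      obtain v where v: "v \<in> F i x" "y = snd c x v" using yF by blast
      have "v \<in> fibre W x" using filtration_fibre[of i v x] v(1) i by simp
      then show ?thesis using P(2)[OF i] filtration_proj_id[OF i v(1)] v(2) by metis
    qed
  qed
  from that[OF this P(2)] show thesis by blast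
qed

lemma splitting_mem_iff:
  assumes v: "v \<in> fibre W x"
  shows "splitting W k F T x v \<in> partial_sum k (graded A W F) I x \<longleftrightarrow> (\<forall>i\<in>{1..k} - I. \<pi> i x v \<in> F (i - 1) x)"
proof -
  have "splitting W k F T x v i \<in> zero_sub (graded A W F i) x \<longleftrightarrow> \<pi> i x v \<in> F (i - 1) x" if i: "i \<in> {1..k}" for i
    using coset_zero_iff[OF filtration_piece(1,2)[OF i], of "\<pi> i x v" x] filtration_proj_in[OF i v] i
    unfolding splitting_def graded_def filtration_piece(4)[OF i] by simp
  with splitting_in[OF v] show ?thesis unfolding partial_sum_def by auto
qed

lemma splitting_inj: "inj_on (splitting W k F T x) (fibre W x)"
proof (rule inj_onI)
  fix v w assume v: "v \<in> fibre W x" and w: "w \<in> fibre W x" and eq: "splitting W k F T x v = splitting W k F T x w"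
  obtain c where c: "c \<in> trivs W" "x \<in> fst c" using hol_vbundle_ex[OF W] by blast
  note ct = hol_vbundle_triv[OF W c(1)]
  note vc = hol_trivD(5)[OF ct c(2) v] and wc = hol_trivD(5)[OF ct c(2) w]
  obtain P where P: "filtered_projections (vb_rank W) k (\<lambda>i. snd c x ` F i x) P"
    "\<And>i v. i \<in> {1..k} \<Longrightarrow> v \<in> fibre W x \<Longrightarrow> snd c x (\<pi> i x v) = P i *\<^sub>v snd c x v"
    using pointwise_projections[OF c] by blast
  interpret fp: filtered_projections "vb_rank W" k "\<lambda>i. snd c x ` F i x" P by (rule P(1))
  have "snd c x v - snd c x w = 0\<^sub>v (vb_rank W)"
  proof (rule fp.graded_injective)
    fix i assume i: "i \<in> {1..k}"
    have "splitting W k F T x v i = splitting W k F T x w i" using eq by simp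
    then have "snd c x (\<pi> i x v) - snd c x (\<pi> i x w) \<in> snd c x ` F (i - 1) x"
      using graded_coset_eq_iff[OF i ct c(2) filtration_proj_in[OF i v] filtration_proj_in[OF i w]] i unfolding splitting_def by simp
    then show "P i *\<^sub>v (snd c x v - snd c x w) \<in> snd c x ` F (i - 1) x"
      unfolding P(2)[OF i v] P(2)[OF i w] by (simp add: mult_minus_distrib_mat_vec[OF fp.P_mat[OF i] vc wc])
  qed (use vc wc in simp)
  then have "snd c x v = snd c x w" using vc wc
    by (metis (no_types, lifting) carrier_vecD eq_vecI index_minus_vec(1) index_zero_vec(1) right_minus_eq)
  then show "v = w" using inj_onD[OF hol_trivD(4)[OF ct c(2)]] v w by blast
qed

text \<open>This serves twice: as compatibility with the filtration and, for \<open>j = k\<close>,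
  as surjectivity onto the direct sum.\<close>

lemma splitting_image:
  assumes j: "j \<le> k"
  shows "splitting W k F T x ` F j x = partial_sum k (graded A W F) {1..j} x"
proof (intro equalityI subsetI)
  fix u assume "u \<in> splitting W k F T x ` F j x"
  then obtain v where v: "v \<in> F j x" "u = splitting W k F T x v" by blast
  have "\<pi> i x v \<in> F (i - 1) x" if "i \<in> {1..k} - {1..j}" for i
  proof -
    have i: "i \<in> {1..k}" "j \<le> i - 1" "i - 1 \<le> k" "j \<le> i" "i \<le> k" using that by auto
    have "v \<in> F i x" "v \<in> F (i - 1) x" using v(1) filtration_mono[OF filt i(4,5)] filtration_mono[OF filt i(2,3)] by blast+
    then show ?thesis using filtration_proj_id[OF i(1)] by simp
  qed
  then show "u \<in> partial_sum k (graded A W F) {1..j} x"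
    unfolding v(2) splitting_mem_iff[OF filtration_fibre[OF j v(1)]] by blast
next
  fix u assume u: "u \<in> partial_sum k (graded A W F) {1..j} x"
  have uP: "u \<in> PiE {1..k} (\<lambda>i. fibre (graded A W F i) x)"
    using u unfolding partial_sum_def direct_sum_simps(2) by blast
  have "\<exists>w\<in>F i x. u i = fibre_add (Bd i) x w ` F (i - 1) x" if "i \<in> {1..k}" for i
    using PiE_mem[OF uP that] unfolding graded_simps(2)[OF that] by blast
  then obtain r where r: "\<And>i. i \<in> {1..k} \<Longrightarrow> r i \<in> F i x"
    "\<And>i. i \<in> {1..k} \<Longrightarrow> u i = fibre_add (Bd i) x (r i) ` F (i - 1) x" by metis
  obtain c where c: "c \<in> trivs W" "x \<in> fst c" using hol_vbundle_ex[OF W] by blast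
  note ct = hol_vbundle_triv[OF W c(1)]
  obtain P where P: "filtered_projections (vb_rank W) k (\<lambda>i. snd c x ` F i x) P"
    "\<And>i v. i \<in> {1..k} \<Longrightarrow> v \<in> fibre W x \<Longrightarrow> snd c x (\<pi> i x v) = P i *\<^sub>v snd c x v"
    using pointwise_projections[OF c] by blast
  interpret fp: filtered_projections "vb_rank W" k "\<lambda>i. snd c x ` F i x" P by (rule P(1))
  \<comment> \<open>Solving only for the components up to \<open>j\<close> keeps the preimage in
    \<open>F j\<close>; the components beyond \<open>j\<close> are then right automatically.\<close>
  obtain y where y: "y \<in> snd c x ` F j x" "\<And>i. i \<in> {1..j} \<Longrightarrow> P i *\<^sub>v y - snd c x (r i) \<in> snd c x ` F (i - 1) x"
    using fp.graded_surjective[OF j, of "\<lambda>i. snd c x (r i)"] r(1) by blast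
  then obtain v where v: "v \<in> F j x" "y = snd c x v" by blast
  have vf: "v \<in> fibre W x" by (rule filtration_fibre[OF j v(1)])
  have "splitting W k F T x v = u"
  proof
    fix i
    show "splitting W k F T x v i = u i"
    proof (cases "i \<in> {1..k}")
      case False
      then show ?thesis using PiE_arb[OF uP False] unfolding splitting_def by (simp only: restrict_apply if_False)
    next
      case i: True
      have "snd c x (\<pi> i x v) - snd c x (r i) \<in> snd c x ` F (i - 1) x"
      proof (cases "i \<le> j")
        case True
        then show ?thesis using y(2)[of i] i P(2)[OF i vf] v(2) by simp
      next
        \<comment> \<open>Here both classes are zero: that of \<open>u\<close> by the definition of
          the partial sum, that of \<open>v\<close> because \<open>v\<close> is its own projection
          and already lies in \<open>F (i - 1)\<close>.\<close>
        case False
        then have i': "i \<in> {1..k} - {1..j}" "j \<le> i - 1" "i - 1 \<le> k" using i by auto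
        have "u i \<in> zero_sub (graded A W F i) x" using u i'(1) unfolding partial_sum_def by blast
        then have "r i \<in> F (i - 1) x"
          using coset_zero_iff[OF filtration_piece(1,2)[OF i], of "r i" x] r[OF i] unfolding graded_def filtration_piece(4)[OF i] by simp
        moreover have "v \<in> F (i - 1) x" by (rule subsetD[OF filtration_mono[OF filt i'(2,3)] v(1)])
        moreover have "\<pi> i x v = v"
        proof (rule filtration_proj_id[OF i])
          have "j \<le> i" "i \<le> k" using False i by auto
          then show "v \<in> F i x" by (rule subsetD[OF filtration_mono[OF filt] v(1)])
        qed
        ultimately show ?thesis using vsubD(5)[OF fp.F_sub[OF i'(3)]] by simp
      qed
      then show ?thesis
        using graded_coset_eq_iff[OF i ct c(2) filtration_proj_in[OF i vf] r(1)[OF i]] r(2)[OF i] i unfolding splitting_def by simp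
    qed
  qed
  with v(1) show "u \<in> splitting W k F T x ` F j x" by blast
qed

lemma splitting_iso: "vb_iso A W (direct_sum k (graded A W F)) (splitting W k F T)"
  unfolding vb_iso_def
proof (intro conjI allI splitting_hom)
  fix x
  have "F k = fibre W" using filt unfolding filtration_def by blast
  moreover have "partial_sum k (graded A W F) {1..k} x = fibre (direct_sum k (graded A W F)) x"
    by (auto simp: partial_sum_def)
  ultimately show "bij_betw (splitting W k F T x) (fibre W x) (fibre (direct_sum k (graded A W F)) x)"
    using splitting_image[OF order_refl, of x] splitting_inj by (simp add: bij_betw_def)
qed

text \<open>Since \<open>F i\<close> and \<open>T i\<close> are both invariant, the projections
  commute with the Higgs field. It therefore preserves the conditions of
  \<open>splitting_mem_iff\<close>, which ask certain projections of \<open>v\<close> to lie in the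
  invariant \<open>F (i - 1)\<close>.\<close>

lemma splitting_invariant:
  assumes L: "hol_vbundle A L" "vb_rank L = 1" and \<Phi>: "vb_hom A W (line_tensor L W) \<Phi>"
    and F_inv: "\<And>i. i \<in> {1..k} \<Longrightarrow> higgs_invariant L W \<Phi> (F i)"
    and T_inv: "\<And>i. i \<in> {1..k} \<Longrightarrow> higgs_invariant L W \<Phi> (T i)"
  shows "higgs_invariant L W \<Phi> (\<lambda>x. {v \<in> fibre W x. splitting W k F T x v \<in> partial_sum k (graded A W F) I x})"
  unfolding higgs_invariant_def
proof
  fix x
  let ?n = "vb_rank W" and ?S = "\<lambda>x. {v \<in> fibre W x. splitting W k F T x v \<in> partial_sum k (graded A W F) I x}"
  obtain c where c: "c \<in> trivs W" "x \<in> fst c" using hol_vbundle_ex[OF W] by blast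
  note ct = hol_vbundle_triv[OF W c(1)]
  obtain M where M: "M \<in> carrier_mat ?n ?n"
    "\<And>S y. S x \<subseteq> fibre W x \<Longrightarrow> vsub ?n (snd c x ` S x) \<Longrightarrow> \<Phi> x ` S x \<subseteq> tensor_sub L W S x \<Longrightarrow>
       y \<in> snd c x ` S x \<Longrightarrow> M *\<^sub>v y \<in> snd c x ` S x"
    "\<And>S. S x \<subseteq> fibre W x \<Longrightarrow> (\<And>y. y \<in> snd c x ` S x \<Longrightarrow> M *\<^sub>v y \<in> snd c x ` S x) \<Longrightarrow>
       \<Phi> x ` S x \<subseteq> tensor_sub L W S x"
    by (rule higgs_pointwise[OF L W \<Phi> c]) blast
  obtain P where P: "filtered_projections ?n k (\<lambda>i. snd c x ` F i x) P"
    "\<And>i v. i \<in> {1..k} \<Longrightarrow> v \<in> fibre W x \<Longrightarrow> snd c x (\<pi> i x v) = P i *\<^sub>v snd c x v"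
    using pointwise_projections[OF c] by blast
  interpret fp: filtered_projections ?n k "\<lambda>i. snd c x ` F i x" P by (rule P(1))
  have MF: "M *\<^sub>v y \<in> snd c x ` F i x" if i: "i \<le> k" and y: "y \<in> snd c x ` F i x" for i y
  proof (cases "i = 0")
    case True
    have "M *\<^sub>v 0\<^sub>v ?n = 0\<^sub>v ?n" using M(1) by (intro eq_vecI) auto
    then show ?thesis using y fp.F_zero unfolding True by simp
  next
    case False
    then have "i \<in> {1..k}" using i by simp
    from M(2)[of "F i", OF subbundleD(2)[OF F_sub[OF i]] fp.F_sub[OF i] _ y] F_inv[OF this]
    show ?thesis unfolding higgs_invariant_def by blast
  qed
  have MT: "M *\<^sub>v y \<in> snd c x ` T i x" if i: "i \<in> {1..k}" and y: "y \<in> snd c x ` T i x" for i y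
  proof -
    obtain m where m: "subbundle_of_rank A W m (T i)" using complement_rank[OF i] by blast
    from M(2)[of "T i", OF subbundleD(2)[OF m] subbundle_vsub[OF W m ct c(2)] _ y] T_inv[OF i]
    show ?thesis unfolding higgs_invariant_def by blast
  qed
  show "\<Phi> x ` ?S x \<subseteq> tensor_sub L W ?S x"
  proof (rule M(3))
    fix y assume "y \<in> snd c x ` ?S x"
    then obtain v where v: "v \<in> fibre W x" "\<And>i. i \<in> {1..k} - I \<Longrightarrow> \<pi> i x v \<in> F (i - 1) x" "y = snd c x v"
      using splitting_mem_iff by blast
    have "M *\<^sub>v y \<in> carrier_vec ?n" using M(1) hol_trivD(5)[OF ct c(2) v(1)] v(3) by simp
    \<comment> \<open>\<open>u\<close> stands for the image of \<open>v\<close> under the Higgs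
      field, with its factor in \<open>L\<close> normalized away.\<close>
    then obtain u where u: "u \<in> fibre W x" "snd c x u = M *\<^sub>v y" by (rule triv_coords_ex[OF ct c(2)])
    have "\<pi> i x u \<in> F (i - 1) x" if iI: "i \<in> {1..k} - I" for i
    proof -
      have i: "i \<in> {1..k}" "i \<le> k" "i - 1 \<le> k" using iI by auto
      obtain m where m: "subbundle_of_rank A W m (T i)" using complement_rank[OF i(1)] by blast
      obtain t where t: "t \<in> T i x" "v = fibre_add W x (\<pi> i x v) t" using proj_on(2)[OF sum[OF i(1)] v(1)] by blast
      have tf: "t \<in> fibre W x" using t(1) subbundleD(2)[OF m] by blast
      have p: "\<pi> i x v \<in> F i x" by (rule filtration_proj_in[OF i(1) v(1)])
      have pf: "\<pi> i x v \<in> fibre W x" by (rule filtration_fibre[OF i(2) p])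
      have yc: "y = snd c x (\<pi> i x v) + snd c x t" using fibre_add(2)[OF W pf tf ct c(2)] t(2) v(3) by metis
      have My: "M *\<^sub>v y = M *\<^sub>v snd c x (\<pi> i x v) + M *\<^sub>v snd c x t"
        unfolding yc by (rule mult_add_distrib_mat_vec[OF M(1) hol_trivD(5)[OF ct c(2) pf] hol_trivD(5)[OF ct c(2) tf]])
      have "M *\<^sub>v snd c x (\<pi> i x v) \<in> snd c x ` F (i - 1) x" by (rule MF[OF i(3)]) (use v(2)[OF iI] in blast)
      then obtain p' where p': "p' \<in> F (i - 1) x" "M *\<^sub>v snd c x (\<pi> i x v) = snd c x p'" by blast
      obtain t' where t': "t' \<in> T i x" "M *\<^sub>v snd c x t = snd c x t'" using MT[OF i(1), of "snd c x t"] t(1) by blast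
      have p'F: "p' \<in> F i x" using filtration_mono[OF filt, of "i - 1" i x] i(2) p'(1) by auto
      have p't'f: "p' \<in> fibre W x" "t' \<in> fibre W x" using filtration_fibre[OF i(2) p'F] t'(1) subbundleD(2)[OF m] by blast+
      \<comment> \<open>Applying \<open>M\<close> to the decomposition of \<open>v\<close>
        decomposes \<open>u\<close> along the same summands, so by uniqueness \<open>p'\<close> is
        the projection of \<open>u\<close>.\<close>
      have "fibre_add W x p' t' = u"
        by (rule fibre_add_unique[OF W p't'f ct c(2) u(1)]) (simp only: u(2) My p'(2) t'(2))
      then have "\<pi> i x u = p'" using proj_on(3)[OF sum[OF i(1)] u(1) p'F t'(1)] by simp
      with p'(1) show ?thesis by simp
    qed
    then have "u \<in> ?S x" using u(1) splitting_mem_iff[OF u(1)] by blast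
    then show "M *\<^sub>v y \<in> snd c x ` ?S x" unfolding u(2)[symmetric] by (rule imageI)
  qed blast
qed

end

end

section \<open>Stability\<close>

context compact_riemann_surface begin

text \<open>The strict step at the bottom separates \<open>F i\<close> from 0, and the strict step
  following \<open>F i\<close> separates it from \<open>W\<close>.\<close>

lemma filtration_strict:
  assumes filt: "filtration A W k F" and i: "i \<in> {1..<k}"
  shows "subbundle A W (F i)" "F i \<noteq> zero_sub W" "F i \<noteq> fibre W"
proof -
  have k: "i \<le> k" "i < k" "0 < k" "1 \<le> i" using i by auto
  show "subbundle A W (F i)" using filt k(1) unfolding filtration_def by blast
  have z: "F 0 = zero_sub W" and f: "F k = fibre W" using filt unfolding filtration_def by blast+
  have "F 0 \<noteq> F (Suc 0)" "F i \<noteq> F (Suc i)" using filt k unfolding filtration_def by blast+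
  moreover have "F 0 x \<subseteq> F (Suc 0) x" "F (Suc 0) x \<subseteq> F i x" "F i x \<subseteq> F (Suc i) x" "F (Suc i) x \<subseteq> F k x" for x
    using filtration_mono[OF filt, of _ _ x] k by simp_all
  ultimately show "F i \<noteq> zero_sub W" "F i \<noteq> fibre W"
    unfolding z[symmetric] f[symmetric] by (metis ext subset_antisym)+
qed

lemma semistable_iff:
  assumes W: "hol_vbundle A W" and \<tau>: "vb_iso A (det_bundle W) trivial_line_bundle \<tau>"
  shows "higgs_semistable A L W \<Phi> \<longleftrightarrow>
    (\<forall>S. subbundle A W S \<and> higgs_invariant L W \<Phi> S \<longrightarrow> sub_degree A W S \<le> 0)"
proof (intro iffI allI impI)
  fix S assume ss: "higgs_semistable A L W \<Phi>" and S: "subbundle A W S \<and> higgs_invariant L W \<Phi> S"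
  let ?n = "vb_rank W"
  obtain m where m: "subbundle_of_rank A W m S" using S by (auto simp: subbundle_def)
  show "sub_degree A W S \<le> 0"
  \<comment> \<open>For these two the test filtration would contain a repeated term.\<close>
  proof (cases "S = zero_sub W \<or> S = fibre W")
    case True
    then show ?thesis using sub_degree_zero_sub[OF W] sub_degree_fibre[OF W \<tau>] by auto
  next
    case False
    define F where "F i = (if i = 0 then zero_sub W else if i = 1 then S else fibre W)" for i :: nat
    \<comment> \<open>The weights \<open>m - ?n\<close> on \<open>S\<close> and \<open>m\<close> on
      the quotient satisfy \<open>m * (m - ?n) + (?n - m) * m = 0\<close>. Their jump is
      \<open>?n\<close>, so the degree of the filtration is \<open>- ?n\<close> times the degree of
      \<open>S\<close>.\<close>
    define l where "l i = (if i = 1 then real m - real ?n else real m)" for i :: nat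
    \<comment> \<open>In rank 0 the subbundle would be all of \<open>W\<close>; a positive rank is
      what allows dividing by \<open>?n\<close> at the end.\<close>
    have "?n \<noteq> 0"
    proof
      assume "?n = 0"
      have "S x = fibre W x" for x
      proof -
        obtain c where c: "x \<in> fst c" "adapted_triv A W m S c" using subbundleD(3)[OF m] by blast
        show ?thesis using adapted_mem_iff[OF c(2,1) subbundleD(2)[OF m]] subbundleD(2)[OF m, of x] \<open>?n = 0\<close> by auto
      qed
      then show False using False by auto
    qed
    have filt: "filtration A W 2 F"
      unfolding filtration_def
    proof (intro conjI allI impI)
      show "subbundle A W (F i)" for i
        using S zero_sub_subbundle[OF W] fibre_subbundle[OF W] by (auto simp: F_def subbundle_def)
      show "F i x \<subseteq> F (Suc i) x" if "i < 2" for i x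
        using that zero_sub_subset(1)[OF W m] subbundleD(2)[OF m] by (auto simp: F_def less_2_cases_iff)
      show "F i \<noteq> F (Suc i)" if "i < 2" for i
        using that False by (auto simp: F_def less_2_cases_iff)
    qed (simp_all add: F_def)
    have two: "{1..<2} = {1::nat}" "{1..2} = {1, 2::nat}" by auto
    have "sub_rank A W (F 1) = m" "sub_rank A W (F 2) = ?n"
      using sub_rank_eq[OF W m] sub_rank_eq[OF W fibre_subbundle[OF W]] by (simp_all add: F_def)
    then have "l \<in> weights A W 2 F"
      by (simp add: weights_def two l_def algebra_simps numeral_2_eq_2)
    moreover have "in_N L W 2 F l \<Phi>" using S by (simp add: in_N_def two F_def)
    ultimately have "filt_degree A W 2 F l \<ge> 0" using ss filt unfolding higgs_semistable_def by blast
    then have "- real ?n * real_of_int (sub_degree A W S) \<ge> 0"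
      by (simp add: filt_degree_def two l_def F_def)
    then show ?thesis using \<open>?n \<noteq> 0\<close> by (simp add: mult_le_0_iff)
  qed
next
  assume H: "\<forall>S. subbundle A W S \<and> higgs_invariant L W \<Phi> S \<longrightarrow> sub_degree A W S \<le> 0"
  show "higgs_semistable A L W \<Phi>" unfolding higgs_semistable_def
  proof (intro allI impI)
    fix k F l assume a: "filtration A W k F \<and> l \<in> weights A W k F \<and> in_N L W k F l \<Phi>"
    show "filt_degree A W k F l \<ge> 0" unfolding filt_degree_def
    proof (rule sum_nonneg)
      fix j assume j: "j \<in> {1..<k}"
      have le: "l j \<le> l (Suc j)" using a j by (simp add: weights_def)
      show "(l j - l (Suc j)) * real_of_int (sub_degree A W (F j)) \<ge> 0"
      proof (cases "l j < l (Suc j)")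
        case True
        then have "higgs_invariant L W \<Phi> (F j)" using a j unfolding in_N_def by blast
        then have "sub_degree A W (F j) \<le> 0" using H filtration_strict(1) a j by blast
        then show ?thesis using le by (intro mult_nonpos_nonpos) auto
      qed (use le in simp)
    qed
  qed
qed

text \<open>Every summand of the degree is nonnegative, and positive where the weights jump. What
  remains is to find a jump for weights that do not all vanish.\<close>

lemma stable_if:
  assumes W: "hol_vbundle A W"
    and H: "\<And>S. subbundle A W S \<Longrightarrow> S \<noteq> zero_sub W \<Longrightarrow> S \<noteq> fibre W \<Longrightarrow> higgs_invariant L W \<Phi> S \<Longrightarrow> sub_degree A W S < 0"
  shows "higgs_stable A L W \<Phi>"
proof -
  have summand: "(l j - l (Suc j)) * real_of_int (sub_degree A W (F j)) \<ge> 0"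
    "l j < l (Suc j) \<Longrightarrow> (l j - l (Suc j)) * real_of_int (sub_degree A W (F j)) > 0"
    if a: "filtration A W k F" "l \<in> weights A W k F" "in_N L W k F l \<Phi>" and j: "j \<in> {1..<k}" for k F l j
  proof -
    have le: "l j \<le> l (Suc j)" using a(2) j by (simp add: weights_def)
    show *: "(l j - l (Suc j)) * real_of_int (sub_degree A W (F j)) > 0" if lt: "l j < l (Suc j)"
    proof -
      have "higgs_invariant L W \<Phi> (F j)" using a(3) j lt unfolding in_N_def by blast
      then have "sub_degree A W (F j) < 0" using H filtration_strict[OF a(1) j] by blast
      then show ?thesis using lt by (intro mult_neg_neg) auto
    qed
    show "(l j - l (Suc j)) * real_of_int (sub_degree A W (F j)) \<ge> 0"
      using le * by (cases "l j < l (Suc j)") auto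
  qed
  show ?thesis unfolding higgs_stable_def higgs_semistable_def
  proof (intro conjI allI impI)
    fix k F l assume "filtration A W k F \<and> l \<in> weights A W k F \<and> in_N L W k F l \<Phi>"
    then show "filt_degree A W k F l \<ge> 0" unfolding filt_degree_def using summand(1) by (intro sum_nonneg) blast
  next
    fix k F l
    assume "filtration A W k F \<and> l \<in> weights A W k F \<and> (\<exists>i\<in>{1..k}. l i \<noteq> 0) \<and> in_N L W k F l \<Phi>"
    then have a: "filtration A W k F" "l \<in> weights A W k F" "in_N L W k F l \<Phi>" and nz: "\<exists>i\<in>{1..k}. l i \<noteq> 0" by blast+
    have mono: "l i \<le> l (Suc i)" if "i \<in> {1..<k}" for i using a(2) that by (simp add: weights_def)
    \<comment> \<open>Without a jump all weights equal \<open>l k\<close>, and the linear condition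
      says that the rank times \<open>l k\<close> is 0. The rank would then be 0, and the filtration
      could have no strict step.\<close>
    have "\<exists>j\<in>{1..<k}. l j < l (Suc j)"
    proof (rule ccontr)
      assume "\<not> (\<exists>j\<in>{1..<k}. l j < l (Suc j))"
      then have eq: "l i = l (Suc i)" if "i \<in> {1..<k}" for i using mono[OF that] that by (meson antisym_conv2)
      have const: "l i = l k" if "i \<le> k" "1 \<le> i" for i
        using that(1)
      proof (induction i rule: inc_induct)
        case (step j)
        have "l j = l (Suc j)" by (rule eq) (use step \<open>1 \<le> i\<close> in simp)
        with step.IH show ?case by simp
      qed simp
      obtain i where i: "i \<in> {1..k}" "l i \<noteq> 0" using nz by blast
      then have "l k \<noteq> 0" "1 \<le> k" using const[of i] by auto
      have "F 0 = zero_sub W" "F k = fibre W" using a(1) unfolding filtration_def by blast+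
      have "(\<Sum>i=1..k. real (sub_rank A W (F i)) * (l i - (if i = k then 0 else l (Suc i)))) =
        (\<Sum>i=1..k. if i = k then real (sub_rank A W (F k)) * l k else 0)"
      proof (rule sum.cong[OF refl])
        fix i assume "i \<in> {1..k}"
        then show "real (sub_rank A W (F i)) * (l i - (if i = k then 0 else l (Suc i))) =
            (if i = k then real (sub_rank A W (F k)) * l k else 0)"
          using eq[of i] by (cases "i = k") simp_all
      qed
      also have "\<dots> = real (vb_rank W) * l k"
        using \<open>1 \<le> k\<close> sub_rank_eq[OF W fibre_subbundle[OF W]] by (simp add: \<open>F k = fibre W\<close>)
      finally have r0: "vb_rank W = 0" using a(2) \<open>l k \<noteq> 0\<close> by (simp add: weights_def)
      have "F k x \<subseteq> F 0 x" for x
      proof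
        fix v assume "v \<in> F k x"
        then have v: "v \<in> fibre W x" by (simp add: \<open>F k = fibre W\<close>)
        obtain c where c: "c \<in> trivs W" "x \<in> fst c" using hol_vbundle_ex[OF W] by blast
        note ct = hol_vbundle_triv[OF W c(1)]
        have "snd c x v = 0\<^sub>v (vb_rank W)"
          using hol_trivD(5)[OF ct c(2) v] r0 by (intro eq_vecI) auto
        with v show "v \<in> F 0 x" unfolding \<open>F 0 = zero_sub W\<close> zero_sub_iff[OF W ct c(2)] by blast
      qed
      moreover have "F 0 x \<subseteq> F (Suc 0) x" "F (Suc 0) x \<subseteq> F k x" for x
        using filtration_mono[OF a(1), of _ _ x] \<open>1 \<le> k\<close> by simp_all
      ultimately have "F 0 x = F (Suc 0) x" for x by blast
      then have "F 0 = F (Suc 0)" by (rule ext)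
      moreover have "F 0 \<noteq> F (Suc 0)" using a(1) \<open>1 \<le> k\<close> unfolding filtration_def by force
      ultimately show False by blast
    qed
    then obtain j where j: "j \<in> {1..<k}" "l j < l (Suc j)" by blast
    show "filt_degree A W k F l > 0" unfolding filt_degree_def
      by (rule sum_pos2[OF _ j(1)]) (use summand[OF a] j in auto)
  qed
qed

lemma polystable_if:
  assumes L: "hol_vbundle A L" "vb_rank L = 1" and W: "hol_vbundle A W"
    and \<tau>: "vb_iso A (det_bundle W) trivial_line_bundle \<tau>"
    and \<Phi>: "vb_hom A W (line_tensor L W) \<Phi>"
    and ss: "higgs_semistable A L W \<Phi>"
    and H: "\<And>S. subbundle A W S \<Longrightarrow> higgs_invariant L W \<Phi> S \<Longrightarrow> sub_degree A W S = 0 \<Longrightarrow>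
      \<exists>T. subbundle A W T \<and> higgs_invariant L W \<Phi> T \<and> internal_sum W S T"
  shows "higgs_polystable A L W \<Phi>"
  unfolding higgs_polystable_def
proof (intro conjI allI impI)
  show "higgs_semistable A L W \<Phi>" by (rule ss)
  fix k F l
  assume "filtration A W k F \<and> l \<in> weights A W k F \<and> (\<forall>i\<in>{1..<k}. l i < l (Suc i)) \<and>
        in_N L W k F l \<Phi> \<and> filt_degree A W k F l = 0"
  then have filt: "filtration A W k F" and lt: "\<And>i. i \<in> {1..<k} \<Longrightarrow> l i < l (Suc i)"
    and N: "in_N L W k F l \<Phi>" and d0: "filt_degree A W k F l = 0" by blast+
  have sub: "subbundle A W (F i)" if "i \<le> k" for i using filt that unfolding filtration_def by blast
  have Fk: "F k = fibre W" using filt unfolding filtration_def by blast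
  have inv: "higgs_invariant L W \<Phi> (F i)" if "i \<in> {1..<k}" for i using N lt that unfolding in_N_def by blast
  \<comment> \<open>A vanishing sum of nonnegative terms has only zero terms, and the strictly
    increasing weights allow cancelling the coefficients.\<close>
  have deg: "sub_degree A W (F i) = 0" if i: "i \<in> {1..<k}" for i
  proof -
    have nonneg: "(l j - l (Suc j)) * real_of_int (sub_degree A W (F j)) \<ge> 0" if j: "j \<in> {1..<k}" for j
    proof -
      have "sub_degree A W (F j) \<le> 0"
        using semistable_iff[OF W \<tau>, of L \<Phi>] ss inv[OF j] filtration_strict(1)[OF filt j] by blast
      then show ?thesis using lt[OF j] by (intro mult_nonpos_nonpos) auto
    qed
    have "\<forall>j\<in>{1..<k}. (l j - l (Suc j)) * real_of_int (sub_degree A W (F j)) = 0"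
      using d0 unfolding filt_degree_def by (subst (asm) sum_nonneg_eq_0_iff) (use nonneg in auto)
    then have "(l i - l (Suc i)) * real_of_int (sub_degree A W (F i)) = 0" using i by blast
    then show ?thesis using lt[OF i] by simp
  qed
  \<comment> \<open>The last term \<open>F k = W\<close> is included, since the splitting uses a
    projection for every index in \<open>{1..k}\<close>; its degree is 0 because the determinant is
    trivial.\<close>
  have ids: "higgs_invariant L W \<Phi> (F i) \<and> sub_degree A W (F i) = 0" if "i \<in> {1..k}" for i
  proof (cases "i = k")
    case True
    then show ?thesis using higgs_range[OF \<Phi>] sub_degree_fibre[OF W \<tau>] Fk by simp
  next
    case False
    then show ?thesis using inv deg that by simp
  qed
  have "\<exists>T. subbundle A W T \<and> higgs_invariant L W \<Phi> T \<and> internal_sum W (F i) T" if "i \<in> {1..k}" for i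
    using H[OF sub] ids[OF that] that by simp
  then obtain T where T: "\<And>i. i \<in> {1..k} \<Longrightarrow> subbundle A W (T i)" "\<And>i. i \<in> {1..k} \<Longrightarrow> higgs_invariant L W \<Phi> (T i)"
    "\<And>i. i \<in> {1..k} \<Longrightarrow> internal_sum W (F i) (T i)" by metis
  note ctx = W filt sub_rank[OF W sub] T(1,3)
  show "\<exists>h. vb_iso A W (direct_sum k (graded A W F)) h \<and>
           (\<forall>j\<le>k. \<forall>x. h x ` F j x = partial_sum k (graded A W F) {1..j} x) \<and>
           (\<forall>i\<in>{1..k}. higgs_invariant L W \<Phi>
              (\<lambda>x. {v \<in> fibre W x. h x v \<in> partial_sum k (graded A W F) {i} x}))"
  proof (intro exI[of _ "splitting W k F T"] conjI ballI allI impI)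
    show "vb_iso A W (direct_sum k (graded A W F)) (splitting W k F T)"
      by (rule splitting_iso[OF ctx])
    show "splitting W k F T x ` F j x = partial_sum k (graded A W F) {1..j} x" if "j \<le> k" for j x
      by (rule splitting_image[OF ctx that])
    show "higgs_invariant L W \<Phi> (\<lambda>x. {v \<in> fibre W x. splitting W k F T x v \<in> partial_sum k (graded A W F) {i} x})" for i
      by (rule splitting_invariant[OF ctx L \<Phi>]) (use ids T(2) in blast)+
  qed
qed

end

theorem theorem4p4:
  fixes A :: "'x::t2_space coord set"
    and L :: "('x, 'l) vbundle"
    and n :: nat
    and W :: "('x, 'w) vbundle"
    and \<tau> :: "'x \<Rightarrow> (('x, 'w) triv \<Rightarrow> complex) \<Rightarrow> complex"
    and \<Phi> :: "'x \<Rightarrow> 'w \<Rightarrow> ('l \<times> 'w) set"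
  assumes "compact_riemann_surface A"
    and "hol_line_bundle A L"
    and "SL_higgs_pair A L n W \<tau> \<Phi>"
  shows "(higgs_semistable A L W \<Phi> \<longleftrightarrow>
           (\<forall>S. subbundle A W S \<and> higgs_invariant L W \<Phi> S \<longrightarrow> sub_degree A W S \<le> 0)) \<and>
         ((\<forall>S. subbundle A W S \<and> S \<noteq> zero_sub W \<and> S \<noteq> fibre W \<and> higgs_invariant L W \<Phi> S \<longrightarrow>
              sub_degree A W S < 0) \<longrightarrow> higgs_stable A L W \<Phi>) \<and>
         (higgs_semistable A L W \<Phi> \<and>
          (\<forall>S. subbundle A W S \<and> higgs_invariant L W \<Phi> S \<and> sub_degree A W S = 0 \<longrightarrow>
              (\<exists>T. subbundle A W T \<and> higgs_invariant L W \<Phi> T \<and> internal_sum W S T)) \<longrightarrow>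
          higgs_polystable A L W \<Phi>)"
proof -
  interpret compact_riemann_surface A by (rule assms(1))
  have L: "hol_vbundle A L" "vb_rank L = 1" using assms(2) by (simp_all add: hol_line_bundle_def)
  have W: "hol_vbundle A W" and \<tau>: "vb_iso A (det_bundle W) trivial_line_bundle \<tau>"
    and \<Phi>: "vb_hom A W (line_tensor L W) \<Phi>"
    using assms(3) by (simp_all add: SL_higgs_pair_def)
  show ?thesis
  proof (intro conjI impI)
    show "higgs_stable A L W \<Phi>"
      if "\<forall>S. subbundle A W S \<and> S \<noteq> zero_sub W \<and> S \<noteq> fibre W \<and> higgs_invariant L W \<Phi> S \<longrightarrow> sub_degree A W S < 0"
      by (rule stable_if[OF W]) (use that in blast)
    show "higgs_polystable A L W \<Phi>"
      if "higgs_semistable A L W \<Phi> \<and> (\<forall>S. subbundle A W S \<and> higgs_invariant L W \<Phi> S \<and> sub_degree A W S = 0 \<longrightarrow>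
              (\<exists>T. subbundle A W T \<and> higgs_invariant L W \<Phi> T \<and> internal_sum W S T))"
      by (rule polystable_if[OF L W \<tau> \<Phi>]) (use that in blast)+
  qed (rule semistable_iff[OF W \<tau>])
qed

end
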